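(* For any system of $n\ge3$ qubits: (i) the group generated by the $\sqrt{\mathrm{iSWAP}}$ gates (on all pairs of qubits) and the single-qubit $S$ gates (on all qubits) contains a dense subgroup of $\mathcal{SV}_n^{\mathrm{U}(1)}$; (ii) the group generated by the $\sqrt{\mathrm{iSWAP}}$ gates on all pairs of qubits is a dense subgroup of $\mathcal{G}_n$.
   Context: $X,Y,Z$ are the Pauli matrices, $Z_j$ is $Z$ on qubit $j$; $\sqrt{\mathrm{iSWAP}}=\exp(i\frac{\pi}{8}(X\otimes X+Y\otimes Y))$; $S=\mathrm{diag}(1,i)$. A unitary $V$ on $n$ qubits commuting with $\sum_jZ_j$ decomposes as $V=\bigoplus_{m=0}^nV^{(m)}$, with $V^{(m)}$ acting on the span $\mathcal{H}^{(m)}$ of computational basis vectors of Hamming weight $m$. $\mathcal{SV}_n^{\mathrm{U}(1)}$ is the group of all such $V$ with $\det V^{(m)}=1$ for $m=0,\dots,n$. $\mathcal{G}_n$ is the group of $n$-qubit unitaries $V$ with: $[V,\sum_jZ_j]=0$; $X^{\otimes n}VX^{\otimes n}=V$; $\det V^{(m)}=1$ for all $m=0,\dots,n$; and, when $n$ is even, $\det V^{(n/2,\pm)}=1$, where $V^{(n/2,\pm)}$ is the restriction of $V^{(n/2)}$ to the $\pm1$ eigenspace of $X^{\otimes n}$ in $\mathcal{H}^{(n/2)}$. *)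

theory Defs
  imports "HOL-Analysis.Analysis" "HOL-Algebra.Generated_Groups"
begin

text \<open>
  The type \<open>'n\<close> indexes the qubits. A computational basis vector is a bit string
  \<open>x :: 'n \<Rightarrow> bool\<close> with \<open>x j\<close> meaning that qubit \<open>j\<close> is in state 1, and row and column
  indices of a single-qubit matrix are ordered as False = 0, True = 1. Beware that \<open>*\<close> and \<open>^\<close>
  on \<^typ>\<open>complex^'a^'a\<close> are componentwise; the matrix product is \<open>**\<close>.
\<close>

type_synonym 'a cmat = "complex^'a^'a"
type_synonym 'n qop = "('n \<Rightarrow> bool) cmat"

definition adjoint_mat :: "'a::finite cmat \<Rightarrow> 'a cmat" where
  "adjoint_mat A = (\<chi> x y. cnj (A $ y $ x))"

definition unitary :: "'a::finite cmat \<Rightarrow> bool" where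
  "unitary U \<longleftrightarrow> adjoint_mat U ** U = mat 1 \<and> U ** adjoint_mat U = mat 1"

definition unitary_group :: "'a::finite cmat monoid" where
  "unitary_group = \<lparr>carrier = {U. unitary U}, mult = (**), one = mat 1\<rparr>"

definition mat_exp :: "'a::finite cmat \<Rightarrow> 'a cmat" where
  "mat_exp A = (\<Sum>k. (1 / fact k) *\<^sub>R (((**) A ^^ k) (mat 1)))"

definition cscale :: "complex \<Rightarrow> 'a::finite cmat \<Rightarrow> 'a cmat" where
  "cscale c A = (\<chi> x y. c * A $ x $ y)"


subsection \<open>Gates\<close>

definition pauli_X :: "bool cmat" where
  "pauli_X = (\<chi> a b. if a = b then 0 else 1)"

definition pauli_Y :: "bool cmat" where
  "pauli_Y = (\<chi> a b. if a = b then 0 else if a then \<i> else - \<i>)"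

definition pauli_Z :: "bool cmat" where
  "pauli_Z = (\<chi> a b. if a = b then (if a then - 1 else 1) else 0)"

definition S_gate :: "bool cmat" where
  "S_gate = (\<chi> a b. if a = b then (if a then \<i> else 1) else 0)"

definition tensor :: "'a::finite cmat \<Rightarrow> 'b::finite cmat \<Rightarrow> ('a \<times> 'b) cmat" where
  "tensor A B = (\<chi> p q. A $ fst p $ fst q * B $ snd p $ snd q)"

definition sqrt_iSWAP :: "(bool \<times> bool) cmat" where
  "sqrt_iSWAP =
     mat_exp (cscale (\<i> * of_real (pi / 8)) (tensor pauli_X pauli_X + tensor pauli_Y pauli_Y))"

text \<open>
  \<open>on_qubit j A\<close> and \<open>on_pair j k A\<close> (for \<open>j \<noteq> k\<close>) let \<open>A\<close> act on the given qubits and the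
  identity on all others; \<open>on_all A\<close> is the tensor power of \<open>A\<close> over all qubits.
\<close>

definition on_qubit :: "'n::finite \<Rightarrow> bool cmat \<Rightarrow> 'n qop" where
  "on_qubit j A = (\<chi> x y. if \<forall>l. l \<noteq> j \<longrightarrow> x l = y l then A $ x j $ y j else 0)"

definition on_pair :: "'n::finite \<Rightarrow> 'n \<Rightarrow> (bool \<times> bool) cmat \<Rightarrow> 'n qop" where
  "on_pair j k A =
     (\<chi> x y. if \<forall>l. l \<noteq> j \<and> l \<noteq> k \<longrightarrow> x l = y l then A $ (x j, x k) $ (y j, y k) else 0)"

definition on_all :: "bool cmat \<Rightarrow> 'n::finite qop" where
  "on_all A = (\<chi> x y. \<Prod>j\<in>UNIV. A $ x j $ y j)"

definition sqrt_iSWAP_gates :: "'n::finite qop set" where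
  "sqrt_iSWAP_gates = {on_pair j k sqrt_iSWAP | j k. j \<noteq> k}"

definition S_gates :: "'n::finite qop set" where
  "S_gates = {on_qubit j S_gate | j. True}"


subsection \<open>Charge sectors and determinants of restrictions\<close>

definition hamming_weight :: "('n::finite \<Rightarrow> bool) \<Rightarrow> nat" where
  "hamming_weight x = card {j. x j}"

definition sector :: "nat \<Rightarrow> (complex^('n::finite \<Rightarrow> bool)) set" where
  "sector m = vec.span {axis x 1 | x. hamming_weight x = m}"

definition X_eigenspace :: "complex \<Rightarrow> (complex^('n::finite \<Rightarrow> bool)) set" where
  "X_eigenspace c = {v. on_all pauli_X *v v = c *s v}"

text \<open>
  The determinant of the restriction of \<open>A\<close> to an \<open>A\<close>-invariant subspace \<open>W\<close>: the Leibniz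
  formula for the matrix \<open>(M b b')\<close> of the restriction with respect to a basis \<open>B\<close> of \<open>W\<close>,
  where \<open>A *v b'\<close> is the sum of the vectors \<open>M b b' *s b\<close> over \<open>b \<in> B\<close>. The basis is an
  arbitrary one, the value does not depend on it. The library function \<^const>\<open>det\<close> is only
  available for matrices indexed by a whole type.
\<close>

definition basis_of :: "(complex^'a::finite) set \<Rightarrow> (complex^'a) set \<Rightarrow> bool" where
  "basis_of B W \<longleftrightarrow> vec.independent B \<and> vec.span B = W"

definition restrict_det :: "'a::finite cmat \<Rightarrow> (complex^'a) set \<Rightarrow> complex" where
  "restrict_det A W =
     (let B = (SOME B. basis_of B W);
          M = (\<lambda>b b'. vec.representation B (A *v b') b)
      in \<Sum>p | p permutes B. of_int (sign p) * (\<Prod>b\<in>B. M b (p b)))"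


subsection \<open>Groups of symmetric unitaries\<close>

definition U1_symmetric :: "'n::finite qop \<Rightarrow> bool" where
  "U1_symmetric V \<longleftrightarrow>
     V ** (\<Sum>j\<in>UNIV. on_qubit j pauli_Z) = (\<Sum>j\<in>UNIV. on_qubit j pauli_Z) ** V"

definition SV_U1 :: "'n::finite qop set" where
  "SV_U1 = {V. unitary V \<and> U1_symmetric V \<and>
               (\<forall>m\<le>CARD('n). restrict_det V (sector m) = 1)}"

definition G_group :: "'n::finite qop set" where
  "G_group = {V. unitary V \<and> U1_symmetric V \<and>
                 on_all pauli_X ** V ** on_all pauli_X = V \<and>
                 (\<forall>m\<le>CARD('n). restrict_det V (sector m) = 1) \<and>
                 (even (CARD('n)) \<longrightarrow>
                    restrict_det V (sector (CARD('n) div 2) \<inter> X_eigenspace 1) = 1 \<and>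
                    restrict_det V (sector (CARD('n) div 2) \<inter> X_eigenspace (- 1)) = 1)}"

definition dense_subgroup :: "'a::finite cmat set \<Rightarrow> 'a cmat set \<Rightarrow> bool" where
  "dense_subgroup H K \<longleftrightarrow> subgroup H unitary_group \<and> H \<subseteq> K \<and> K \<subseteq> closure H"

end

theory Submission
  imports Defs "HOL-Analysis.Kronecker_Approximation_Theorem"
begin

text \<open>
  Write $T_{jk} = (X_jX_k + Y_jY_k)/2$, so that the $\sqrt{\mathrm{iSWAP}}$ gates are
  $\exp(i\frac{\pi}{4}T_{jk})$, and let \<open>K\<close> be the closure of the group that they generate.

  On three qubits the gates on two of the pairs act as two rotations by 45 degrees about orthogonal
  axes. The angle of their product is not a rational multiple of $\pi$, so \<open>K\<close> contains
  all rotations about its axis, hence all rotations about the conjugated axes, and a palindromic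
  product of these yields $\exp(i t T_{jk}) \in K$ for all \<open>t\<close>.

  Conjugating with iSWAP gates produces $\exp(i t T_{jl} Z_S)$ for even \<open>|S|\<close> and
  $\exp(i t A_{jl} Z_S)$ for odd \<open>|S|\<close>, where $A_{jl}$ is $T_{jl}$ with an imaginary hopping amplitude.
  For fixed \<open>j, l\<close> those of one kind commute, and the products localize the hopping to a single
  pair of basis vectors together with its image under $X^{\otimes n}$. So \<open>K\<close> contains
  a copy of $SU(2)$ for each pair of basis vectors of the same weight, and Gaussian elimination with
  these shows that they generate the block-diagonal unitaries with unit determinants. In the middle
  sector this is applied in the eigenbasis of $X^{\otimes n}$. Conjugation with \<open>S\<close>
  gates removes the coupling to the mirror image.

  Determinants of restrictions are computed as $\det(AP + 1 - P)$ for a projection \<open>P\<close>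
  commuting with \<open>A\<close>.
\<close>

text \<open>Every gate commutes with the spin flip \<open>on_all pauli_X\<close>. Hence hopping
  between x and y is tied to hopping between \<open>flip x\<close> and \<open>flip y\<close>.
  Outside the middle sector the mirror image lies in another sector and is a mere copy. In the
  middle sector it lies in the same one, so no copy of SU(2) acts on x and \<open>flip x\<close>;
  the rotations of x with y and of x with \<open>flip y\<close> must be combined into one that acts
  on a single eigenspace of the flip.

  The hopping amplitude \<i> alone does not give SU(2). The amplitude 1 commutes with the flip only
  together with an odd number of factors Z, which needs a third qubit. The third qubit also fixes
  the determinants: Z_j Z_l commutes with the flip and inverts exp(i t T_jk), so the square of that
  matrix has determinant 1 on every invariant block.

  The irrational angle comes from arithmetic: twice the cosine of a rational multiple of pi is an
  algebraic integer, whereas the product of two gates rotates by an angle whose doubled cosine is (2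
  sqrt 2 - 1) / 2.

  S gates have determinants other than 1 on the sectors, so they enter only through
  conjugation.\<close>

section \<open>Groups of unitary matrices and their closures\<close>

lemma matrix_mult_entry: "(A ** B) $ i $ j = (\<Sum>k\<in>UNIV. A $ i $ k * B $ k $ j)"
  by (simp add: matrix_matrix_mult_def)

lemma mat_1_entry: "(mat 1 :: 'a::finite cmat) $ i $ j = (if i = j then 1 else 0)"
  by (simp add: mat_def)

lemma matrix_commute_mult:
  "A ** P = P ** A \<Longrightarrow> B ** P = P ** B \<Longrightarrow> A ** B ** P = P ** (A ** B)"
  by (metis matrix_mul_assoc)

lemma adjoint_mat_adjoint [simp]: "adjoint_mat (adjoint_mat A) = A"
  by (simp add: adjoint_mat_def vec_eq_iff)

lemma adjoint_mat_mult: "adjoint_mat (A ** B) = adjoint_mat B ** adjoint_mat A"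
  by (simp add: adjoint_mat_def vec_eq_iff matrix_mult_entry mult.commute)

lemma adjoint_mat_one [simp]: "adjoint_mat (mat 1) = mat 1"
  by (simp add: adjoint_mat_def vec_eq_iff mat_1_entry)

lemma unitary_one [simp]: "unitary (mat 1)"
  by (simp add: unitary_def)

lemma unitary_mult:
  assumes "unitary A" "unitary B"
  shows "unitary (A ** B)"
proof -
  have "adjoint_mat B ** adjoint_mat A ** (A ** B) = adjoint_mat B ** (adjoint_mat A ** A) ** B"
    by (simp add: matrix_mul_assoc)
  moreover have "A ** B ** (adjoint_mat B ** adjoint_mat A) = A ** (B ** adjoint_mat B) ** adjoint_mat A"
    by (simp add: matrix_mul_assoc)
  ultimately show ?thesis
    using assms by (simp add: unitary_def adjoint_mat_mult)
qed

lemma unitary_adjoint: "unitary A \<Longrightarrow> unitary (adjoint_mat A)"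
  by (simp add: unitary_def)

lemma unitary_commute_adjoint:
  assumes "unitary A" "A ** B = B ** A"
  shows "adjoint_mat A ** B = B ** adjoint_mat A"
proof -
  have "adjoint_mat A ** B = adjoint_mat A ** (B ** (A ** adjoint_mat A))"
    using assms by (simp add: unitary_def)
  also have "\<dots> = adjoint_mat A ** (B ** A) ** adjoint_mat A"
    by (simp add: matrix_mul_assoc)
  also have "\<dots> = (adjoint_mat A ** A) ** B ** adjoint_mat A"
    by (simp flip: assms(2) add: matrix_mul_assoc)
  finally show ?thesis using assms by (simp add: unitary_def)
qed

lemma group_unitary_group: "group (unitary_group :: 'a::finite cmat monoid)"
proof (rule groupI)
  fix x :: "'a cmat" assume "x \<in> carrier unitary_group"
  then show "\<exists>y\<in>carrier unitary_group. y \<otimes>\<^bsub>unitary_group\<^esub> x = \<one>\<^bsub>unitary_group\<^esub>"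
    by (intro bexI[of _ "adjoint_mat x"]) (auto simp: unitary_group_def unitary_def)
qed (auto simp: unitary_group_def unitary_mult matrix_mul_assoc)

lemma inv_unitary_group: "unitary x \<Longrightarrow> inv\<^bsub>unitary_group\<^esub> x = adjoint_mat x"
  by (rule group.inv_equality[OF group_unitary_group])
    (auto simp: unitary_group_def unitary_def)

text \<open>Subgroups of the unitary group, with \<open>adjoint_mat\<close> in place of the inverse:
  the adjoint is continuous, so all closure properties pass to limits entry by entry.\<close>

locale matrix_group =
  fixes K :: "'a::finite cmat set"
  assumes one: "mat 1 \<in> K"
    and mult: "A \<in> K \<Longrightarrow> B \<in> K \<Longrightarrow> A ** B \<in> K"
    and adj: "A \<in> K \<Longrightarrow> adjoint_mat A \<in> K"
    and unit: "A \<in> K \<Longrightarrow> unitary A"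

lemma matrix_group_subgroup:
  assumes "matrix_group K"
  shows "subgroup K unitary_group"
  using assms
  by (intro group.subgroupI[OF group_unitary_group])
    (auto simp: unitary_group_def inv_unitary_group[unfolded unitary_group_def] matrix_group_def)

lemma subgroup_matrix_group:
  assumes "subgroup K unitary_group"
  shows "matrix_group K"
proof
  have *: "A \<in> K \<Longrightarrow> unitary A" for A
    using subgroup.mem_carrier[OF assms] by (simp add: unitary_group_def)
  show "mat 1 \<in> K" "A \<in> K \<Longrightarrow> B \<in> K \<Longrightarrow> A ** B \<in> K" for A B
    using subgroup.one_closed[OF assms] subgroup.m_closed[OF assms] by (simp_all add: unitary_group_def)
  show "A \<in> K \<Longrightarrow> adjoint_mat A \<in> K" for A
    using subgroup.m_inv_closed[OF assms, of A] * by (simp add: inv_unitary_group)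
  show "A \<in> K \<Longrightarrow> unitary A" for A by (rule *)
qed

lemma tendsto_matrix_mult:
  fixes A B :: "nat \<Rightarrow> 'a::finite cmat"
  assumes "A \<longlonglongrightarrow> a" "B \<longlonglongrightarrow> b"
  shows "(\<lambda>n. A n ** B n) \<longlonglongrightarrow> a ** b"
  by (intro vec_tendstoI)
    (simp add: matrix_mult_entry tendsto_sum tendsto_mult tendsto_vec_nth assms)

lemma tendsto_adjoint_mat:
  fixes A :: "nat \<Rightarrow> 'a::finite cmat"
  assumes "A \<longlonglongrightarrow> a"
  shows "(\<lambda>n. adjoint_mat (A n)) \<longlonglongrightarrow> adjoint_mat a"
  by (intro vec_tendstoI)
    (simp add: adjoint_mat_def tendsto_cnj tendsto_vec_nth assms)

lemma (in matrix_group) closure: "matrix_group (closure K)"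
proof
  show "mat 1 \<in> closure K" using one closure_subset by blast
  fix A assume "A \<in> closure K"
  then obtain f where f: "\<And>n. f n \<in> K" "f \<longlonglongrightarrow> A"
    by (auto simp: closure_sequential)
  show "adjoint_mat A \<in> closure K"
    unfolding closure_sequential using f adj
    by (intro exI[of _ "\<lambda>n. adjoint_mat (f n)"]) (auto intro: tendsto_adjoint_mat)
  show "A ** B \<in> closure K" if B: "B \<in> closure K" for B
  proof -
    obtain g where g: "\<And>n. g n \<in> K" "g \<longlonglongrightarrow> B"
      using B by (auto simp: closure_sequential)
    show ?thesis
      unfolding closure_sequential using f g mult
      by (intro exI[of _ "\<lambda>n. f n ** g n"]) (auto intro: tendsto_matrix_mult)
  qed
  have "(\<lambda>n. adjoint_mat (f n) ** f n) \<longlonglongrightarrow> adjoint_mat A ** A"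
    "(\<lambda>n. f n ** adjoint_mat (f n)) \<longlonglongrightarrow> A ** adjoint_mat A"
    by (intro tendsto_matrix_mult tendsto_adjoint_mat f)+
  moreover have "adjoint_mat (f n) ** f n = mat 1" "f n ** adjoint_mat (f n) = mat 1" for n
    using unit[OF f(1)[of n]] unfolding unitary_def by blast+
  ultimately have "(\<lambda>n::nat. mat 1) \<longlonglongrightarrow> adjoint_mat A ** A" "(\<lambda>n::nat. mat 1) \<longlonglongrightarrow> A ** adjoint_mat A"
    by simp_all
  then show "unitary A"
    unfolding unitary_def LIMSEQ_const_iff by metis
qed


section \<open>Determinants of restrictions\<close>

definition pdet :: "'a::finite cmat \<Rightarrow> 'a cmat \<Rightarrow> complex" where
  "pdet P A = det (A ** P + (mat 1 - P))"

lemma matrix_diff_rdistrib: "((B :: 'a::finite cmat) - C) ** A = B ** A - C ** A"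
  by (vector matrix_matrix_mult_def sum_subtractf left_diff_distrib)

lemma matrix_diff_ldistrib: "(A :: 'a::finite cmat) ** (B - C) = A ** B - A ** C"
  by (vector matrix_matrix_mult_def sum_subtractf right_diff_distrib)

lemma matrix_mult_add_rdistrib: "((B :: 'a::finite cmat) + C) ** A = B ** A + C ** A"
  by (vector matrix_matrix_mult_def sum.distrib[symmetric] field_simps)

lemma matrix_vector_mult_sum:
  "(A :: 'a::finite cmat) *v (\<Sum>x\<in>S. g x) = (\<Sum>x\<in>S. A *v g x)"
  by (induction S rule: infinite_finite_induct) (simp_all add: matrix_vector_right_distrib)

text \<open>In the product of \<open>A ** P + (mat 1 - P)\<close> and
  \<open>B ** P + (mat 1 - P)\<close> the cross terms vanish: one contains P (1 - P), the other (1 -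
  P) B P, and B commutes with P.\<close>

lemma pdet_mult:
  assumes "P ** P = P" "B ** P = P ** B"
  shows "pdet P (A ** B) = pdet P A * pdet P B"
proof -
  have 1: "A ** P ** (B ** P) = A ** B ** P"
    by (metis assms matrix_mul_assoc)
  have 2: "P ** (B ** P) = B ** P"
    by (metis assms matrix_mul_assoc)
  have 3: "A ** P ** P = A ** P"
    by (metis assms(1) matrix_mul_assoc)
  have "(A ** P + (mat 1 - P)) ** (B ** P + (mat 1 - P)) = A ** B ** P + (mat 1 - P)"
    using assms 1 2 3
    by (simp add: matrix_add_ldistrib matrix_mult_add_rdistrib matrix_diff_rdistrib matrix_diff_ldistrib)
  then show ?thesis
    by (simp add: pdet_def flip: det_mul)
qed

lemma pdet_one [simp]: "pdet P (mat 1) = 1"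
  by (simp add: pdet_def)

lemma pdet_conj:
  assumes "P ** P = P" "A ** P = P ** A" "C ** P = P ** C" "C' ** P = P ** C'" "C ** C' = mat 1"
  shows "pdet P (C ** A ** C') = pdet P A"
proof -
  have "pdet P C * pdet P C' = 1"
    using pdet_mult[of P C' C] assms by simp
  then show ?thesis
    using assms by (simp add: pdet_mult mult_ac)
qed

text \<open>A is conjugate to its inverse, so its determinant d satisfies d * d = 1; the sign of d
  disappears in the square. For a one-parameter group, A is the element at half the
  parameter.\<close>

lemma pdet_eq_1_of_sqrt:
  assumes "P ** P = P" "A ** P = P ** A" "A' ** P = P ** A'" "D ** P = P ** D" "D' ** P = P ** D'"
    and "A ** A' = mat 1" "D ** D' = mat 1" "D ** A ** D' = A'"
  shows "pdet P (A ** A) = 1"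
proof -
  have "pdet P A * pdet P A' = 1"
    using pdet_mult[of P A' A] assms by simp
  moreover have "pdet P A' = pdet P A"
    using pdet_conj[of P A D D'] assms by simp
  ultimately show ?thesis
    using assms by (simp add: pdet_mult)
qed

text \<open>A permutation that moves an index outside J picks an off-diagonal zero from an identity
  column, so only permutations of J survive in the Leibniz formula.\<close>

lemma det_block_identity:
  fixes N :: "complex^'a^'a::finite"
  assumes N: "\<And>i j. j \<notin> J \<Longrightarrow> N $ i $ j = (if i = j then 1 else 0)"
  shows "det N = (\<Sum>p | p permutes J. of_int (sign p) * (\<Prod>i\<in>J. N $ i $ p i))"
proof -
  have "det N = (\<Sum>p | p permutes UNIV. of_int (sign p) * (\<Prod>i\<in>UNIV. N $ i $ p i))"
    by (simp add: det_def)
  also have "\<dots> = (\<Sum>p | p permutes J. of_int (sign p) * (\<Prod>i\<in>UNIV. N $ i $ p i))"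
  proof (rule sum.mono_neutral_right)
    show "{p. p permutes J} \<subseteq> {p. p permutes UNIV}"
      using permutes_subset by blast
    show "\<forall>p\<in>{p. p permutes UNIV} - {p. p permutes J}.
        of_int (sign p) * (\<Prod>i\<in>UNIV. N $ i $ p i) = 0"
    proof
      fix p :: "'a \<Rightarrow> 'a" assume p: "p \<in> {p. p permutes UNIV} - {p. p permutes J}"
      then obtain j where j: "j \<notin> J" "p j \<noteq> j"
        unfolding permutes_def by blast
      obtain i where i: "p i = j"
        using p permutes_surj[of p UNIV] by (metis DiffD1 mem_Collect_eq surjD)
      then have "N $ i $ p i = 0" using N[of j i] j by auto
      then have "(\<Prod>i\<in>UNIV. N $ i $ p i) = 0" by (metis UNIV_I finite prod_zero)
      then show "of_int (sign p) * (\<Prod>i\<in>UNIV. N $ i $ p i) = 0" by simp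
    qed
  qed simp
  also have "\<dots> = (\<Sum>p | p permutes J. of_int (sign p) * (\<Prod>i\<in>J. N $ i $ p i))"
  proof (rule sum.cong)
    fix p assume "p \<in> {p. p permutes J}"
    then have "(\<Prod>i\<in>UNIV. N $ i $ p i) = (\<Prod>i\<in>J. N $ i $ p i)"
      using N by (intro prod.mono_neutral_right) (auto simp: permutes_not_in)
    then show "of_int (sign p) * (\<Prod>i\<in>UNIV. N $ i $ p i) = of_int (sign p) * (\<Prod>i\<in>J. N $ i $ p i)"
      by simp
  qed simp
  finally show ?thesis .
qed

text \<open>A basis C of the kernel of P completes B to a basis of the whole space. In this basis
  \<open>A ** P + (mat 1 - P)\<close> has the matrix N, which is the matrix of the restriction on
  the block of B and has identity columns elsewhere; its determinant is therefore the Leibniz sum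
  over B.\<close>

lemma restrict_det_basis:
  fixes A P :: "'a::finite cmat"
  assumes P: "P ** P = P" "A ** P = P ** A" and B: "basis_of B {v. P *v v = v}"
  shows "(\<Sum>p | p permutes B. of_int (sign p) * (\<Prod>b\<in>B. vec.representation B (A *v p b) b)) = pdet P A"
proof -
  have indB: "vec.independent B" and spanB: "vec.span B = {v. P *v v = v}"
    using B by (auto simp: basis_of_def)
  obtain C where C: "C \<subseteq> {v. P *v v = 0}" "vec.independent C" "{v. P *v v = 0} \<subseteq> vec.span C"
    using vec.maximal_independent_subset[of "{v. P *v v = 0}"] by metis
  have PB: "P *v v = v" if "v \<in> B" for v
    using that spanB vec.span_base by blast
  have PC: "P *v v = 0" if "v \<in> C" for v using that C by blast
  have finB: "finite B" and finC: "finite C"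
    using indB C(2) vec.finiteI_independent by auto
  have zB: "0 \<notin> B" using indB vec.dependent_zero by blast
  have disj: "B \<inter> C = {}" using PB PC zB by fastforce
  have spanBC: "vec.span (B \<union> C) = UNIV"
  proof -
    have "v \<in> vec.span (B \<union> C)" for v
    proof -
      have "P *v (P *v v) = P *v v" using P by (simp add: matrix_vector_mul_assoc)
      then have 1: "P *v v \<in> vec.span B" and 2: "v - P *v v \<in> vec.span C"
        using spanB C(3) by (auto simp: matrix_vector_mult_diff_distrib)
      have "P *v v + (v - P *v v) \<in> vec.span (B \<union> C)"
        by (intro vec.span_add) (use 1 2 vec.span_mono[of B "B \<union> C"] vec.span_mono[of C "B \<union> C"] in auto)
      then show ?thesis by simp
    qed
    then show ?thesis by auto
  qed
  have indBC: "vec.independent (B \<union> C)"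
  proof (rule vec.independent_if_scalars_zero)
    show "finite (B \<union> C)" using finB finC by simp
    fix f x assume s: "(\<Sum>x\<in>B \<union> C. f x *s x) = 0" and x: "x \<in> B \<union> C"
    have s': "(\<Sum>x\<in>B. f x *s x) + (\<Sum>x\<in>C. f x *s x) = 0"
      using s finB finC disj by (simp add: sum.union_disjoint)
    have "P *v (\<Sum>x\<in>B. f x *s x) = (\<Sum>x\<in>B. f x *s x)"
      unfolding matrix_vector_mult_sum vector_scalar_commute
      by (intro sum.cong) (simp_all add: PB)
    moreover have "P *v (\<Sum>x\<in>C. f x *s x) = 0"
      unfolding matrix_vector_mult_sum vector_scalar_commute
      by (intro sum.neutral) (simp add: PC)
    moreover have "P *v ((\<Sum>x\<in>B. f x *s x) + (\<Sum>x\<in>C. f x *s x)) = 0"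
      unfolding s' by simp
    ultimately have sB: "(\<Sum>x\<in>B. f x *s x) = 0"
      unfolding matrix_vector_right_distrib by simp
    with s' have sC: "(\<Sum>x\<in>C. f x *s x) = 0" by simp
    show "f x = 0"
      using x vec.independentD[OF indB finB subset_refl sB] vec.independentD[OF C(2) finC subset_refl sC]
      by blast
  qed
  have "card (B \<union> C) = CARD('a)"
    using vec.dim_eq_card_independent[OF indBC] vec.dim_span[of "B \<union> C"] spanBC vec_dim_card by metis
  then obtain \<beta> :: "'a \<Rightarrow> complex^'a" where \<beta>: "bij_betw \<beta> UNIV (B \<union> C)"
    using finite_same_card_bij[of "UNIV :: 'a set" "B \<union> C"] finB finC by auto
  \<comment> \<open>The basis vectors are numbered by the index type itself, so that S and N are
    square matrices over it; J marks the numbers of the vectors in B.\<close>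
  define J where "J = {i. \<beta> i \<in> B}"
  define S where "S = (\<chi> i j. \<beta> j $ i)"
  define N :: "'a cmat" where "N = (\<chi> i j. if j \<in> J then
      (if i \<in> J then vec.representation B (A *v \<beta> j) (\<beta> i) else 0) else if i = j then 1 else 0)"
  have bij: "bij_betw \<beta> J B"
    using \<beta> disj unfolding J_def bij_betw_def by (auto simp: inj_on_def image_iff set_eq_iff) (metis UnCI)
  have colS: "column j S = \<beta> j" for j
    by (simp add: column_def S_def vec_eq_iff)
  have col: "column j (X ** Y) = X *v column j Y" for X Y :: "'a cmat" and j
    by (simp add: column_def vec_eq_iff matrix_mult_entry matrix_vector_mult_def)
  have SN: "S *v column j N = (\<Sum>i\<in>UNIV. N $ i $ j *s \<beta> i)" for j
    unfolding matrix_mult_sum colS by (simp add: column_def)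
  have intertw: "(A ** P + (mat 1 - P)) ** S = S ** N"
  proof -
    have "column j ((A ** P + (mat 1 - P)) ** S) = column j (S ** N)" for j
    proof (cases "j \<in> J")
      case True
      then have b: "\<beta> j \<in> B" by (simp add: J_def)
      have "A *v \<beta> j \<in> vec.span B"
        using spanB PB[OF b] P(2) by (metis (mono_tags, lifting) matrix_vector_mul_assoc mem_Collect_eq)
      then have "(\<Sum>b\<in>B. vec.representation B (A *v \<beta> j) b *s b) = A *v \<beta> j"
        using vec.sum_representation_eq[OF indB _ finB subset_refl] by blast
      moreover have "(\<Sum>i\<in>UNIV. N $ i $ j *s \<beta> i) = (\<Sum>i\<in>J. vec.representation B (A *v \<beta> j) (\<beta> i) *s \<beta> i)"
        using True by (intro sum.mono_neutral_cong_right) (auto simp: N_def)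
      moreover have "\<dots> = (\<Sum>b\<in>B. vec.representation B (A *v \<beta> j) b *s b)"
        by (rule sum.reindex_bij_betw[OF bij])
      moreover have "(A ** P + (mat 1 - P)) *v \<beta> j = A *v \<beta> j"
        by (simp add: matrix_vector_mult_add_rdistrib matrix_vector_mult_diff_rdistrib
            PB[OF b] flip: matrix_vector_mul_assoc)
      ultimately show ?thesis by (simp add: col colS SN)
    next
      case False
      then have b: "\<beta> j \<in> C" using \<beta> by (auto simp: J_def bij_betw_def)
      have "(\<Sum>i\<in>UNIV. N $ i $ j *s \<beta> i) = (\<Sum>i\<in>{j}. N $ i $ j *s \<beta> i)"
        using False by (intro sum.mono_neutral_right) (auto simp: N_def)
      also have "\<dots> = \<beta> j" using False by (simp add: N_def)
      finally have "(\<Sum>i\<in>UNIV. N $ i $ j *s \<beta> i) = \<beta> j" .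
      moreover have "(A ** P + (mat 1 - P)) *v \<beta> j = \<beta> j"
        by (simp add: matrix_vector_mult_add_rdistrib matrix_vector_mult_diff_rdistrib
            PC[OF b] flip: matrix_vector_mul_assoc)
      ultimately show ?thesis by (simp add: col colS SN)
    qed
    then show ?thesis by (simp add: vec_eq_iff column_def)
  qed
  have "\<exists>T. T ** S = mat 1"
    unfolding matrix_left_invertible_independent_columns
  proof (intro allI impI)
    fix c i assume c: "(\<Sum>i\<in>UNIV. c i *s column i S) = 0"
    have "(\<Sum>b\<in>B \<union> C. c (inv_into UNIV \<beta> b) *s b) = (\<Sum>i\<in>UNIV. c (inv_into UNIV \<beta> (\<beta> i)) *s \<beta> i)"
      by (rule sum.reindex_bij_betw[OF \<beta>, symmetric])
    also have "\<dots> = 0" using c \<beta> by (simp add: colS bij_betw_def)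
    finally have "(\<Sum>b\<in>B \<union> C. c (inv_into UNIV \<beta> b) *s b) = 0" .
    moreover have "finite (B \<union> C)" "\<beta> i \<in> B \<union> C" using finB finC \<beta> by (auto simp: bij_betw_def)
    ultimately have "c (inv_into UNIV \<beta> (\<beta> i)) = 0"
      using vec.independentD[OF indBC _ subset_refl, of "\<lambda>b. c (inv_into UNIV \<beta> b)"] by blast
    then show "c i = 0" using \<beta> by (simp add: bij_betw_def)
  qed
  then have "det S \<noteq> 0"
    by (metis det_I det_mul mult_eq_0_iff zero_neq_one)
  moreover have "det (A ** P + (mat 1 - P)) * det S = det S * det N"
    using intertw by (metis det_mul)
  ultimately have "pdet P A = det N" by (simp add: pdet_def)
  also have "\<dots> = (\<Sum>p | p permutes J. of_int (sign p) * (\<Prod>i\<in>J. N $ i $ p i))"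
    by (rule det_block_identity) (auto simp: N_def)
  also have "\<dots> = (\<Sum>p | p permutes J. of_int (sign (map_permutation J \<beta> p)) *
      (\<Prod>b\<in>B. vec.representation B (A *v map_permutation J \<beta> p b) b))"
  proof (intro sum.cong refl arg_cong2[where f="(*)"])
    fix p assume "p \<in> {p. p permutes J}"
    then have p: "p permutes J" by simp
    show "of_int (sign p) = of_int (sign (map_permutation J \<beta> p))"
      using sign_map_permutation[of \<beta> J p] bij p by (simp add: bij_betw_def)
    have "(\<Prod>b\<in>B. vec.representation B (A *v map_permutation J \<beta> p b) b) =
      (\<Prod>i\<in>J. vec.representation B (A *v map_permutation J \<beta> p (\<beta> i)) (\<beta> i))"
      by (rule prod.reindex_bij_betw[OF bij, symmetric])
    also have "\<dots> = (\<Prod>i\<in>J. N $ i $ p i)"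
      using bij p by (intro prod.cong)
        (auto simp: N_def map_permutation_apply bij_betw_def permutes_in_image)
    finally show "(\<Prod>i\<in>J. N $ i $ p i) =
      (\<Prod>b\<in>B. vec.representation B (A *v map_permutation J \<beta> p b) b)" by simp
  qed
  also have "\<dots> = (\<Sum>p | p permutes B. of_int (sign p) * (\<Prod>b\<in>B. vec.representation B (A *v p b) b))"
  proof (rule sum.reindex_bij_witness[of _ "map_permutation B (inv_into J \<beta>)" "map_permutation J \<beta>"])
    have bij': "bij_betw (inv_into J \<beta>) B J" using bij by (rule bij_betw_inv_into)
    fix p assume "p \<in> {p. p permutes J}"
    then show "map_permutation B (inv_into J \<beta>) (map_permutation J \<beta> p) = p"
      "map_permutation J \<beta> p \<in> {p. p permutes B}"
      using bij map_permutation_permutes[OF bij]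
      by (auto intro!: map_permutation_compose_inv simp: bij_betw_inv_into_left)
  next
    have bij': "bij_betw (inv_into J \<beta>) B J" using bij by (rule bij_betw_inv_into)
    fix p assume "p \<in> {p. p permutes B}"
    then show "map_permutation J \<beta> (map_permutation B (inv_into J \<beta>) p) = p"
      "map_permutation B (inv_into J \<beta>) p \<in> {p. p permutes J}"
      using bij' map_permutation_permutes[OF bij']
      by (auto intro!: map_permutation_compose_inv simp: bij_betw_inv_into_right[OF bij])
  qed simp_all
  finally show ?thesis by simp
qed

lemma restrict_det_eq_pdet:
  fixes A P :: "'a::finite cmat"
  assumes P: "P ** P = P" "A ** P = P ** A" and W: "W = {v. P *v v = v}"
  shows "restrict_det A W = pdet P A"
proof -
  have sub: "vec.subspace W"
    unfolding W vec.subspace_def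
    by (auto simp: matrix_vector_right_distrib vector_scalar_commute)
  obtain B where "B \<subseteq> W" "vec.independent B" "W \<subseteq> vec.span B"
    using vec.maximal_independent_subset[of W] by metis
  then have "basis_of B W"
    using vec.span_minimal[OF _ sub] by (auto simp: basis_of_def)
  then have "basis_of (SOME B. basis_of B W) W" by (rule someI)
  then show ?thesis
    unfolding restrict_det_def Let_def W by (rule restrict_det_basis[OF P])
qed

section \<open>Diagonal projections\<close>

definition dproj :: "'a set \<Rightarrow> 'a::finite cmat" where
  "dproj S = (\<chi> x y. if x = y \<and> x \<in> S then 1 else 0)"

lemma mult_dproj_entry: "(A ** dproj S) $ x $ y = (if y \<in> S then A $ x $ y else 0)"
proof -
  have "(A ** dproj S) $ x $ y = (\<Sum>k\<in>UNIV. if k = y then (if y \<in> S then A $ x $ y else 0) else 0)"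
    unfolding matrix_mult_entry by (intro sum.cong) (auto simp: dproj_def)
  then show ?thesis by simp
qed

lemma dproj_mult_entry: "(dproj S ** A) $ x $ y = (if x \<in> S then A $ x $ y else 0)"
proof -
  have "(dproj S ** A) $ x $ y = (\<Sum>k\<in>UNIV. if k = x then (if x \<in> S then A $ x $ y else 0) else 0)"
    unfolding matrix_mult_entry by (intro sum.cong) (auto simp: dproj_def)
  then show ?thesis by simp
qed

lemma dproj_idem: "dproj S ** dproj S = dproj S"
  by (auto simp: vec_eq_iff mult_dproj_entry) (auto simp: dproj_def)

lemma commute_dproj_iff:
  "A ** dproj S = dproj S ** A \<longleftrightarrow> (\<forall>x y. (x \<in> S) \<noteq> (y \<in> S) \<longrightarrow> A $ x $ y = 0)"
  by (auto simp: vec_eq_iff mult_dproj_entry dproj_mult_entry)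

definition diagm :: "('a \<Rightarrow> complex) \<Rightarrow> 'a::finite cmat" where
  "diagm d = (\<chi> x y. if x = y then d x else 0)"

lemma mult_diagm_entry: "(A ** diagm d) $ x $ y = A $ x $ y * d y"
proof -
  have "(A ** diagm d) $ x $ y = (\<Sum>k\<in>UNIV. if k = y then A $ x $ y * d y else 0)"
    unfolding matrix_mult_entry by (intro sum.cong) (auto simp: diagm_def)
  then show ?thesis by simp
qed

lemma diagm_mult_entry: "(diagm d ** A) $ x $ y = d x * A $ x $ y"
proof -
  have "(diagm d ** A) $ x $ y = (\<Sum>k\<in>UNIV. if k = x then d x * A $ x $ y else 0)"
    unfolding matrix_mult_entry by (intro sum.cong) (auto simp: diagm_def)
  then show ?thesis by simp
qed

lemma diagm_mult: "diagm d ** diagm e = diagm (\<lambda>x. d x * e x)"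
  by (auto simp: vec_eq_iff mult_diagm_entry) (auto simp: diagm_def)

lemma diagm_one: "diagm (\<lambda>_. 1) = mat 1"
  by (auto simp: vec_eq_iff diagm_def mat_1_entry)

lemma diagm_involution: "(\<And>x. d x * d x = 1) \<Longrightarrow> diagm d ** diagm d = mat 1"
  by (simp add: diagm_mult flip: diagm_one)


section \<open>Two-level matrices\<close>

definition pair_swap :: "('a \<Rightarrow> 'a) \<Rightarrow> 'a \<Rightarrow> 'a \<Rightarrow> 'a \<Rightarrow> 'a" where
  "pair_swap \<sigma> x y u =
     (if u = x then y else if u = y then x else if u = \<sigma> x then \<sigma> y else if u = \<sigma> y then \<sigma> x else u)"

text \<open>The element of $SU(2)$ with first column $(a, c)$, acting simultaneously on the span of
  \<open>x, y\<close> and on the span of \<open>\<sigma> x, \<sigma> y\<close>.\<close>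

definition su :: "('a \<Rightarrow> 'a) \<Rightarrow> 'a \<Rightarrow> 'a \<Rightarrow> complex \<Rightarrow> complex \<Rightarrow> 'a::finite cmat" where
  "su \<sigma> x y a c = (\<chi> u v.
     (if v = u then (if u = x \<or> u = \<sigma> x then a else if u = y \<or> u = \<sigma> y then cnj a else 1) else 0) +
     (if v = pair_swap \<sigma> x y u
      then (if u = x \<or> u = \<sigma> x then - cnj c else if u = y \<or> u = \<sigma> y then c else 0) else 0))"

lemma su_left:
  "(su \<sigma> x y a c ** A) $ u $ z =
     (if u = x \<or> u = \<sigma> x then a else if u = y \<or> u = \<sigma> y then cnj a else 1) * A $ u $ z +
     (if u = x \<or> u = \<sigma> x then - cnj c else if u = y \<or> u = \<sigma> y then c else 0) * A $ pair_swap \<sigma> x y u $ z"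
  unfolding matrix_mult_entry su_def
  by (simp only: vec_lambda_beta distrib_right sum.distrib if_distrib[of "\<lambda>x. x * _"]
      mult_zero_left sum.delta' sum.delta finite UNIV_I if_True cong: if_cong)

text \<open>The planes spanned by x, y and by \<sigma> x, \<sigma> y either coincide, with \<sigma>
  fixing x and y, or are disjoint. This lets one formula serve for plain and for mirrored
  rotations.\<close>

locale good_pair =
  fixes \<sigma> :: "'a::finite \<Rightarrow> 'a" and x y :: 'a
  assumes inv: "\<And>z. \<sigma> (\<sigma> z) = z"
    and ne: "x \<noteq> y" and ne': "\<sigma> x \<noteq> y" and fix_iff: "\<sigma> x = x \<longleftrightarrow> \<sigma> y = y"
begin

lemma ne'': "\<sigma> y \<noteq> x" using inv ne' by metis
lemma ne''': "\<sigma> y \<noteq> \<sigma> x" using inv ne by metis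

lemmas nes = ne ne[symmetric] ne' ne'[symmetric] ne'' ne''[symmetric] ne''' ne'''[symmetric]

lemma pair_swap_simps [simp]:
  "pair_swap \<sigma> x y x = y" "pair_swap \<sigma> x y y = x"
  "pair_swap \<sigma> x y (\<sigma> x) = \<sigma> y" "pair_swap \<sigma> x y (\<sigma> y) = \<sigma> x"
  using nes fix_iff by (auto simp: pair_swap_def)

lemma pair_swap_invol: "pair_swap \<sigma> x y (pair_swap \<sigma> x y u) = u"
  using nes fix_iff by (auto simp: pair_swap_def)

lemma su_rows:
  "(su \<sigma> x y a c ** A) $ x $ z = a * A $ x $ z - cnj c * A $ y $ z"
  "(su \<sigma> x y a c ** A) $ y $ z = c * A $ x $ z + cnj a * A $ y $ z"
  "(su \<sigma> x y a c ** A) $ (\<sigma> x) $ z = a * A $ \<sigma> x $ z - cnj c * A $ \<sigma> y $ z"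
  "(su \<sigma> x y a c ** A) $ (\<sigma> y) $ z = c * A $ \<sigma> x $ z + cnj a * A $ \<sigma> y $ z"
  "u \<notin> {x, y, \<sigma> x, \<sigma> y} \<Longrightarrow> (su \<sigma> x y a c ** A) $ u $ z = A $ u $ z"
  using nes by (simp_all add: su_left)

lemma su_entries:
  "su \<sigma> x y a c $ x $ z = (if z = x then a else if z = y then - cnj c else 0)"
  "su \<sigma> x y a c $ y $ z = (if z = x then c else if z = y then cnj a else 0)"
  "su \<sigma> x y a c $ (\<sigma> x) $ z = (if z = \<sigma> x then a else if z = \<sigma> y then - cnj c else 0)"
  "su \<sigma> x y a c $ (\<sigma> y) $ z = (if z = \<sigma> x then c else if z = \<sigma> y then cnj a else 0)"
  "u \<notin> {x, y, \<sigma> x, \<sigma> y} \<Longrightarrow> su \<sigma> x y a c $ u $ z = (if z = u then 1 else 0)"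
  using nes by (auto simp: su_def)

lemma row_cases:
  obtains "u = x" | "u = y" | "u = \<sigma> x" | "u = \<sigma> y" | "u \<notin> {x, y, \<sigma> x, \<sigma> y}"
  by blast

lemma su_mult:
  "su \<sigma> x y a c ** su \<sigma> x y a' c' = su \<sigma> x y (a * a' - cnj c * c') (c * a' + cnj a * c')"
proof -
  have "(su \<sigma> x y a c ** su \<sigma> x y a' c') $ u $ z = su \<sigma> x y (a * a' - cnj c * c') (c * a' + cnj a * c') $ u $ z" for u z
    by (cases u rule: row_cases) (auto simp: su_rows su_entries nes algebra_simps)
  then show ?thesis by (simp add: vec_eq_iff)
qed

lemma su_one: "su \<sigma> x y 1 0 = mat 1"
proof -
  have "su \<sigma> x y 1 0 $ u $ z = mat 1 $ u $ z" for u z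
    by (cases u rule: row_cases) (auto simp: su_entries nes mat_1_entry)
  then show ?thesis by (simp add: vec_eq_iff)
qed

lemma adjoint_su: "adjoint_mat (su \<sigma> x y a c) = su \<sigma> x y (cnj a) (- c)"
proof -
  have "adjoint_mat (su \<sigma> x y a c) $ u $ z = su \<sigma> x y (cnj a) (- c) $ u $ z" for u z
    unfolding adjoint_mat_def vec_lambda_beta
    by (cases u rule: row_cases; cases z rule: row_cases; simp add: su_entries nes)
      (use nes fix_iff in auto)
  then show ?thesis by (simp add: vec_eq_iff)
qed

lemma su_inverse:
  assumes "norm a ^ 2 + norm c ^ 2 = 1"
  shows "su \<sigma> x y a c ** su \<sigma> x y (cnj a) (- c) = mat 1"
    "su \<sigma> x y (cnj a) (- c) ** su \<sigma> x y a c = mat 1"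
proof -
  have "a * cnj a + c * cnj c = 1"
    using assms by (metis complex_norm_square of_real_1 of_real_add)
  then show "su \<sigma> x y a c ** su \<sigma> x y (cnj a) (- c) = mat 1"
    "su \<sigma> x y (cnj a) (- c) ** su \<sigma> x y a c = mat 1"
    by (simp_all add: su_mult mult.commute flip: su_one)
qed

lemma unitary_su: "norm a ^ 2 + norm c ^ 2 = 1 \<Longrightarrow> unitary (su \<sigma> x y a c)"
  by (simp add: unitary_def adjoint_su su_inverse)

lemma su_commute_dproj:
  assumes "x \<in> S \<longleftrightarrow> y \<in> S" "\<sigma> x \<in> S \<longleftrightarrow> \<sigma> y \<in> S"
  shows "su \<sigma> x y a c ** dproj S = dproj S ** su \<sigma> x y a c"
proof -
  have "(u \<in> S) \<noteq> (z \<in> S) \<longrightarrow> su \<sigma> x y a c $ u $ z = 0" for u z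
    by (cases u rule: row_cases; simp add: su_entries nes) (use assms in auto)
  then show ?thesis by (simp add: commute_dproj_iff)
qed

abbreviation "rot \<phi> t \<equiv> su \<sigma> x y (of_real (cos t)) (\<phi> * of_real (sin t))"

lemma norm_rot: "norm (\<phi> :: complex) = 1 \<Longrightarrow> norm (of_real (cos t) :: complex) ^ 2 + norm (\<phi> * of_real (sin t)) ^ 2 = 1"
  unfolding norm_mult norm_of_real by simp

text \<open>Changing the sign of x and \<sigma> x is a diagonal conjugation that inverts a rotation
  with real diagonal, so \<open>pdet_eq_1_of_sqrt\<close> applies to the rotation by half the
  angle.\<close>

lemma pdet_rot:
  assumes "x \<in> S \<longleftrightarrow> y \<in> S" "\<sigma> x \<in> S \<longleftrightarrow> \<sigma> y \<in> S" and \<phi>: "norm \<phi> = 1"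
  shows "pdet (dproj S) (rot \<phi> t) = 1"
proof -
  define D :: "'a cmat" where "D = diagm (\<lambda>u. if u = x \<or> u = \<sigma> x then - 1 else 1)"
  have DD: "D ** D = mat 1" unfolding D_def by (rule diagm_involution) simp
  have "(D ** su \<sigma> x y (of_real r) c ** D) $ u $ z = su \<sigma> x y (cnj (of_real r)) (- c) $ u $ z" for u z r c
    unfolding D_def diagm_mult_entry mult_diagm_entry
    by (cases u rule: row_cases; simp add: su_entries nes) (use nes fix_iff in auto)
  then have conj: "D ** su \<sigma> x y (of_real r) c ** D = su \<sigma> x y (cnj (of_real r)) (- c)" for r c
    by (simp add: vec_eq_iff)
  have "D ** dproj S = dproj S ** D"
    unfolding commute_dproj_iff by (auto simp: D_def diagm_def)
  then have "pdet (dproj S) (rot \<phi> (t/2) ** rot \<phi> (t/2)) = 1"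
    using assms norm_rot[OF \<phi>]
    by (intro pdet_eq_1_of_sqrt[OF dproj_idem _ _ _ _ su_inverse(1) DD conj])
      (simp_all add: su_commute_dproj)
  also have "rot \<phi> (t/2) ** rot \<phi> (t/2) = rot \<phi> t"
  proof -
    have "cnj \<phi> * \<phi> = 1" by (metis \<phi> complex_norm_square mult.commute of_real_1 one_power2)
    then have "cnj (\<phi> * of_real (sin (t/2))) * (\<phi> * of_real (sin (t/2))) = of_real (sin (t/2) * sin (t/2))"
      unfolding complex_cnj_mult complex_cnj_complex_of_real of_real_mult by algebra
    then have "of_real (cos (t/2)) * of_real (cos (t/2)) -
       cnj (\<phi> * of_real (sin (t/2))) * (\<phi> * of_real (sin (t/2))) = complex_of_real (cos t)"
      using cos_double[of "t/2"] unfolding power2_eq_square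
      by (simp only: of_real_mult[symmetric] of_real_diff[symmetric]) simp
    moreover have "\<phi> * of_real (sin (t/2)) * of_real (cos (t/2)) +
       cnj (of_real (cos (t/2))) * (\<phi> * of_real (sin (t/2))) = \<phi> * complex_of_real (sin t)"
      using sin_double[of "t/2"] by simp
    ultimately show ?thesis by (simp only: su_mult)
  qed
  finally show ?thesis .
qed

end


section \<open>Generation by two-level matrices\<close>

text \<open>Two instances are intended: the identity with the Hamming weight, for
  \<open>SV_U1\<close>, and \<open>mirror\<close> with \<open>label c\<close>, for
  \<open>G_group\<close> in the eigenbasis of the flip. By \<open>blk_fix\<close> a block that is
  mapped to itself is fixed pointwise, which makes any two distinct elements of a block a
  \<open>good_pair\<close>.\<close>

locale block_symmetry =
  fixes \<sigma> :: "'a::finite \<Rightarrow> 'a" and blk :: "'a \<Rightarrow> 'b"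
  assumes inv: "\<sigma> (\<sigma> x) = x"
    and blk_cong: "blk x = blk y \<Longrightarrow> blk (\<sigma> x) = blk (\<sigma> y)"
    and blk_fix: "blk (\<sigma> x) = blk x \<Longrightarrow> \<sigma> x = x"
begin

definition special :: "'a cmat \<Rightarrow> bool" where
  "special V \<longleftrightarrow> unitary V \<and> (\<forall>x y. blk x \<noteq> blk y \<longrightarrow> V $ x $ y = 0) \<and>
     (\<forall>x y. V $ \<sigma> x $ \<sigma> y = V $ x $ y) \<and> (\<forall>z. pdet (dproj {x. blk x = blk z}) V = 1)"

definition fixed :: "'a cmat \<Rightarrow> 'a set" where
  "fixed V = {x. \<forall>u. V $ u $ x = (if u = x then 1 else 0)}"

lemma good: "x \<noteq> y \<Longrightarrow> blk x = blk y \<Longrightarrow> good_pair \<sigma> x y"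
  using inv blk_cong blk_fix by unfold_locales metis+

lemma special_zero: "special V \<Longrightarrow> blk x \<noteq> blk y \<Longrightarrow> V $ x $ y = 0"
  unfolding special_def by metis

lemma special_commute: "special V \<Longrightarrow> V ** dproj {x. blk x = b} = dproj {x. blk x = b} ** V"
  by (auto simp: special_def commute_dproj_iff)

lemma special_mult:
  assumes A: "special A" and B: "special B"
  shows "special (A ** B)"
  unfolding special_def
proof (intro conjI allI impI)
  show "unitary (A ** B)" using A B by (simp add: special_def unitary_mult)
  show "(A ** B) $ x $ y = 0" if "blk x \<noteq> blk y" for x y
    unfolding matrix_mult_entry by (rule sum.neutral, intro ballI)
      (metis A B that mult_eq_0_iff special_def)
  show "(A ** B) $ \<sigma> x $ \<sigma> y = (A ** B) $ x $ y" for x y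
    unfolding matrix_mult_entry
    by (rule sum.reindex_bij_witness[of _ \<sigma> \<sigma>]) (use A B inv in \<open>auto simp: special_def\<close>, metis)
  show "pdet (dproj {x. blk x = blk z}) (A ** B) = 1" for z
    using A B by (simp add: pdet_mult dproj_idem special_commute) (simp add: special_def)
qed

lemma special_rot:
  assumes "x \<noteq> y" "blk x = blk y" "norm \<phi> = 1"
  shows "special (su \<sigma> x y (of_real (cos t)) (\<phi> * of_real (sin t)))"
proof -
  interpret good_pair \<sigma> x y by (rule good) (use assms in auto)
  show ?thesis
    unfolding special_def
  proof (intro conjI allI impI)
    show "unitary (rot \<phi> t)" using norm_rot assms by (intro unitary_su)
    show "pdet (dproj {x. blk x = blk z}) (rot \<phi> t) = 1" for z
      by (rule pdet_rot) (use assms blk_cong[of x y] in auto)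
    fix u z
    show "rot \<phi> t $ u $ z = 0" if "blk u \<noteq> blk z"
      by (cases u rule: row_cases; simp add: su_entries nes) (use that assms blk_cong[of x y] in auto)
    have s: "\<sigma> u = v \<longleftrightarrow> u = \<sigma> v" for u v using inv by metis
    show "rot \<phi> t $ \<sigma> u $ \<sigma> z = rot \<phi> t $ u $ z"
      by (cases u rule: row_cases; simp add: su_entries inv s)
  qed
qed

text \<open>The columns of V are orthonormal, so if column y is a basis vector then every other
  column has a zero in row y. Consequently a row with a nonzero off-diagonal entry never belongs to
  a fixed column.\<close>

lemma fixed_row:
  assumes "special V" "y \<in> fixed V"
  shows "V $ y $ x = (if y = x then 1 else 0)"
proof -
  have "(adjoint_mat V ** V) $ x $ y = (if x = y then 1 else 0)"
    using assms by (simp add: special_def unitary_def mat_1_entry)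
  moreover have "(adjoint_mat V ** V) $ x $ y = (\<Sum>u\<in>UNIV. if u = y then cnj (V $ y $ x) else 0)"
    unfolding matrix_mult_entry
    by (intro sum.cong) (use assms(2) in \<open>auto simp: adjoint_mat_def fixed_def\<close>)
  ultimately have "cnj (V $ y $ x) = (if x = y then 1 else 0)" by simp
  then show ?thesis by (metis complex_cnj_cnj complex_cnj_one complex_cnj_zero)
qed

lemma fixed_sigma:
  assumes "special V"
  shows "\<sigma> x \<in> fixed V \<longleftrightarrow> x \<in> fixed V"
proof -
  have *: "V $ \<sigma> u $ \<sigma> x = V $ u $ x" for u x using assms by (simp add: special_def)
  have "\<sigma> x \<in> fixed V" if "x \<in> fixed V" for x
  proof -
    have "V $ u $ \<sigma> x = (if u = \<sigma> x then 1 else 0)" for u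
      using *[of "\<sigma> u" x] that inv by (auto simp: fixed_def)
    then show ?thesis by (simp add: fixed_def)
  qed
  then show ?thesis by (metis inv)
qed

lemma fixed_su:
  assumes V: "special V" and "x \<noteq> y" "blk x = blk y" "x \<notin> fixed V" "y \<notin> fixed V"
  shows "fixed V \<subseteq> fixed (su \<sigma> x y a c ** V)"
proof
  interpret good_pair \<sigma> x y by (rule good) (use assms in auto)
  fix z assume z: "z \<in> fixed V"
  have ne: "z \<noteq> x" "z \<noteq> y" "z \<noteq> \<sigma> x" "z \<noteq> \<sigma> y"
    using z assms(4,5) fixed_sigma[OF V, of x] fixed_sigma[OF V, of y] by blast+
  have col: "V $ u $ z = (if u = z then 1 else 0)" for u
    using z by (simp add: fixed_def)
  have "(su \<sigma> x y a c ** V) $ u $ z = (if u = z then 1 else 0)" for u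
    using ne by (cases u rule: row_cases) (simp_all add: su_rows col)
  then show "z \<in> fixed (su \<sigma> x y a c ** V)" by (simp add: fixed_def)
qed

text \<open>Columns are turned into identity columns one at a time, by Givens rotations within a
  block followed by a phase correction. Rotations are applied only to unfixed indices, so finished
  columns stay finished. In each block the determinant condition settles the last column.\<close>

theorem special_mem:
  assumes K: "matrix_group K"
    and rots: "\<And>x y \<phi> t. x \<noteq> y \<Longrightarrow> blk x = blk y \<Longrightarrow> \<phi> \<in> {1, \<i>} \<Longrightarrow>
      su \<sigma> x y (of_real (cos t)) (\<phi> * of_real (sin t)) \<in> K"
    and V: "special V"
  shows "V \<in> K"
proof -
  \<comment> \<open>The matrix must remain special after each multiplication, so the multipliers are
    kept both in K and special.\<close>
  define G where "G = {A \<in> K. special A}"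
  have G_mult: "A \<in> G \<Longrightarrow> B \<in> G \<Longrightarrow> A ** B \<in> G" for A B
    using matrix_group.mult[OF K] special_mult by (auto simp: G_def)
  have G_rot: "su \<sigma> x y (of_real (cos t)) (of_real (sin t)) \<in> G"
    "su \<sigma> x y (of_real (cos t)) (\<i> * of_real (sin t)) \<in> G" if "x \<noteq> y" "blk x = blk y" for x y t
    using rots[OF that, of 1 t] rots[OF that, of \<i> t] special_rot[OF that, of 1 t] special_rot[OF that, of \<i> t]
    by (auto simp: G_def)
  \<comment> \<open>Conjugation by a real rotation through 45 degrees diagonalizes the rotation with
    imaginary amplitude.\<close>
  have G_phase: "su \<sigma> x y (cis t) 0 \<in> G" if xy: "x \<noteq> y" "blk x = blk y" for x y t
  proof -
    interpret good_pair \<sigma> x y by (rule good[OF xy])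
    let ?r = "complex_of_real (sqrt 2 / 2)"
    have r: "?r * ?r = 1/2" by (simp flip: of_real_mult)
    have "su \<sigma> x y ?r ?r \<in> G" "su \<sigma> x y ?r (- ?r) \<in> G"
      using G_rot(1)[OF xy, of "pi/4"] G_rot(1)[OF xy, of "-pi/4"] by (simp_all add: cos_45 sin_45)
    then have "su \<sigma> x y ?r ?r ** su \<sigma> x y (of_real (cos (- t))) (\<i> * of_real (sin (- t))) ** su \<sigma> x y ?r (- ?r) \<in> G"
      by (intro G_mult G_rot xy)
    moreover have "su \<sigma> x y ?r ?r ** su \<sigma> x y (of_real (cos (- t))) (\<i> * of_real (sin (- t))) ** su \<sigma> x y ?r (- ?r) =
      su \<sigma> x y ((?r * ?r + ?r * ?r) * (of_real (cos t) + \<i> * of_real (sin t))) 0"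
      unfolding su_mult by (rule arg_cong2[where f="su \<sigma> x y"]) (simp_all add: algebra_simps)
    moreover have "of_real (cos t) + \<i> * of_real (sin t) = cis t"
      by (simp add: cis_conv_exp exp_Euler cos_of_real sin_of_real)
    ultimately show ?thesis unfolding r by (simp only:) simp
  qed
  \<comment> \<open>Euler decomposition: an element of SU(2) is a real rotation between two diagonal
    phases. Their angles are the half difference and the half sum of the arguments of a and
    c.\<close>
  have G_su: "su \<sigma> x y a c \<in> G" if xy: "x \<noteq> y" "blk x = blk y" and ac: "norm a ^ 2 + norm c ^ 2 = 1" for x y a c
  proof -
    interpret good_pair \<sigma> x y by (rule good[OF xy])
    obtain t where t: "norm a = cos t" "norm c = sin t"
      using sincos_total_pi_half[of "norm a" "norm c"] ac by auto
    define \<alpha> \<beta> where "\<alpha> = Arg a" and "\<beta> = Arg c"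
    have a: "a = of_real (cos t) * cis \<alpha>" and c: "c = of_real (sin t) * cis \<beta>"
      using t rcis_cmod_Arg[of a] rcis_cmod_Arg[of c] by (simp_all add: \<alpha>_def \<beta>_def rcis_def)
    have "su \<sigma> x y (cis ((\<alpha> - \<beta>) / 2)) 0 ** su \<sigma> x y (of_real (cos t)) (of_real (sin t)) **
       su \<sigma> x y (cis ((\<alpha> + \<beta>) / 2)) 0 \<in> G"
      by (intro G_mult G_rot G_phase xy)
    also have "su \<sigma> x y (cis ((\<alpha> - \<beta>) / 2)) 0 ** su \<sigma> x y (of_real (cos t)) (of_real (sin t)) **
       su \<sigma> x y (cis ((\<alpha> + \<beta>) / 2)) 0 = su \<sigma> x y a c"
      unfolding su_mult a c
      by (rule arg_cong2[where f="su \<sigma> x y"]) (simp_all add: cis_cnj cis_mult mult_ac add_divide_distrib diff_divide_distrib)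
    finally show ?thesis .
  qed
  have clear: "\<exists>k\<in>G. (\<forall>y. y \<noteq> x \<longrightarrow> (k ** V) $ y $ x = 0) \<and> fixed V \<subseteq> fixed (k ** V)"
    if "special V" "x \<notin> fixed V" "mat 1 \<in> G" for V x
    using that
  proof (induction "card {y. y \<noteq> x \<and> V $ y $ x \<noteq> 0}" arbitrary: V rule: less_induct)
    case less
    show ?case
    proof (cases "\<exists>y. y \<noteq> x \<and> V $ y $ x \<noteq> 0")
      case False
      then show ?thesis using less.prems by (intro bexI[of _ "mat 1"]) auto
    next
      case True
      then obtain y where y: "y \<noteq> x" "V $ y $ x \<noteq> 0" by blast
      then have b: "blk x = blk y" using special_zero[OF less.prems(1)] by metis
      have yf: "y \<notin> fixed V" using fixed_row[OF less.prems(1), of y x] y by auto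
      interpret good_pair \<sigma> x y by (rule good) (use y b in auto)
      define p q where "p = V $ x $ x" and "q = V $ y $ x"
      define r where "r = sqrt (norm p ^ 2 + norm q ^ 2)"
      have "norm p ^ 2 + norm q ^ 2 > 0" using y by (intro add_nonneg_pos) (simp_all add: q_def)
      then have r: "r > 0" unfolding r_def by (rule real_sqrt_gt_zero)
      \<comment> \<open>A Givens rotation: it maps the pair (p, q) to (r, 0).\<close>
      define k where "k = su \<sigma> x y (cnj p / r) (- q / r)"
      have "norm (cnj p / r) ^ 2 + norm (- q / r) ^ 2 = (norm p ^ 2 + norm q ^ 2) / r ^ 2"
        using r by (simp add: norm_divide power_divide add_divide_distrib del: of_real_power)
      also have "r ^ 2 = norm p ^ 2 + norm q ^ 2" unfolding r_def by simp
      also have "(norm p ^ 2 + norm q ^ 2) / (norm p ^ 2 + norm q ^ 2) = 1"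
        using \<open>norm p ^ 2 + norm q ^ 2 > 0\<close> by (intro divide_self) linarith
      finally have k: "k \<in> G" unfolding k_def using y b by (intro G_su) auto
      have ky: "(k ** V) $ y $ x = 0"
        unfolding k_def su_rows by (simp add: p_def q_def)
      \<comment> \<open>The rotation also mixes the rows \<sigma> x and \<sigma> y. If these differ
        from x and y they lie in another block, where column x of V vanishes, so no new nonzero
        entry appears.\<close>
      have zero: "(k ** V) $ u $ x = 0" if "u \<noteq> x" "V $ u $ x = 0" for u
      proof -
        have "V $ \<sigma> x $ x = 0 \<and> V $ \<sigma> y $ x = 0" if "\<sigma> x \<noteq> x"
          using that special_zero[OF less.prems(1)] blk_fix[of x] blk_cong[OF b] by metis
        then show ?thesis
          using that ky fix_iff unfolding k_def
          by (cases u rule: row_cases) (auto simp: su_rows)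
      qed
      have sp: "special (k ** V)" using k less.prems special_mult by (auto simp: G_def)
      show ?thesis
      proof (cases "x \<in> fixed (k ** V)")
        case True
        then show ?thesis
          using k fixed_su[OF less.prems(1) ne b less.prems(2) yf] unfolding k_def
          by (intro bexI[of _ k]) (auto simp: fixed_def k_def)
      next
        case False
        have "{u. u \<noteq> x \<and> (k ** V) $ u $ x \<noteq> 0} \<subset> {u. u \<noteq> x \<and> V $ u $ x \<noteq> 0}"
          using zero ky y by blast
        then have "card {u. u \<noteq> x \<and> (k ** V) $ u $ x \<noteq> 0} < card {u. u \<noteq> x \<and> V $ u $ x \<noteq> 0}"
          by (intro psubset_card_mono) auto
        from less.hyps[OF this sp False less.prems(3)] obtain k' where
          k': "k' \<in> G" "\<forall>y. y \<noteq> x \<longrightarrow> (k' ** (k ** V)) $ y $ x = 0" "fixed (k ** V) \<subseteq> fixed (k' ** (k ** V))"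
          by blast
        have "fixed V \<subseteq> fixed (k ** V)"
          unfolding k_def by (rule fixed_su[OF less.prems(1) ne b less.prems(2) yf])
        then show ?thesis
          using k' G_mult[OF k'(1) k] by (intro bexI[of _ "k' ** k"]) (auto simp: matrix_mul_assoc)
      qed
    qed
  qed
  have "V \<in> K" if "special V" "mat 1 \<in> G" for V
    using that
  proof (induction "card (- fixed V)" arbitrary: V rule: less_induct)
    case less
    show ?case
    proof (cases "fixed V = UNIV")
      case True
      then have "V $ u $ x = (if u = x then 1 else 0)" for u x
        unfolding fixed_def by blast
      then have "V = mat 1" by (simp add: vec_eq_iff mat_1_entry)
      then show ?thesis using matrix_group.one[OF K] by simp
    next
      case False
      then obtain x where x: "x \<notin> fixed V" by blast
      obtain k where k: "k \<in> G" "\<And>y. y \<noteq> x \<Longrightarrow> (k ** V) $ y $ x = 0" "fixed V \<subseteq> fixed (k ** V)"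
        using clear[OF less.prems(1) x less.prems(2)] by blast
      have sp: "special (k ** V)" using k less.prems special_mult by (auto simp: G_def)
      have pull: "V \<in> K" if "A \<in> K" "A ** V \<in> K" for A
      proof -
        have "adjoint_mat A ** (A ** V) = V"
          using matrix_group.unit[OF K that(1)] by (simp add: unitary_def matrix_mul_assoc)
        then show ?thesis using matrix_group.mult[OF K matrix_group.adj[OF K that(1)] that(2)] by simp
      qed
      have progress: "V \<in> K" if A: "A \<in> G" "fixed V \<subseteq> fixed (A ** V)" "x \<in> fixed (A ** V)" for A
      proof -
        have "card (- fixed (A ** V)) < card (- fixed V)"
          using A x by (intro psubset_card_mono) auto
        then have "A ** V \<in> K"
          using less.hyps special_mult A less.prems by (auto simp: G_def)
        then show ?thesis using A pull by (auto simp: G_def)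
      qed
      define c where "c = (k ** V) $ x $ x"
      have "(adjoint_mat (k ** V) ** (k ** V)) $ x $ x = (\<Sum>u\<in>UNIV. if u = x then cnj c * c else 0)"
        unfolding matrix_mult_entry[of "adjoint_mat (k ** V)"]
        by (intro sum.cong) (use k in \<open>auto simp: adjoint_mat_def c_def\<close>)
      then have c: "cnj c * c = 1"
        using sp by (simp add: special_def unitary_def mat_1_entry)
      then have nc: "norm c = 1"
        by (metis complex_mod_sqrt_Re_mult_cnj mult.commute one_complex.simps(1) real_sqrt_one)
      show ?thesis
      proof (cases "x \<in> fixed (k ** V)")
        case True
        then show ?thesis using progress k by blast
      next
        case xf: False
        show ?thesis
        proof (cases "\<exists>y. y \<noteq> x \<and> blk y = blk x \<and> y \<notin> fixed (k ** V)")
          case True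
          then obtain y where y: "y \<noteq> x" "blk x = blk y" "y \<notin> fixed (k ** V)" by auto
          interpret good_pair \<sigma> x y by (rule good) (use y in auto)
          \<comment> \<open>The remaining diagonal entry c has modulus 1. It is removed at x at the
            cost of the opposite phase at y, which does no harm because column y is not fixed
            yet.\<close>
          let ?d = "su \<sigma> x y (cnj c) 0"
          have d: "?d \<in> G" using y nc by (intro G_su) auto
          have "(?d ** (k ** V)) $ u $ x = (if u = x then 1 else 0)" for u
            by (cases u rule: row_cases; simp add: su_rows nes)
              (use k c nes in \<open>auto simp: c_def[symmetric]\<close>)
          then have "x \<in> fixed (?d ** (k ** V))" by (simp add: fixed_def)
          moreover have "fixed (k ** V) \<subseteq> fixed (?d ** (k ** V))"
            by (rule fixed_su[OF sp ne y(2) xf y(3)])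
          ultimately show ?thesis
            using progress[of "?d ** k"] d k G_mult by (auto simp: matrix_mul_assoc)
        next
          case False
          let ?P = "dproj {u. blk u = blk x}"
          \<comment> \<open>All other columns of the block are fixed, so the determinant of the
            block is c itself, and the condition on it forces c = 1.\<close>
          have "k ** V ** ?P + (mat 1 - ?P) = diagm (\<lambda>u. if u = x then c else 1)"
          proof -
            have "(k ** V ** ?P + (mat 1 - ?P)) $ u $ z = diagm (\<lambda>u. if u = x then c else 1) $ u $ z" for u z
            proof -
              have "(k ** V) $ u $ z = (if u = z then 1 else 0)" if "z \<noteq> x" "blk z = blk x"
                using that False by (auto simp: fixed_def)
              moreover have "(k ** V) $ u $ x = (if u = x then c else 0)"
                using k by (auto simp: c_def)
              ultimately show ?thesis
                by (auto simp: mult_dproj_entry mat_1_entry diagm_def) (auto simp: dproj_def)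
            qed
            then show ?thesis by (simp add: vec_eq_iff)
          qed
          moreover have "det (diagm (\<lambda>u. if u = x then c else 1)) = c"
            by (subst det_diagonal) (auto simp: diagm_def prod.delta)
          moreover have "pdet ?P (k ** V) = 1" using sp by (simp add: special_def)
          ultimately have "c = 1" by (simp add: pdet_def)
          then have "x \<in> fixed (k ** V)" using k by (auto simp: fixed_def c_def)
          then show ?thesis using xf by blast
        qed
      qed
    qed
  qed
  moreover have "special (mat 1)" by (auto simp: special_def mat_1_entry inv) (metis inv)+
  then have "mat 1 \<in> G" using matrix_group.one[OF K] by (simp add: G_def)
  ultimately show ?thesis using V by blast
qed

end

section \<open>Hopping matrices\<close>

text \<open>The exponential of the generator that sends the basis vector x to g x * w x times the
  basis vector \<pi> x. Under \<open>hopping\<close> and \<open>strength\<close> this generator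
  squares to - (g x)^2 on each plane, which gives the closed form. The angle may vary from plane to
  plane.\<close>

definition hop :: "('a \<Rightarrow> 'a) \<Rightarrow> ('a \<Rightarrow> complex) \<Rightarrow> ('a \<Rightarrow> real) \<Rightarrow> 'a::finite cmat" where
  "hop \<pi> w g = (\<chi> y x. (if x = y then of_real (cos (g x)) else 0) +
     (if y = \<pi> x then w x * of_real (sin (g x)) else 0))"

text \<open>Together with modulus 1, the product condition says that w (\<pi> x) is minus the
  conjugate of w x, so the generator is anti-Hermitian.\<close>

definition hopping :: "('a \<Rightarrow> 'a) \<Rightarrow> ('a \<Rightarrow> complex) \<Rightarrow> bool" where
  "hopping \<pi> w \<longleftrightarrow> (\<forall>x. \<pi> (\<pi> x) = x \<and> norm (w x) = 1 \<and> (\<pi> x \<noteq> x \<longrightarrow> w x * w (\<pi> x) = - 1))"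

definition strength :: "('a \<Rightarrow> 'a) \<Rightarrow> ('a \<Rightarrow> real) \<Rightarrow> bool" where
  "strength \<pi> g \<longleftrightarrow> (\<forall>x. g (\<pi> x) = g x \<and> (\<pi> x = x \<longrightarrow> g x = 0))"

lemma hop_entry: "hop \<pi> w g $ y $ x = (if x = y then of_real (cos (g x)) else 0) +
     (if y = \<pi> x then w x * of_real (sin (g x)) else 0)"
  by (simp add: hop_def)

lemma mult_hop_entry:
  "(A ** hop \<pi> w g) $ y $ x = A $ y $ x * of_real (cos (g x)) + A $ y $ \<pi> x * (w x * of_real (sin (g x)))"
  unfolding matrix_mult_entry hop_def
  by (simp only: vec_lambda_beta distrib_left sum.distrib if_distrib[of "\<lambda>x. _ * x"]
      mult_zero_right sum.delta' sum.delta finite UNIV_I if_True cong: if_cong)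

text \<open>Where the sine vanishes the partner of x does not enter. This permits exchanging a swap
  of two qubits for an involution that moves only the few strings in the support.\<close>

lemma hop_cong:
  assumes "\<And>x. cos (g x) = cos (g' x)"
    "\<And>x. w x * of_real (sin (g x)) = w' x * of_real (sin (g' x))"
    "\<And>x. sin (g x) \<noteq> 0 \<Longrightarrow> \<pi> x = \<pi>' x"
  shows "hop \<pi> w g = hop \<pi>' w' g'"
proof -
  have "hop \<pi> w g $ y $ x = hop \<pi>' w' g' $ y $ x" for x y
  proof (cases "sin (g x) = 0")
    case True
    then have 0: "w x * of_real (sin (g x)) = 0" by simp
    with assms(2)[of x] have 0: "w x * of_real (sin (g x)) = 0" "w' x * of_real (sin (g' x)) = 0" by simp_all
    show ?thesis unfolding hop_def vec_lambda_beta assms(1)[of x] 0 by simp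
  next
    case False
    show ?thesis
      unfolding hop_def vec_lambda_beta assms(3)[OF False] assms(2)[of x] assms(1)[of x] ..
  qed
  then show ?thesis by (simp add: vec_eq_iff)
qed

lemma hop_0: "hop \<pi> w (\<lambda>_. 0) = mat 1"
  by (auto simp: vec_eq_iff hop_def mat_1_entry)

lemma hop_mult:
  assumes "hopping \<pi> w" "strength \<pi> g" "strength \<pi> g'"
  shows "hop \<pi> w g ** hop \<pi> w g' = hop \<pi> w (\<lambda>x. g x + g' x)"
proof -
  have "(hop \<pi> w g ** hop \<pi> w g') $ y $ x = hop \<pi> w (\<lambda>x. g x + g' x) $ y $ x" for x y
  proof (cases "\<pi> x = x")
    case True
    then show ?thesis using assms by (auto simp: mult_hop_entry hop_entry strength_def)
  next
    case False
    then have w: "w (\<pi> x) * w x = - 1" "\<pi> (\<pi> x) = x" "g (\<pi> x) = g x"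
      using assms unfolding hopping_def strength_def by (metis mult.commute)+
    have "w (\<pi> x) * of_real (sin (g (\<pi> x))) * (w x * of_real (sin (g' x))) =
      (w (\<pi> x) * w x) * (of_real (sin (g x)) * of_real (sin (g' x)))"
      unfolding w(3) by (simp only: mult_ac)
    then have k: "w (\<pi> x) * of_real (sin (g (\<pi> x))) * (w x * of_real (sin (g' x))) =
      - of_real (sin (g x) * sin (g' x))"
      unfolding w(1) by simp
    show ?thesis
      unfolding mult_hop_entry hop_entry distrib_right w(2)
      using False w(3) k by (cases "y = x"; cases "y = \<pi> x")
        (simp_all add: cos_add sin_add distrib_left mult_ac)
  qed
  then show ?thesis by (simp add: vec_eq_iff)
qed

lemma strength_minus: "strength \<pi> g \<Longrightarrow> strength \<pi> (\<lambda>x. - g x)"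
  by (simp add: strength_def)

lemma adjoint_hop:
  assumes "hopping \<pi> w" "strength \<pi> g"
  shows "adjoint_mat (hop \<pi> w g) = hop \<pi> w (\<lambda>x. - g x)"
proof -
  have "cnj (hop \<pi> w g $ x $ y) = hop \<pi> w (\<lambda>x. - g x) $ y $ x" for x y
  proof (cases "\<pi> x = x")
    case True
    moreover have "x = \<pi> y \<Longrightarrow> y = x"
      using assms(1) True unfolding hopping_def by metis
    moreover have "g x = 0" using assms(2) True by (simp add: strength_def)
    ultimately show ?thesis by (auto simp: hop_entry)
  next
    case False
    have w: "w x * w (\<pi> x) = - 1" "\<pi> (\<pi> x) = x" "norm (w x) = 1" "g (\<pi> x) = g x"
      using assms False unfolding hopping_def strength_def by metis+
    then have "w x * cnj (w x) = 1" by (metis complex_norm_square of_real_1 one_power2)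
    then have "cnj (w (\<pi> x)) = - w x"
      using w(1) by (metis (no_types, lifting) complex_cnj_mult complex_cnj_minus complex_cnj_one
          mult.assoc mult.commute mult.right_neutral mult_minus_left)
    moreover have "x = \<pi> y \<longleftrightarrow> y = \<pi> x"
      using assms(1) unfolding hopping_def by metis
    ultimately show ?thesis using w by (auto simp: hop_entry)
  qed
  then show ?thesis by (simp add: vec_eq_iff adjoint_mat_def)
qed

lemma hop_inverse:
  assumes "hopping \<pi> w" "strength \<pi> g"
  shows "hop \<pi> w g ** hop \<pi> w (\<lambda>x. - g x) = mat 1" "hop \<pi> w (\<lambda>x. - g x) ** hop \<pi> w g = mat 1"
  using hop_mult[OF assms strength_minus[OF assms(2)]]
    hop_mult[OF assms(1) strength_minus[OF assms(2)] assms(2)] by (simp_all add: hop_0)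

lemma unitary_hop: "hopping \<pi> w \<Longrightarrow> strength \<pi> g \<Longrightarrow> unitary (hop \<pi> w g)"
  by (simp add: unitary_def adjoint_hop hop_inverse)

definition monomial :: "('a \<Rightarrow> 'a) \<Rightarrow> ('a \<Rightarrow> complex) \<Rightarrow> 'a::finite cmat" where
  "monomial \<rho> d = (\<chi> y x. if y = \<rho> x then d x else 0)"

lemma mult_monomial_entry: "(A ** monomial \<rho> d) $ y $ x = A $ y $ \<rho> x * d x"
  unfolding matrix_mult_entry monomial_def
  by (simp only: vec_lambda_beta if_distrib[of "\<lambda>x. _ * x"]
      mult_zero_right sum.delta' sum.delta finite UNIV_I if_True cong: if_cong)

text \<open>Conjugation by a monomial matrix relabels the planes by \<rho> and multiplies the
  amplitude at x by the ratio d (\<pi> x) / d x. The intertwining form is what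
  \<open>conj_mem\<close> takes and involves no inverse.\<close>

lemma monomial_hop_intertwine:
  assumes "inj \<rho>"
    and "\<And>x. cos (g' (\<rho> x)) = cos (g x)"
    and "\<And>x. w' (\<rho> x) * of_real (sin (g' (\<rho> x))) * d x = w x * of_real (sin (g x)) * d (\<pi> x)"
    and "\<And>x. sin (g x) \<noteq> 0 \<Longrightarrow> \<pi>' (\<rho> x) = \<rho> (\<pi> x)" and "\<And>x. d x \<noteq> 0"
  shows "monomial \<rho> d ** hop \<pi> w g = hop \<pi>' w' g' ** monomial \<rho> d"
proof -
  have "(monomial \<rho> d ** hop \<pi> w g) $ y $ x = (hop \<pi>' w' g' ** monomial \<rho> d) $ y $ x" for x y
  proof -
    have "(monomial \<rho> d ** hop \<pi> w g) $ y $ x = (if y = \<rho> x then d x * of_real (cos (g x)) else 0) +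
       (if y = \<rho> (\<pi> x) then w x * of_real (sin (g x)) * d (\<pi> x) else 0)"
      by (simp add: mult_hop_entry) (simp add: monomial_def)
    also have "\<dots> = (if \<rho> x = y then of_real (cos (g' (\<rho> x))) * d x else 0) +
       (if y = \<pi>' (\<rho> x) then w' (\<rho> x) * of_real (sin (g' (\<rho> x))) * d x else 0)"
      unfolding assms(2,3) using assms(4)[of x] by (cases "sin (g x) = 0") auto
    also have "\<dots> = (hop \<pi>' w' g' ** monomial \<rho> d) $ y $ x"
      by (simp add: mult_monomial_entry hop_entry distrib_right)
    finally show ?thesis .
  qed
  then show ?thesis by (simp add: vec_eq_iff)
qed

text \<open>At a right angle the cosine vanishes on all moved strings; for \<open>xy\<close> this is
  the iSWAP gate.\<close>

lemma hop_half_pi: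
  assumes "strength \<rho> g" "\<And>x. \<rho> x \<noteq> x \<Longrightarrow> g x = pi / 2"
  shows "hop \<rho> v g = monomial \<rho> (\<lambda>x. if \<rho> x = x then 1 else v x)"
proof -
  have "hop \<rho> v g $ y $ x = monomial \<rho> (\<lambda>x. if \<rho> x = x then 1 else v x) $ y $ x" for x y
  proof (cases "\<rho> x = x")
    case True
    then show ?thesis using assms(1) by (simp add: hop_entry monomial_def strength_def)
  next
    case False
    show ?thesis unfolding hop_entry assms(2)[OF False] using False by (simp add: monomial_def)
  qed
  then show ?thesis by (simp add: vec_eq_iff)
qed

context matrix_group
begin

lemma inverse_mem: "A \<in> K \<Longrightarrow> A ** B = mat 1 \<Longrightarrow> B \<in> K"
  by (metis adj matrix_mul_assoc matrix_mul_lid matrix_mul_rid unit unitary_def)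

lemma conj_mem:
  assumes "D \<in> K" "A \<in> K" "D ** A = B ** D"
  shows "B \<in> K"
proof -
  have "B = B ** (D ** adjoint_mat D)" using unit[OF assms(1)] by (simp add: unitary_def)
  also have "\<dots> = D ** A ** adjoint_mat D" by (simp add: matrix_mul_assoc assms(3))
  finally show ?thesis using assms mult adj by metis
qed

end

section \<open>Three qubits and quaternions\<close>

lemma i_sandwich: "\<i> * z * \<i> = - z"
  by (simp add: complex_eq_iff)

type_synonym 'n bits = "'n \<Rightarrow> bool"

definition swp :: "'n \<Rightarrow> 'n \<Rightarrow> 'n bits \<Rightarrow> 'n bits" where
  "swp j l x = x(j := x l, l := x j)"

lemma swp_swp [simp]: "swp j l (swp j l x) = x"
  by (auto simp: swp_def)

lemma swp_simps: "swp j l x j = x l" "swp j l x l = x j"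
  "m \<noteq> j \<Longrightarrow> m \<noteq> l \<Longrightarrow> swp j l x m = x m"
  by (auto simp: swp_def)

lemma swp_eq_iff: "swp j l x = x \<longleftrightarrow> x j = x l"
  by (auto simp: swp_def fun_eq_iff)

lemma hopping_swp: "hopping (swp j l) (\<lambda>_. \<i>)"
  by (simp add: hopping_def)

lemma strength_swp:
  assumes "\<And>x. x j \<noteq> x l \<Longrightarrow> f (swp j l x) = f x"
  shows "strength (swp j l) (\<lambda>x. if x j \<noteq> x l then f x else 0)"
  using assms by (auto simp: strength_def swp_simps swp_eq_iff)

text \<open>This is $\exp(i t (X_jX_k + Y_jY_k)/2)$.\<close>

definition xy :: "'n \<Rightarrow> 'n \<Rightarrow> real \<Rightarrow> 'n::finite qop" where
  "xy j k t = hop (swp j k) (\<lambda>_. \<i>) (\<lambda>x. if x j \<noteq> x k then t else 0)"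

lemma strength_xy: "strength (swp j k) (\<lambda>x. if x j \<noteq> x k then t else 0)"
  by (rule strength_swp) simp

lemma xy_mult: "xy j k s ** xy j k t = xy j k (s + t)"
  unfolding xy_def hop_mult[OF hopping_swp strength_xy strength_xy]
  by (rule arg_cong[where f="hop _ _"]) auto

lemma xy_0: "xy j k 0 = mat 1"
  by (simp add: xy_def hop_0)

lemma unitary_xy: "unitary (xy j k t)"
  unfolding xy_def by (intro unitary_hop hopping_swp strength_xy)

locale three_qubits =
  fixes j k l :: "'n::finite"
  assumes dist: "j \<noteq> k" "j \<noteq> l" "k \<noteq> l"
begin

definition agree :: "'n bits \<Rightarrow> 'n bits \<Rightarrow> bool" where
  "agree x y \<longleftrightarrow> (\<forall>i. i \<notin> {j, k, l} \<longrightarrow> x i = y i)"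

text \<open>A triple of bits is encoded by its majority value and the position 1, 2, 3 of the
  dissenting bit (0 if there is none).\<close>

definition maj :: "'n bits \<Rightarrow> bool" where
  "maj x = (if x j = x k then x j else x l)"

definition odd_pos :: "'n bits \<Rightarrow> nat" where
  "odd_pos x = (if x j = x k then if x k = x l then 0 else 3 else if x j = x l then 2 else 1)"

definition rebuild :: "'n bits \<Rightarrow> nat \<Rightarrow> 'n bits" where
  "rebuild x p = x(j := (maj x \<noteq> (p = 1)), k := (maj x \<noteq> (p = 2)), l := (maj x \<noteq> (p = 3)))"

lemma odd_pos_less: "odd_pos x < 4"
  by (simp add: odd_pos_def)

lemma rebuild_props:
  assumes "p < 4"
  shows "odd_pos (rebuild x p) = p" "maj (rebuild x p) = maj x" "agree x (rebuild x p)"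
proof -
  have "p = 0 \<or> p = 1 \<or> p = 2 \<or> p = 3" using assms by linarith
  then show "odd_pos (rebuild x p) = p" "maj (rebuild x p) = maj x" "agree x (rebuild x p)"
    using dist by (auto simp: odd_pos_def maj_def rebuild_def agree_def)
qed

lemma rebuild_odd_pos:
  assumes "agree x z" "maj z = maj x"
  shows "rebuild x (odd_pos z) = z"
proof
  fix i show "rebuild x (odd_pos z) i = z i"
    using assms dist unfolding rebuild_def odd_pos_def agree_def maj_def
    by (cases "i \<in> {j, k, l}"; cases "z j"; cases "z k"; cases "z l") auto
qed

text \<open>Hopping within three qubits preserves their weight and commutes with flipping all of
  them. It thus acts on a single excitation as it does on a single hole, and one 4 by 4 matrix
  describes both majority values.\<close>

definition three :: "(nat \<Rightarrow> nat \<Rightarrow> complex) \<Rightarrow> 'n qop" where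
  "three M = (\<chi> x y. if agree x y \<and> maj x = maj y then M (odd_pos x) (odd_pos y) else 0)"

lemma three_entry: "three M $ x $ y = (if agree x y \<and> maj x = maj y then M (odd_pos x) (odd_pos y) else 0)"
  by (simp add: three_def)

lemma three_cong: "(\<And>p r. p < 4 \<Longrightarrow> r < 4 \<Longrightarrow> M p r = M' p r) \<Longrightarrow> three M = three M'"
  by (simp add: vec_eq_iff three_entry odd_pos_less)

lemma three_mult:
  "three M ** three M' = three (\<lambda>p r. \<Sum>q<4. M p q * M' q r)"
proof -
  have "(three M ** three M') $ x $ y = three (\<lambda>p r. \<Sum>q<4. M p q * M' q r) $ x $ y" for x y
  proof (cases "agree x y \<and> maj x = maj y")
    case True
    have "(three M ** three M') $ x $ y =
      (\<Sum>z\<in>rebuild x ` {..<4}. three M $ x $ z * three M' $ z $ y)"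
      unfolding matrix_mult_entry
    proof (rule sum.mono_neutral_right)
      show "\<forall>z\<in>UNIV - rebuild x ` {..<4}. three M $ x $ z * three M' $ z $ y = 0"
      proof
        fix z assume "z \<in> UNIV - rebuild x ` {..<4}"
        then have "\<not> (agree x z \<and> maj x = maj z)"
          using rebuild_odd_pos[of x z] odd_pos_less[of z] by (metis DiffD2 image_eqI lessThan_iff)
        then show "three M $ x $ z * three M' $ z $ y = 0" by (auto simp: three_entry)
      qed
    qed auto
    also have "\<dots> = (\<Sum>q<4. three M $ x $ rebuild x q * three M' $ rebuild x q $ y)"
      by (rule sum.reindex_cong[of "rebuild x"]) (auto intro!: inj_onI dest: arg_cong[of _ _ odd_pos] simp: rebuild_props)
    also have "\<dots> = (\<Sum>q<4. M (odd_pos x) q * M' q (odd_pos y))"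
    proof (rule sum.cong)
      fix q :: nat assume "q \<in> {..<4}"
      then have q: "odd_pos (rebuild x q) = q" "maj (rebuild x q) = maj x" "agree x (rebuild x q)"
        using rebuild_props[of q x] by simp_all
      moreover have "agree (rebuild x q) y" using q(3) True by (simp add: agree_def)
      ultimately show "three M $ x $ rebuild x q * three M' $ rebuild x q $ y = M (odd_pos x) q * M' q (odd_pos y)"
        using True by (simp add: three_entry)
    qed simp
    finally show ?thesis using True by (simp add: three_entry)
  next
    case False
    have "three M $ x $ z * three M' $ z $ y = 0" for z
      using False by (auto simp: three_entry agree_def)
    then have "(three M ** three M') $ x $ y = 0"
      unfolding matrix_mult_entry by (intro sum.neutral) blast
    then show ?thesis using False by (auto simp: three_entry)
  qed
  then show ?thesis by (simp add: vec_eq_iff)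
qed

text \<open>A diagonal change of basis that makes the imaginary hoppings between positions 1, 2 and
  between 2, 3 real, so that the gates become rotations of real 3-space.\<close>

definition phase :: "nat \<Rightarrow> complex" where
  "phase p = (if p = 2 then \<i> else if p = 3 then - 1 else 1)"

text \<open>The rotation matrix of a quaternion, in rows and columns 1, 2, 3, together with the squared
  norm in position 0.\<close>

definition qrot :: "real \<Rightarrow> real \<Rightarrow> real \<Rightarrow> real \<Rightarrow> nat \<Rightarrow> nat \<Rightarrow> real" where
  "qrot a b c d p r =
    (if p = 0 then (if r = 0 then a\<^sup>2 + b\<^sup>2 + c\<^sup>2 + d\<^sup>2 else 0)
     else if p = 1 then (if r = 0 then 0 else if r = 1 then a\<^sup>2 + b\<^sup>2 - c\<^sup>2 - d\<^sup>2
       else if r = 2 then 2 * (b * c - a * d) else 2 * (b * d + a * c))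
     else if p = 2 then (if r = 0 then 0 else if r = 1 then 2 * (b * c + a * d)
       else if r = 2 then a\<^sup>2 - b\<^sup>2 + c\<^sup>2 - d\<^sup>2 else 2 * (c * d - a * b))
     else (if r = 0 then 0 else if r = 1 then 2 * (b * d - a * c)
       else if r = 2 then 2 * (c * d + a * b) else a\<^sup>2 - b\<^sup>2 - c\<^sup>2 + d\<^sup>2))"

definition quat :: "real \<Rightarrow> real \<Rightarrow> real \<Rightarrow> real \<Rightarrow> 'n qop" where
  "quat a b c d = three (\<lambda>p r. phase p * of_real (qrot a b c d p r) * cnj (phase r))"

text \<open>The map from quaternions to rotations is multiplicative as a polynomial identity. The
  entry in position 0 is Euler's four-square identity, so quaternions of any norm are
  covered.\<close>

lemma qrot_mult:
  assumes "p < 4" "r < 4"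
  shows "(\<Sum>q<4. qrot a b c d p q * qrot a' b' c' d' q r) =
    qrot (a*a' - b*b' - c*c' - d*d') (a*b' + b*a' + c*d' - d*c')
      (a*c' - b*d' + c*a' + d*b') (a*d' + b*c' - c*b' + d*a') p r"
proof -
  have s: "(\<Sum>q<4. f q) = f 0 + f 1 + f 2 + f (3::nat)" for f :: "nat \<Rightarrow> real"
    by (simp add: eval_nat_numeral)
  have "p = 0 \<or> p = 1 \<or> p = 2 \<or> p = 3" "r = 0 \<or> r = 1 \<or> r = 2 \<or> r = 3" using assms by linarith+
  then show ?thesis
    unfolding s by (elim disjE) (simp_all add: qrot_def power2_eq_square algebra_simps)
qed

lemma quat_mult:
  "quat a b c d ** quat a' b' c' d' =
    quat (a*a' - b*b' - c*c' - d*d') (a*b' + b*a' + c*d' - d*c')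
      (a*c' - b*d' + c*a' + d*b') (a*d' + b*c' - c*b' + d*a')"
proof -
  have ph: "cnj (phase q) * phase q = 1" for q by (simp add: phase_def)
  have "(\<Sum>q<4. phase p * of_real (qrot a b c d p q) * cnj (phase q) *
      (phase q * of_real (qrot a' b' c' d' q r) * cnj (phase r))) =
    phase p * of_real (\<Sum>q<4. qrot a b c d p q * qrot a' b' c' d' q r) * cnj (phase r)" for p r
  proof -
    have "phase p * of_real (qrot a b c d p q) * cnj (phase q) *
      (phase q * of_real (qrot a' b' c' d' q r) * cnj (phase r)) =
      phase p * of_real (qrot a b c d p q * qrot a' b' c' d' q r) * cnj (phase r) * (cnj (phase q) * phase q)" for q
      by (simp add: mult_ac)
    then show ?thesis unfolding ph of_real_sum sum_distrib_left sum_distrib_right mult_1_right by (rule sum.cong[OF refl])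
  qed
  then show ?thesis
    unfolding quat_def three_mult by (intro three_cong) (simp only: qrot_mult)
qed

lemma eq_iff_agree: "x = y \<longleftrightarrow> agree x y \<and> x j = y j \<and> x k = y k \<and> x l = y l"
  unfolding agree_def by (auto simp: fun_eq_iff)

lemma eq_swp_jk: "y = swp j k x \<longleftrightarrow> agree y x \<and> y j = x k \<and> y k = x j \<and> y l = x l"
  unfolding eq_iff_agree[of y "swp j k x"] using dist by (auto simp: agree_def swp_simps)

lemma eq_swp_kl: "y = swp k l x \<longleftrightarrow> agree y x \<and> y j = x j \<and> y k = x l \<and> y l = x k"
  unfolding eq_iff_agree[of y "swp k l x"] using dist by (auto simp: agree_def swp_simps)

lemma agree_sym: "agree x y = agree y x"
  by (auto simp: agree_def)

lemma trig_halves: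
  "of_real (cos (2 * t)) = (of_real (cos t))\<^sup>2 - (of_real (sin t) :: complex)\<^sup>2"
  "of_real (sin (2 * t)) = 2 * of_real (cos t) * (of_real (sin t) :: complex)"
  "(of_real (cos t))\<^sup>2 + (of_real (sin t) :: complex)\<^sup>2 = 1"
  unfolding cos_double sin_double by (simp_all flip: of_real_power of_real_add of_real_diff)

lemma quat_xy_jk: "quat (cos t) 0 0 (sin t) = xy j k (2 * t)"
proof -
  have "quat (cos t) 0 0 (sin t) $ y $ x = xy j k (2 * t) $ y $ x" for x y
  proof (cases "agree y x")
    case True
    show ?thesis
      unfolding xy_def hop_entry eq_swp_jk eq_iff_agree[of x y] agree_sym[of x y] quat_def three_entry
        maj_def odd_pos_def
      using True trig_halves[of t]
      by (cases "x j"; cases "x k"; cases "x l"; cases "y j"; cases "y k"; cases "y l")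
         (simp_all add: phase_def qrot_def i_sandwich)
  next
    case False
    then show ?thesis
      unfolding xy_def hop_entry eq_swp_jk eq_iff_agree[of x y] agree_sym[of x y] quat_def three_entry by simp
  qed
  then show ?thesis by (simp add: vec_eq_iff)
qed

lemma quat_xy_kl: "quat (cos t) (sin t) 0 0 = xy k l (2 * t)"
proof -
  have "quat (cos t) (sin t) 0 0 $ y $ x = xy k l (2 * t) $ y $ x" for x y
  proof (cases "agree y x")
    case True
    show ?thesis
      unfolding xy_def hop_entry eq_swp_kl eq_iff_agree[of x y] agree_sym[of x y] quat_def three_entry
        maj_def odd_pos_def
      using True trig_halves[of t]
      by (cases "x j"; cases "x k"; cases "x l"; cases "y j"; cases "y k"; cases "y l")
         (simp_all add: phase_def qrot_def i_sandwich)
  next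
    case False
    then show ?thesis
      unfolding xy_def hop_entry eq_swp_kl eq_iff_agree[of x y] agree_sym[of x y] quat_def three_entry by simp
  qed
  then show ?thesis by (simp add: vec_eq_iff)
qed

lemma tendsto_quat:
  assumes "(a \<longlongrightarrow> a0) F" "(b \<longlongrightarrow> b0) F" "(c \<longlongrightarrow> c0) F" "(d \<longlongrightarrow> d0) F"
  shows "((\<lambda>n. quat (a n) (b n) (c n) (d n)) \<longlongrightarrow> quat a0 b0 c0 d0) F"
proof (intro vec_tendstoI)
  fix x y
  have "((\<lambda>n. qrot (a n) (b n) (c n) (d n) p r) \<longlongrightarrow> qrot a0 b0 c0 d0 p r) F" for p r
    unfolding qrot_def by (auto intro!: tendsto_intros assms)
  then show "((\<lambda>n. quat (a n) (b n) (c n) (d n) $ x $ y) \<longlongrightarrow> quat a0 b0 c0 d0 $ x $ y) F"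
    unfolding quat_def three_entry by (auto intro!: tendsto_intros)
qed

end

section \<open>Closed subgroups of the reals\<close>

lemma int_multiple_mem:
  fixes T :: "real set"
  assumes zero: "0 \<in> T"
    and add: "\<And>s t. s \<in> T \<Longrightarrow> t \<in> T \<Longrightarrow> s + t \<in> T"
    and uminus: "\<And>t. t \<in> T \<Longrightarrow> - t \<in> T"
    and s: "s \<in> T"
  shows "of_int n * s \<in> T"
proof -
  have nat: "of_nat n * s \<in> T" for n
    by (induction n) (use zero add s in \<open>auto simp: distrib_right\<close>)
  show ?thesis
  proof (cases "n \<ge> 0")
    case True
    then show ?thesis using nat[of "nat n"] by simp
  next
    case False
    then show ?thesis using uminus[OF nat[of "nat (- n)"]] by simp
  qed
qed

text \<open>The integer multiples of a nonzero element s come within distance |s| of every real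
  number.\<close>

lemma closed_subgroup_UNIV:
  fixes T :: "real set"
  assumes closed: "closed T" and zero: "0 \<in> T"
    and add: "\<And>s t. s \<in> T \<Longrightarrow> t \<in> T \<Longrightarrow> s + t \<in> T"
    and uminus: "\<And>t. t \<in> T \<Longrightarrow> - t \<in> T"
    and small: "\<And>\<epsilon>. \<epsilon> > 0 \<Longrightarrow> \<exists>t\<in>T. t \<noteq> 0 \<and> \<bar>t\<bar> < \<epsilon>"
  shows "t \<in> T"
proof -
  have "\<exists>s\<in>T. dist s t < \<epsilon>" if eps: "\<epsilon> > 0" for \<epsilon>
  proof -
    obtain s where s: "s \<in> T" "s \<noteq> 0" "\<bar>s\<bar> < \<epsilon>" using small[OF eps] by blast
    define n where "n = \<lfloor>t / s\<rfloor>"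
    have "of_int n \<le> t / s" "t / s < of_int n + 1" by (auto simp: n_def)
    then have "\<bar>t / s - of_int n\<bar> < 1" by simp
    then have "\<bar>t / s - of_int n\<bar> * \<bar>s\<bar> < 1 * \<bar>s\<bar>"
      using s(2) by (intro mult_strict_right_mono) simp_all
    also have "\<bar>t / s - of_int n\<bar> * \<bar>s\<bar> = \<bar>t - of_int n * s\<bar>"
      using s(2) by (simp add: abs_mult[symmetric] left_diff_distrib)
    finally have "dist (of_int n * s) t < \<epsilon>"
      using s(3) by (simp add: dist_real_def)
    then show ?thesis using int_multiple_mem[OF zero add uminus s(1)] by blast
  qed
  then have "t \<in> closure T" by (simp add: closure_approachable)
  then show ?thesis using closed by simp
qed

text \<open>Dirichlet approximation of h / pi makes the combination small; the hypothesis on h makes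
  it nonzero.\<close>

lemma small_combination:
  fixes h :: real
  assumes "\<And>k m :: int. k > 0 \<Longrightarrow> of_int k * h \<noteq> of_int m * pi" and "\<epsilon> > 0"
  obtains k m :: int where "of_int k * h - of_int m * pi \<noteq> 0" "\<bar>of_int k * h - of_int m * pi\<bar> < \<epsilon>"
proof -
  obtain N :: nat where N: "pi / \<epsilon> < N" using reals_Archimedean2 by blast
  moreover have "pi / \<epsilon> > 0" using assms(2) by simp
  ultimately have "N > 0" by (metis less_trans of_nat_0_less_iff)
  obtain m k :: int where mk: "0 < k" "k \<le> int N" "\<bar>of_int k * (h / pi) - of_int m\<bar> < 1 / of_int N"
    using Dirichlet_approx[OF \<open>N > 0\<close>, of "h / pi"] by (metis of_int_of_nat_eq)
  have "\<bar>of_int k * h - of_int m * pi\<bar> = \<bar>of_int k * (h / pi) - of_int m\<bar> * \<bar>pi\<bar>"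
    by (simp only: abs_mult[symmetric] left_diff_distrib) simp
  also have "\<dots> < 1 / of_int N * pi"
    using mult_strict_right_mono[OF mk(3) pi_gt_zero] by simp
  also have "\<dots> < \<epsilon>" using N \<open>N > 0\<close> assms(2) by (simp add: field_simps)
  finally show ?thesis using that assms(1)[OF mk(1), of m] by auto
qed

text \<open>\<open>2 cos h\<close> is not an algebraic integer: the powers of 2 in the denominators of
  \<open>2 cos (k h)\<close> increase with \<open>k\<close>.\<close>

lemma cos_multiple_neq_1:
  assumes h: "2 * cos h = (2 * sqrt 2 - 1) / 2" and k: "k > 0"
  shows "cos (real k * h) \<noteq> 1"
proof -
  \<comment> \<open>The factor 2 ^ k clears the denominators, so the Chebyshev recurrence for the
    cosines has coefficients in Z[sqrt 2].\<close>
  define C where "C = (\<lambda>k. 2 ^ k * (2 * cos (real k * h)))"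
  have rec: "C (k + 2) = (2 * sqrt 2 - 1) * C (k + 1) - 4 * C k" for k
  proof -
    have "cos (real (k + 2) * h) + cos (real k * h) = 2 * cos (real (k + 1) * h) * cos h"
      using cos_plus_cos[of "real (k + 2) * h" "real k * h"] by (simp add: algebra_simps add_divide_distrib)
    then have eq: "2 * cos (real (k + 2) * h) = (2 * cos h) * (2 * cos (real (k + 1) * h)) - 2 * cos (real k * h)"
      by algebra
    have gen: "P * (2 * 2) * ((s - 1) / 2 * B - D) = (s - 1) * (P * 2 * B) - 4 * (P * D)"
      for B D P s :: real by (simp add: field_simps)
    show ?thesis
      unfolding C_def eq h power_add power2_eq_square power_one_right gen ..
  qed
  \<comment> \<open>Modulo 2 the recurrence only negates the preceding rational part, so this part
    stays odd. A cosine equal to 1 would instead make C k the integer 2 ^ (k + 1), and the parity of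
    squares excludes this.\<close>
  have "\<exists>(p::int) (q::int) (p'::int) (q'::int). odd p \<and> odd p' \<and> C (k + 1) = p + q * sqrt 2 \<and> C (k + 2) = p' + q' * sqrt 2" for k
  proof (induction k)
    case 0
    have C1: "C 1 = 2 * sqrt 2 - 1" using h by (simp add: C_def)
    have "C 2 = (2 * sqrt 2 - 1) * C 1 - 4 * C 0" using rec[of 0] by (simp add: numeral_2_eq_2)
    then have C2: "C 2 = 1 - 4 * sqrt 2" unfolding C1 by (simp add: C_def algebra_simps)
    show ?case
    proof (intro exI conjI)
      show "odd (- 1 :: int)" "odd (1 :: int)" by simp_all
      show "C (0 + 1) = of_int (- 1) + of_int 2 * sqrt 2" using C1 by simp
      show "C (0 + 2) = of_int 1 + of_int (- 4) * sqrt 2" using C2 by (simp add: numeral_2_eq_2)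
    qed
  next
    case (Suc k)
    then obtain p q p' q' :: int where *: "odd p" "odd p'" "C (k + 1) = p + q * sqrt 2" "C (k + 2) = p' + q' * sqrt 2"
      by blast
    have "C (Suc k + 2) = (2 * sqrt 2 - 1) * C (k + 2) - 4 * C (k + 1)"
      using rec[of "Suc k"] by simp
    also have "\<dots> = of_int (4 * q' - p' - 4 * p) + of_int (2 * p' - q' - 4 * q) * sqrt 2"
      unfolding * by (simp add: algebra_simps)
    finally have "C (Suc k + 2) = of_int (4 * q' - p' - 4 * p) + of_int (2 * p' - q' - 4 * q) * sqrt 2" .
    moreover have "C (Suc k + 1) = p' + q' * sqrt 2" using *(4) by simp
    moreover have "odd (4 * q' - p' - 4 * p)" using *(2) by simp
    ultimately show ?case using *(2) by blast
  qed
  from this[of "k - 1"] obtain p q :: int where pq: "odd p" "C k = p + q * sqrt 2" using k by auto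
  show ?thesis
  proof
    assume "cos (real k * h) = 1"
    then have "of_int q * sqrt 2 = of_int (2 ^ (k + 1) - p)"
      using pq(2) by (simp add: C_def)
    then have "(of_int q * sqrt 2) ^ 2 = (of_int (2 ^ (k + 1) - p)) ^ 2" by simp
    then have "of_int (q\<^sup>2 * 2) = (of_int ((2 ^ (k + 1) - p)\<^sup>2) :: real)"
      by (simp add: power_mult_distrib)
    then have "q\<^sup>2 * 2 = (2 ^ (k + 1) - p)\<^sup>2" by (simp only: of_int_eq_iff)
    moreover have "odd ((2 ^ (k + 1) - p)\<^sup>2)" using pq(1) by simp
    ultimately show False by (metis dvd_triv_right)
  qed
qed

section \<open>From the gates on three qubits to hopping by arbitrary angles\<close>

context three_qubits
begin

lemma quat_uminus: "quat (- a) (- b) (- c) (- d) = quat a b c d"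
  unfolding quat_def by (rule three_cong) (simp add: qrot_def)

lemma quat_cong: "a = a' \<Longrightarrow> b = b' \<Longrightarrow> c = c' \<Longrightarrow> d = d' \<Longrightarrow> quat a b c d = quat a' b' c' d'"
  by simp

lemma quat_one: "quat 1 0 0 0 = mat 1"
  using quat_xy_jk[of 0] by (simp add: xy_0)

lemma closed_quat_preimage:
  assumes "closed K" "continuous_on UNIV a" "continuous_on UNIV b" "continuous_on UNIV c" "continuous_on UNIV d"
  shows "closed {t :: real. quat (a t) (b t) (c t) (d t) \<in> K}"
proof -
  have "continuous_on UNIV (\<lambda>t. quat (a t) (b t) (c t) (d t))"
    using assms(2-) unfolding continuous_on_def by (auto intro: tendsto_quat)
  then have "closed ((\<lambda>t. quat (a t) (b t) (c t) (d t)) -` K)"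
    using assms(1) by (intro closed_vimage)
  then show ?thesis by (simp add: vimage_def)
qed

lemma xy_all_angles:
  assumes grp: "matrix_group K" and cl: "closed K"
    and jk: "xy j k (pi / 4) \<in> K" and kl: "xy k l (pi / 4) \<in> K"
  shows "xy j k t \<in> K"
proof -
  note mult = matrix_group.mult[OF grp] and one = matrix_group.one[OF grp]
    and inverse_mem = matrix_group.inverse_mem[OF grp]
  define c s where "c = cos (pi / 8)" and "s = sin (pi / 8)"
  have cs: "c\<^sup>2 + s\<^sup>2 = 1" by (simp add: c_def s_def)
  have pos: "c > 0" "s > 0"
    unfolding c_def s_def by (auto intro!: cos_gt_zero sin_gt_zero)
  have c2: "c\<^sup>2 = (2 + sqrt 2) / 4"
    using cos_double_cos[of "pi / 8"] by (simp add: c_def cos_45)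
  \<comment> \<open>The product of the two gates is the quaternion with real part c^2 and vector
    part (c s, s^2, s c). The latter is s N times the unit axis (v1, v2, v1), and h is half the
    rotation angle.\<close>
  define N where "N = sqrt (1 + c\<^sup>2)"
  have N: "N\<^sup>2 = 1 + c\<^sup>2" "N > 0" by (auto simp: N_def add_pos_nonneg)
  define v1 v2 where "v1 = c / N" and "v2 = s / N"
  have v: "2 * v1\<^sup>2 + v2\<^sup>2 = 1"
  proof -
    have "2 * v1\<^sup>2 + v2\<^sup>2 = (2 * c\<^sup>2 + s\<^sup>2) / N\<^sup>2"
      by (simp add: v1_def v2_def power_divide add_divide_distrib)
    also have "2 * c\<^sup>2 + s\<^sup>2 = N\<^sup>2" using cs N by simp
    finally show ?thesis using N(2) by simp
  qed
  have v1_pos: "v1 > 0" using pos N by (simp add: v1_def)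
  define qv where "qv = (\<lambda>t. quat (cos t) (sin t * v1) (sin t * v2) (sin t * v1))"
  have qv_add: "qv a ** qv b = qv (a + b)" for a b
  proof -
    have "cos a * cos b - sin a * v1 * (sin b * v1) - sin a * v2 * (sin b * v2) - sin a * v1 * (sin b * v1) =
      cos a * cos b - sin a * sin b * (2 * v1\<^sup>2 + v2\<^sup>2)" by algebra
    then show ?thesis
      unfolding qv_def quat_mult v cos_add sin_add by (simp add: algebra_simps)
  qed
  define T where "T = {t. qv t \<in> K}"
  have qv0: "qv 0 = mat 1" by (simp add: qv_def quat_one)
  have T_zero: "0 \<in> T" by (simp add: T_def qv0 one)
  have T_add: "a + b \<in> T" if "a \<in> T" "b \<in> T" for a b
    using that mult by (auto simp: T_def simp flip: qv_add)
  have T_minus: "- a \<in> T" if "a \<in> T" for a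
    using that inverse_mem[of "qv a" "qv (- a)"] by (simp add: T_def qv_add qv0)
  \<comment> \<open>A quaternion and its negative give the same rotation, so half angles count
    modulo pi.\<close>
  have T_pi: "pi \<in> T"
    using quat_uminus[of 1 0 0 0] one by (simp add: T_def qv_def quat_one)
  define h where "h = arccos (c\<^sup>2)"
  have c2_le: "c\<^sup>2 \<le> 1" using cs zero_le_power2[of s] by linarith
  have cos_h: "cos h = c\<^sup>2" using c2_le by (simp add: h_def cos_arccos_abs)
  have sin_h: "sin h = s * N"
  proof -
    have "sin h = sqrt (1 - (c\<^sup>2)\<^sup>2)" unfolding h_def using c2_le
      by (intro sin_arccos) (simp_all add: order_trans[of _ 0])
    also have "1 - (c\<^sup>2)\<^sup>2 = (s * N)\<^sup>2" unfolding power_mult_distrib N(1) using cs by algebra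
    finally show ?thesis using pos N by simp
  qed
  have T_h: "h \<in> T"
  proof -
    have "quat c 0 0 s \<in> K" "quat c s 0 0 \<in> K"
      using jk kl quat_xy_jk[of "pi / 8"] quat_xy_kl[of "pi / 8"] by (simp_all add: c_def s_def)
    then have "quat c 0 0 s ** quat c s 0 0 \<in> K" by (rule mult)
    also have "quat c 0 0 s ** quat c s 0 0 = qv h"
      unfolding quat_mult qv_def cos_h sin_h v1_def v2_def using N(2) by (simp add: power2_eq_square mult.commute)
    finally show ?thesis by (simp add: T_def)
  qed
  \<comment> \<open>\<open>cos_multiple_neq_1\<close> is applied to the full rotation angle 2 h,
    because 2 cos (2 h) = 4 c^4 - 2 has the required value.\<close>
  have irr: "of_int k * h \<noteq> of_int m * pi" if "k > 0" for k m :: int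
  proof
    assume eq: "of_int k * h = of_int m * pi"
    have e: "real (nat k) * (2 * h) = (2 * pi) * of_int m" using eq that by simp
    have "cos (real (nat k) * (2 * h)) = 1" unfolding e by (rule cos_int_2pin)
    moreover have "2 * cos (2 * h) = (2 * sqrt 2 - 1) / 2"
      unfolding cos_double_cos cos_h c2 by (simp add: power2_eq_square field_simps)
    ultimately show False using cos_multiple_neq_1[of "2 * h" "nat k"] that by simp
  qed
  have T_all: "a \<in> T" for a
  proof (rule closed_subgroup_UNIV[OF _ T_zero T_add T_minus])
    show "closed T" unfolding T_def qv_def
      by (rule closed_quat_preimage[OF cl]) (intro continuous_intros)+
    fix \<epsilon> :: real assume "\<epsilon> > 0"
    then obtain k m :: int where km: "of_int k * h - of_int m * pi \<noteq> 0" "\<bar>of_int k * h - of_int m * pi\<bar> < \<epsilon>"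
      using small_combination[OF irr] by blast
    have "of_int k * h + - (of_int m * pi) \<in> T"
      by (intro T_add T_minus int_multiple_mem[OF T_zero T_add T_minus] T_h T_pi)
    then show "\<exists>t\<in>T. t \<noteq> 0 \<and> \<bar>t\<bar> < \<epsilon>" using km by (intro bexI[of _ "of_int k * h - of_int m * pi"]) auto
  qed
  \<comment> \<open>Four gates on j, k make a half turn about the third axis. Conjugation by it
    moves the axis (v1, v2, v1) to (- v1, - v2, v1).\<close>
  have conj: "quat (cos b) (- (sin b * v1)) (- (sin b * v2)) (sin b * v1) \<in> K" for b
  proof -
    have "xy j k (pi / 4) ** xy j k (pi / 4) ** (xy j k (pi / 4) ** xy j k (pi / 4)) \<in> K"
      using jk mult by blast
    then have "quat 0 0 0 1 \<in> K"
      using quat_xy_jk[of "pi / 2"] by (simp add: xy_mult)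
    moreover have "qv b \<in> K" using T_all by (simp add: T_def)
    ultimately have "quat 0 0 0 1 ** qv b ** quat (- 0) (- 0) (- 0) (- 1) \<in> K"
      unfolding quat_uminus using mult by blast
    then show ?thesis by (simp add: qv_def quat_mult)
  qed
  text \<open>A palindromic product of rotations about two axes is a rotation about an axis in their
    plane; the angles are chosen such that this is the bisector, which is the third axis.\<close>
  have palindrome: "quat (cos b * cos (2 * a) + v2\<^sup>2 * sin b * sin (2 * a)) 0 0 (2 * v1 * sin b) \<in> K"
    if cond: "sin b * (1 - v2\<^sup>2 + v2\<^sup>2 * cos (2 * a)) = cos b * sin (2 * a)" for a b
  proof -
    let ?P = "qv a ** quat (cos b) (- (sin b * v1)) (- (sin b * v2)) (sin b * v1) ** qv a"
    define A S B R where "A = cos a" and "S = sin a" and "B = cos b" and "R = sin b"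
    have AS: "A\<^sup>2 + S\<^sup>2 = 1" by (simp add: A_def S_def)
    \<comment> \<open>The vector part of \<open>?P\<close> is sin b times the second axis plus a
      multiple of the first. The condition makes that multiple equal to sin b, and the first two
      coordinates of the axes cancel in the sum. The term with v2^2 is the inner product - v2^2 of
      the axes.\<close>
    have cond': "R * (1 - v2\<^sup>2 + v2\<^sup>2 * (A\<^sup>2 - S\<^sup>2)) = B * (2 * S * A)"
      using cond by (simp add: A_def S_def B_def R_def cos_double sin_double)
    have "?P \<in> K" using conj T_all mult by (simp add: T_def)
    also have "?P = quat (cos b * cos (2 * a) + v2\<^sup>2 * sin b * sin (2 * a)) 0 0 (2 * v1 * sin b)"
      unfolding qv_def quat_mult cos_double sin_double A_def[symmetric] S_def[symmetric] B_def[symmetric] R_def[symmetric]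
      by (rule quat_cong; use cond' AS v in algebra)
    finally show ?thesis .
  qed
  define T' where "T' = {t. quat (cos t) 0 0 (sin t) \<in> K}"
  have T'_eq: "T' = {t. xy j k (2 * t) \<in> K}" by (simp add: T'_def quat_xy_jk)
  have "t / 2 \<in> T'"
  proof (rule closed_subgroup_UNIV)
    show "closed T'" unfolding T'_def
      by (rule closed_quat_preimage[OF cl]) (intro continuous_intros)+
    show "0 \<in> T'" by (simp add: T'_eq xy_0 one)
    show "a + b \<in> T'" if "a \<in> T'" "b \<in> T'" for a b
      using that mult by (auto simp: T'_eq distrib_left simp flip: xy_mult)
    show "- a \<in> T'" if "a \<in> T'" for a
      using that inverse_mem[of "xy j k (2 * a)" "xy j k (2 * - a)"] by (simp add: T'_eq xy_mult xy_0)
    fix \<epsilon> :: real assume \<epsilon>: "\<epsilon> > 0"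
    \<comment> \<open>With u = 2 a the condition of \<open>palindrome\<close> reads tan b = sin u /
      D u, which arctan solves; f u is the sine of the resulting half angle. It tends to 0 with u,
      and arbitrarily small nonzero angles suffice for a closed subgroup.\<close>
    define D where "D = (\<lambda>u. 1 - v2\<^sup>2 + v2\<^sup>2 * cos u)"
    define f where "f = (\<lambda>u. 2 * v1 * sin (arctan (sin u / D u)))"
    have "((\<lambda>u. arcsin (f u)) \<longlongrightarrow> arcsin (f 0)) (at_right 0)"
      unfolding f_def D_def by (intro isCont_tendsto_compose[OF isCont_arcsin] tendsto_intros) auto
    then have "((\<lambda>u. arcsin (f u)) \<longlongrightarrow> 0) (at_right 0)"
      by (simp add: f_def)
    then have "\<forall>\<^sub>F u in at_right 0. \<bar>arcsin (f u)\<bar> < \<epsilon>"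
      using \<epsilon> by (auto simp: tendsto_iff dist_real_def)
    moreover have "\<forall>\<^sub>F u in at_right 0. u \<in> {0<..<pi / 2}"
      by (rule eventually_at_right_real) simp
    ultimately have ev: "\<forall>\<^sub>F u in at_right 0. \<bar>arcsin (f u)\<bar> < \<epsilon> \<and> u \<in> {0<..<pi / 2}"
      by (rule eventually_conj)
    have "\<exists>u. \<bar>arcsin (f u)\<bar> < \<epsilon> \<and> u \<in> {0<..<pi / 2}"
      by (rule eventually_happens'[OF _ ev]) simp
    then obtain u where u: "\<bar>arcsin (f u)\<bar> < \<epsilon>" "0 < u" "u < pi / 2"
      by auto
    have cu: "cos u > 0" and su: "sin u > 0"
      using u by (auto intro!: cos_gt_zero_pi sin_gt_zero)
    have D: "D u > 0"
    proof -
      have "1 - v2\<^sup>2 > 0" using v zero_less_power[OF v1_pos, of 2] by linarith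
      then show ?thesis using cu by (simp add: D_def add_pos_nonneg)
    qed
    define b where "b = arctan (sin u / D u)"
    have b: "0 < b" using D su by (simp add: b_def)
    have b': "b < pi / 2" unfolding b_def by (rule arctan_ubound)
    have cb: "cos b > 0" and sb: "sin b > 0" using b b' by (auto intro!: cos_gt_zero_pi sin_gt_zero)
    have "tan b = sin u / D u" by (simp add: b_def tan_arctan)
    then have cond: "sin b * D u = cos b * sin u"
      using cb D by (simp add: tan_def field_simps)
    \<comment> \<open>Positivity of w identifies it with the cosine of the arcsine of f u, excluding
      the opposite sign.\<close>
    define w where "w = cos b * cos u + v2\<^sup>2 * sin b * sin u"
    have w: "w > 0" unfolding w_def using cb cu sb su by (intro add_pos_nonneg) auto
    have mem: "quat w 0 0 (f u) \<in> K"
      using palindrome[of b "u / 2"] cond by (simp add: w_def f_def b_def D_def)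
    have norm: "w\<^sup>2 + (f u)\<^sup>2 = 1"
    proof -
      have "(cos b)\<^sup>2 + (sin b)\<^sup>2 = 1" "(cos u)\<^sup>2 + (sin u)\<^sup>2 = 1" by simp_all
      moreover have "f u = 2 * v1 * sin b" by (simp add: f_def b_def)
      ultimately show ?thesis using cond v unfolding w_def D_def by algebra
    qed
    have f_pos: "f u > 0" using sb v1_pos by (simp add: f_def b_def)
    have "(f u)\<^sup>2 \<le> 1\<^sup>2" unfolding one_power2 using norm zero_le_power2[of w] by linarith
    then have f_le: "f u \<le> 1" by (rule power2_le_imp_le) simp
    define t where "t = arcsin (f u)"
    have st: "sin t = f u" using f_pos f_le by (simp add: t_def)
    have "cos t = sqrt (1 - (f u)\<^sup>2)" unfolding t_def using f_pos f_le by (intro cos_arcsin) auto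
    also have "1 - (f u)\<^sup>2 = w\<^sup>2" using norm by simp
    finally have ct: "cos t = w" using w by simp
    have "t \<in> T'" using mem by (simp add: T'_def st ct)
    moreover have "t \<noteq> 0" using st f_pos by auto
    ultimately show "\<exists>t\<in>T'. t \<noteq> 0 \<and> \<bar>t\<bar> < \<epsilon>" using u(1) by (auto simp: t_def)
  qed
  then show ?thesis by (simp add: T'_eq)
qed

end

section \<open>Localized hopping\<close>

definition zs :: "'n set \<Rightarrow> 'n bits \<Rightarrow> real" where
  "zs S x = (\<Prod>k\<in>S. if x k then - 1 else 1)"

lemma zs_empty [simp]: "zs {} x = 1"
  by (simp add: zs_def)

lemma zs_insert [simp]: "finite S \<Longrightarrow> k \<notin> S \<Longrightarrow> zs (insert k S) x = (if x k then - 1 else 1) * zs S x"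
  by (simp add: zs_def)

lemma zs_cong: "(\<And>k. k \<in> S \<Longrightarrow> x k = y k) \<Longrightarrow> zs S x = zs S y"
  by (simp add: zs_def)

definition toggle :: "'n \<Rightarrow> 'n set \<Rightarrow> 'n set" where
  "toggle k S = (if k \<in> S then S - {k} else insert k S)"

lemma zs_toggle: "finite S \<Longrightarrow> zs (toggle k S) x = (if x k then - 1 else 1) * zs S x"
  using zs_insert[of "S - {k}" k x] by (auto simp: toggle_def insert_absorb)

lemma even_card_toggle: "finite S \<Longrightarrow> even (card (toggle k S)) \<longleftrightarrow> odd (card S)"
  by (cases "k \<in> S") (auto simp: toggle_def card_Diff_singleton card_gt_0_iff)

text \<open>The hopping direction is $(XX + YY)/2$ if the parity \<open>e\<close> is even and $(XY - YX)/2$ if it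
  is odd: multiplied by \<open>zs S\<close> with \<open>odd (card S) = e\<close>, both commute with $X^{\otimes n}$.\<close>

definition dirn :: "bool \<Rightarrow> 'n \<Rightarrow> 'n bits \<Rightarrow> complex" where
  "dirn e j x = (if e then if x j then 1 else - 1 else \<i>)"

definition hopg :: "'n \<Rightarrow> 'n \<Rightarrow> bool \<Rightarrow> ('n bits \<Rightarrow> real) \<Rightarrow> real \<Rightarrow> 'n::finite qop" where
  "hopg j l e f t = hop (swp j l) (dirn e j) (\<lambda>x. if x j \<noteq> x l then t * f x else 0)"

lemma hopping_dirn: "hopping (swp j l) (dirn e j)"
  by (auto simp: hopping_def dirn_def swp_simps swp_eq_iff)

lemma hopg_mult:
  assumes "\<And>x. f (swp j l x) = f x" "\<And>x. f' (swp j l x) = f' x"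
  shows "hopg j l e f t ** hopg j l e f' t = hopg j l e (\<lambda>x. f x + f' x) t"
  unfolding hopg_def
  by (subst hop_mult[OF hopping_dirn strength_swp strength_swp])
    (auto simp: assms distrib_left intro!: arg_cong[where f="hop _ _"])

lemma hopg_scale: "hopg j l e (\<lambda>x. c * f x) t = hopg j l e f (c * t)"
  unfolding hopg_def by (intro arg_cong[where f="hop _ _"] ext) (simp add: mult_ac)

locale xy_group = matrix_group K for K :: "'n::finite qop set" +
  assumes xy_mem: "j \<noteq> k \<Longrightarrow> xy j k t \<in> K"
begin

text \<open>Conjugation by iSWAP on \<open>b, l\<close> turns a hopping between \<open>j\<close> and \<open>b\<close> into one between \<open>j\<close>
  and \<open>l\<close> with an additional factor $Z_b$.\<close>

lemma hopg_zs_mem: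
  assumes "finite S" "j \<noteq> l" "j \<notin> S" "l \<notin> S"
  shows "hopg j l (odd (card S)) (zs S) t \<in> K"
  using assms
proof (induction S arbitrary: l t rule: finite_induct)
  case empty
  then show ?case using xy_mem[of j l t] by (simp add: hopg_def xy_def dirn_def[abs_def] cong: if_cong)
next
  case (insert b S)
  \<comment> \<open>For even \<open>card S\<close> the imaginary hopping amplitude is multiplied by
    the factor \<i> of iSWAP; the sign of \<open>t'\<close> absorbs the resulting - 1.\<close>
  define t' where "t' = (if even (card S) then - t else t)"
  have IH: "hopg j b (odd (card S)) (zs S) t' \<in> K"
    using insert by (intro insert.IH) auto
  have "b \<noteq> l" using insert by auto
  have D: "xy b l (pi / 2) = monomial (swp b l) (\<lambda>x. if x b = x l then 1 else \<i>)"
    unfolding xy_def by (subst hop_half_pi[OF strength_xy]) (auto simp: swp_eq_iff)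
  have zs: "zs S (swp b l x) = zs S x" for x
    using insert by (intro zs_cong) (auto simp: swp_def)
  have "monomial (swp b l) (\<lambda>x. if x b = x l then 1 else \<i>) ** hopg j b (odd (card S)) (zs S) t' =
    hopg j l (odd (card (insert b S))) (zs (insert b S)) t ** monomial (swp b l) (\<lambda>x. if x b = x l then 1 else \<i>)"
    unfolding hopg_def
  proof (rule monomial_hop_intertwine)
    show "inj (swp b l)" by (metis injI swp_swp)
    fix x :: "'n bits"
    have bits: "swp b l x j = x j" "swp b l x l = x b" "swp b l x b = x l"
      "swp j b x b = x j" "swp j b x l = x l"
      using insert \<open>b \<noteq> l\<close> by (auto simp: swp_def)
    show "cos (if swp b l x j \<noteq> swp b l x l then t * zs (insert b S) (swp b l x) else 0) =
       cos (if x j \<noteq> x b then t' * zs S x else 0)"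
      using insert by (simp add: bits zs t'_def)
    show "dirn (odd (card (insert b S))) j (swp b l x) *
         complex_of_real (sin (if swp b l x j \<noteq> swp b l x l then t * zs (insert b S) (swp b l x) else 0)) *
         (if x b = x l then 1 else \<i>) =
         dirn (odd (card S)) j x * complex_of_real (sin (if x j \<noteq> x b then t' * zs S x else 0)) *
         (if swp j b x b = swp j b x l then 1 else \<i>)"
      using insert by (cases "x j"; cases "x b"; cases "x l") (simp_all add: bits zs t'_def dirn_def i_sandwich)
    show "swp j l (swp b l x) = swp b l (swp j b x)"
      using insert \<open>b \<noteq> l\<close> by (auto simp: swp_def fun_eq_iff)
    show "(if x b = x l then 1 else \<i>) \<noteq> 0" by simp
  qed
  then show ?case
    using conj_mem[OF xy_mem[OF \<open>b \<noteq> l\<close>, of "pi / 2"] IH] unfolding D by blast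
qed

text \<open>The indicator for k is (1 + Z_k Z_k0) / 2 or (1 - Z_k Z_k0) / 2. Adding k to R therefore
  splits the hopping into two of half strength, whose sets S differ by toggling k and k0. Two
  toggles keep the parity of \<open>card S\<close>, so both parts have the same direction and
  commute. Comparison with the reference bit k0, instead of prescribing bits, keeps the indicator
  invariant under \<open>flip\<close>.\<close>

lemma hopg_projection_mem:
  assumes jl: "j \<noteq> l" and k0: "k0 \<notin> {j, l}" and R: "finite R" "R \<inter> {j, l, k0} = {}"
    and S: "S \<inter> {j, l} = {}" "odd (card S) = e"
  shows "hopg j l e (\<lambda>x. zs S x * (\<Prod>k\<in>R. if (x k = x k0) = (z k = z k0) then 1 else 0)) t \<in> K"
  using R S
proof (induction R arbitrary: S t rule: finite_induct)
  case empty
  then have "hopg j l (odd (card S)) (zs S) t \<in> K" using jl by (intro hopg_zs_mem) auto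
  then show ?case using empty by simp
next
  case (insert k R)
  let ?P = "\<lambda>R x. \<Prod>k\<in>R. if (x k = x k0) = (z k = z k0) then 1 else (0::real)"
  let ?S = "toggle k (toggle k0 S)"
  let ?\<epsilon> = "if z k = z k0 then 1 else - 1 :: real"
  let ?f = "\<lambda>x. (1 / 2) * (zs S x * ?P R x)" and ?f' = "\<lambda>x. (?\<epsilon> / 2) * (zs ?S x * ?P R x)"
  have swp: "?P R (swp j l x) = ?P R x" for x
    using insert.prems insert.hyps k0 by (intro prod.cong) (auto simp: swp_def)
  have zs_swp: "zs S' (swp j l x) = zs S' x" if "S' \<inter> {j, l} = {}" for S' x
    using that by (intro zs_cong) (auto simp: swp_def)
  have S': "?S \<inter> {j, l} = {}"
    using insert.prems k0 by (auto simp: toggle_def split: if_splits)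
  have "hopg j l e ?f t \<in> K" unfolding hopg_scale using insert by (intro insert.IH) auto
  moreover have "hopg j l e ?f' t \<in> K" unfolding hopg_scale
    using insert.prems S' by (intro insert.IH) (auto simp: even_card_toggle)
  ultimately have "hopg j l e ?f t ** hopg j l e ?f' t \<in> K" by (rule mult)
  also have "hopg j l e ?f t ** hopg j l e ?f' t = hopg j l e (\<lambda>x. ?f x + ?f' x) t"
    using insert.prems S' by (intro hopg_mult) (simp_all add: swp zs_swp)
  also have "(\<lambda>x. ?f x + ?f' x) = (\<lambda>x. zs S x * ?P (insert k R) x)"
  proof
    fix x show "?f x + ?f' x = zs S x * ?P (insert k R) x"
      using insert.hyps by (cases "x k"; cases "x k0"; cases "z k = z k0") (simp_all add: zs_toggle)
  qed
  finally show ?case .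
qed

end


section \<open>Mirrored two-level matrices\<close>

definition flip :: "'n bits \<Rightarrow> 'n bits" where
  "flip x = (\<lambda>k. \<not> x k)"

lemma flip_apply: "flip x k = (\<not> x k)"
  by (simp add: flip_def)

lemma flip_flip [simp]: "flip (flip x) = x"
  by (simp add: flip_def)

lemma flip_neq [simp]: "flip x \<noteq> x" "x \<noteq> flip x"
  by (auto simp: flip_def fun_eq_iff)

lemma flip_inj [simp]: "flip x = flip y \<longleftrightarrow> x = y"
  by (auto simp: flip_def fun_eq_iff)

context good_pair
begin

definition pair_dirn :: "complex \<Rightarrow> 'a \<Rightarrow> complex" where
  "pair_dirn \<phi> u = (if u = x \<or> u = \<sigma> x then \<phi> else - cnj \<phi>)"

text \<open>Links the two descriptions of a rotation: \<open>su\<close> is suited to elimination,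
  \<open>hop\<close> to adding angles that differ from plane to plane.\<close>

lemma su_eq_hop:
  "su \<sigma> x y (of_real (cos t)) (\<phi> * of_real (sin t)) =
   hop (pair_swap \<sigma> x y) (pair_dirn \<phi>) (\<lambda>u. if u \<in> {x, y, \<sigma> x, \<sigma> y} then t else 0)"
proof -
  have s: "u = pair_swap \<sigma> x y v \<longleftrightarrow> v = pair_swap \<sigma> x y u" for u v
    using pair_swap_invol by metis
  have "su \<sigma> x y (of_real (cos t)) (\<phi> * of_real (sin t)) $ u $ v =
    hop (pair_swap \<sigma> x y) (pair_dirn \<phi>) (\<lambda>u. if u \<in> {x, y, \<sigma> x, \<sigma> y} then t else 0) $ u $ v" for u v
    unfolding hop_entry s[of u v]
    by (cases u rule: row_cases)
      (use nes fix_iff in \<open>auto simp: su_entries pair_dirn_def pair_swap_def\<close>)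
  then show ?thesis by (simp add: vec_eq_iff)
qed

lemma hopping_pair: "norm \<phi> = 1 \<Longrightarrow> hopping (pair_swap \<sigma> x y) (pair_dirn \<phi>)"
proof -
  assume \<phi>: "norm \<phi> = 1"
  then have "\<phi> * cnj \<phi> = 1" by (metis complex_norm_square of_real_1 one_power2)
  then have p: "\<phi> * cnj \<phi> = 1" "cnj \<phi> * \<phi> = 1" by (simp_all add: mult.commute)
  have "norm (pair_dirn \<phi> u) = 1" for u using \<phi> by (simp add: pair_dirn_def)
  moreover have "pair_swap \<sigma> x y u \<noteq> u \<longrightarrow> pair_dirn \<phi> u * pair_dirn \<phi> (pair_swap \<sigma> x y u) = - 1" for u
    using nes fix_iff by (cases u rule: row_cases) (auto simp: pair_dirn_def p pair_swap_def)
  ultimately show ?thesis by (simp add: hopping_def pair_swap_invol)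
qed

lemma strength_pair:
  assumes "f x = f y" "f (\<sigma> x) = f (\<sigma> y)"
  shows "strength (pair_swap \<sigma> x y) (\<lambda>u. if u \<in> {x, y, \<sigma> x, \<sigma> y} then f u else 0)"
  unfolding strength_def using assms nes fix_iff by (auto simp: pair_swap_def)

end

text \<open>The quarter turn \<open>su \<sigma> w y 0 1\<close> carries w to y and does not move x,
  so it carries rotations of x with w to rotations of x with y.\<close>

lemma su_conj:
  assumes xw: "good_pair \<sigma> x w" and wy: "good_pair \<sigma> w y" and xy: "good_pair \<sigma> x y"
  shows "su \<sigma> w y 0 1 ** su \<sigma> x w a c = su \<sigma> x y a c ** su \<sigma> w y 0 1"
proof -
  interpret xw: good_pair \<sigma> x w by fact
  interpret wy: good_pair \<sigma> w y by fact
  interpret xy: good_pair \<sigma> x y by fact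
  note ne = xw.nes wy.nes xy.nes
  have "(su \<sigma> w y 0 1 ** su \<sigma> x w a c) $ u $ z = (su \<sigma> x y a c ** su \<sigma> w y 0 1) $ u $ z" for u z
  proof -
    consider "u = x" | "u = w" | "u = y" | "u = \<sigma> x" | "u = \<sigma> w" | "u = \<sigma> y"
      | "u \<notin> {x, w, y, \<sigma> x, \<sigma> w, \<sigma> y}" by blast
    then show ?thesis
      by cases (use ne xw.fix_iff wy.fix_iff xy.fix_iff in
          \<open>auto simp: wy.su_rows xy.su_rows xw.su_entries wy.su_entries\<close>)
  qed
  then show ?thesis by (simp add: vec_eq_iff)
qed

lemma good_pair_flip: "x \<noteq> y \<Longrightarrow> flip x \<noteq> y \<Longrightarrow> good_pair flip x y"
  by unfold_locales auto

lemma good_pair_id: "x \<noteq> y \<Longrightarrow> good_pair id x y"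
  by unfold_locales auto

lemma flip_swp: "flip (swp a b x) = swp a b (flip x)"
  by (auto simp: flip_def swp_def fun_eq_iff)

lemma third_index:
  fixes a b :: "'n::finite"
  assumes "CARD('n) \<ge> 3"
  obtains c where "c \<noteq> a" "c \<noteq> b"
proof -
  have "card {a, b} \<noteq> CARD('n)" using assms card_insert_le_m1[of 2 "{b}" a] by auto
  then have "{a, b} \<noteq> UNIV" by metis
  then show ?thesis using that by blast
qed

lemma good_pair_swp:
  fixes x :: "'n::finite bits"
  assumes "CARD('n) \<ge> 3" "x a" "\<not> x b"
  shows "good_pair flip x (swp a b x)"
proof -
  obtain c where "c \<noteq> a" "c \<noteq> b" using third_index[OF assms(1)] by blast
  then have "flip x c \<noteq> swp a b x c" by (simp add: flip_def swp_simps)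
  then show ?thesis using assms by (intro good_pair_flip) (metis swp_simps(1), metis)
qed

context xy_group
begin

text \<open>Every bit other than a, b is compared with a third bit c in the way x prescribes. Among
  the strings with different bits at a and b, this leaves x, y and their mirror images, so the
  projected hopping is the desired rotation.\<close>

lemma su_flip_adjacent_mem:
  fixes x :: "'n bits"
  assumes card: "CARD('n) \<ge> 3" and ab: "x a" "\<not> x b" and \<phi>: "\<phi> \<in> {1, \<i>}"
  shows "su flip x (swp a b x) (of_real (cos t)) (\<phi> * of_real (sin t)) \<in> K"
proof -
  define y where "y = swp a b x"
  interpret good_pair flip x y unfolding y_def by (rule good_pair_swp[OF card ab])
  have "a \<noteq> b" using ab by auto
  obtain c where c: "c \<noteq> a" "c \<noteq> b" using third_index[OF card] by blast
  have bits: "\<not> y a" "y b" "y c = x c" "flip u k = (\<not> u k)" for u and k :: 'n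
    using ab c \<open>a \<noteq> b\<close> by (auto simp: y_def swp_def flip_def)
  define R where "R = UNIV - {a, b, c}"
  define P :: "'n bits \<Rightarrow> real" where "P = (\<lambda>u. \<Prod>k\<in>R. if (u k = u c) = (x k = x c) then 1 else 0)"
  have P: "P u = (if u \<in> {x, y, flip x, flip y} then 1 else 0)" if u: "u a \<noteq> u b" for u
  proof -
    have "P u = (if \<forall>k\<in>R. (u k = u c) = (x k = x c) then 1 else 0)"
      by (auto simp: P_def intro!: prod_zero)
    moreover have "(\<forall>k\<in>R. (u k = u c) = (x k = x c)) \<longleftrightarrow> u \<in> {x, y, flip x, flip y}"
    proof
      assume R: "\<forall>k\<in>R. (u k = u c) = (x k = x c)"
      have eq: "u k = (if u c = x c then x k else \<not> x k)" if "k \<noteq> a" "k \<noteq> b" for k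
      proof (cases "k = c")
        case False
        then have "(u k = u c) = (x k = x c)" using R that by (simp add: R_def)
        then show ?thesis by argo
      qed simp
      have "u = (if u c = x c then (if u a then x else y) else (if u a then flip y else flip x))"
      proof
        fix k
        show "u k = (if u c = x c then (if u a then x else y) else (if u a then flip y else flip x)) k"
          using eq[of k] u ab by (cases "k = a"; cases "k = b") (auto simp: y_def flip_def swp_def)
      qed
      then show "u \<in> {x, y, flip x, flip y}" by (auto split: if_splits)
    next
      assume "u \<in> {x, y, flip x, flip y}"
      then show "\<forall>k\<in>R. (u k = u c) = (x k = x c)"
        using c by (auto simp: R_def y_def flip_def swp_def)
    qed
    ultimately show ?thesis by simp
  qed
  have swp: "swp a b u = pair_swap flip x y u" if "u \<in> {x, y, flip x, flip y}" for u
    using that by (auto simp: y_def flip_swp simp del: pair_swap_simps)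
      (simp_all add: pair_swap_simps[unfolded y_def] flip: flip_swp)
  have four: "u a \<noteq> u b" if "u \<in> {x, y, flip x, flip y}" for u
    using that ab \<open>a \<noteq> b\<close> by (auto simp: y_def flip_def swp_def)
  define e where "e \<longleftrightarrow> \<phi> = 1"
  \<comment> \<open>The amplitude 1 belongs to odd \<open>card S\<close>, hence the factor Z_c. Its
    sign change under \<open>flip\<close> compensates that of \<open>dirn\<close>, so that both
    planes turn alike; the sign s normalizes the value at x.\<close>
  define S where "S = (if e then {c} else {})"
  define s where "s = zs S x"
  have s: "s * s = 1" by (simp add: s_def S_def)
  have "hopg a b e (\<lambda>u. zs S u * P u) (s * t) \<in> K"
    unfolding P_def by (rule hopg_projection_mem) (use \<open>a \<noteq> b\<close> c in \<open>auto simp: R_def S_def\<close>)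
  also have "hopg a b e (\<lambda>u. zs S u * P u) (s * t) =
    hop (pair_swap flip x y) (pair_dirn \<phi>) (\<lambda>u. if u \<in> {x, y, flip x, flip y} then t else 0)"
    unfolding hopg_def
  proof (rule hop_cong)
    fix u
    let ?g = "if u a \<noteq> u b then s * t * (zs S u * P u) else 0"
    let ?g' = "if u \<in> {x, y, flip x, flip y} then t else 0"
    have out: "?g = 0" "?g' = 0" if "u \<notin> {x, y, flip x, flip y}"
      using that P[of u] by auto
    have ing: "?g = s * zs S u * t" if "u \<in> {x, y, flip x, flip y}"
      using that P[of u] four[of u] by simp
    have zs: "s * zs S u = (if e \<and> u \<in> {flip x, flip y} then - 1 else 1)" if "u \<in> {x, y, flip x, flip y}"
      using that nes by (auto simp: s_def S_def bits)
    show "cos ?g = cos ?g'"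
      using out ing zs by (cases "u \<in> {x, y, flip x, flip y}") auto
    show "sin ?g \<noteq> 0 \<Longrightarrow> swp a b u = pair_swap flip x y u"
      using out swp by (cases "u \<in> {x, y, flip x, flip y}") auto
    have dir: "dirn e a u = (if e \<and> u \<in> {flip x, flip y} then - 1 else 1) * pair_dirn \<phi> u"
      if "u \<in> {x, y, flip x, flip y}"
      using that \<phi> ab nes by (auto simp: dirn_def pair_dirn_def e_def bits)
    show "dirn e a u * of_real (sin ?g) = pair_dirn \<phi> u * of_real (sin ?g')"
    proof (cases "u \<in> {x, y, flip x, flip y}")
      case True
      show ?thesis unfolding ing[OF True] zs[OF True] dir[OF True]
        using True by (cases "e \<and> u \<in> {flip x, flip y}") auto
    qed (use out in simp)
  qed
  also have "\<dots> = su flip x y (of_real (cos t)) (\<phi> * of_real (sin t))"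
    by (rule su_eq_hop[symmetric])
  finally show ?thesis unfolding y_def .
qed

end

section \<open>From strings that differ by one swap to all strings of equal weight\<close>

lemma hamming_diff:
  fixes x y :: "'n::finite bits"
  assumes "hamming_weight x = hamming_weight y" "x \<noteq> y"
  obtains a b where "x a" "\<not> y a" "\<not> x b" "y b"
proof -
  have fin: "finite {j. x j}" "finite {j. y j}" by simp_all
  have ne: "{j. x j} \<noteq> {j. y j}" using assms(2) by auto
  have "\<not> {j. x j} \<subseteq> {j. y j}"
    using card_subset_eq[OF fin(2)] assms(1) ne by (auto simp: hamming_weight_def)
  moreover have "\<not> {j. y j} \<subseteq> {j. x j}"
    using card_subset_eq[OF fin(1)] assms(1) ne by (auto simp: hamming_weight_def)
  ultimately show ?thesis using that by blast
qed

lemma hamming_weight_swp [simp]: "hamming_weight (swp a b x) = hamming_weight x"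
proof -
  have "{j. swp a b x j} = Transposition.transpose a b ` {j. x j}"
    by (auto simp: swp_def image_iff Transposition.transpose_def)
  then show ?thesis by (simp add: hamming_weight_def card_image)
qed

text \<open>Induction on the number of differing bits: one swap of a bit 1 with a bit 0 leads from x
  to a string w closer to y, and a quarter turn between w and y transports the rotation of x with
  w.\<close>

lemma su_all_mem:
  fixes x y :: "'n::finite bits" and K :: "'n qop set"
  assumes K: "matrix_group K" and card: "CARD('n) \<ge> 3" and \<sigma>: "\<sigma> = id \<or> \<sigma> = flip"
    and adjacent: "\<And>x a b \<phi> t. x a \<Longrightarrow> \<not> x b \<Longrightarrow> \<phi> \<in> {1, \<i>} \<Longrightarrow>
      su \<sigma> x (swp a b x) (of_real (cos t)) (\<phi> * of_real (sin t)) \<in> K"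
    and "hamming_weight x = hamming_weight y" "x \<noteq> y" "\<sigma> x \<noteq> y" "\<phi> \<in> {1, \<i>}"
  shows "su \<sigma> x y (of_real (cos t)) (\<phi> * of_real (sin t)) \<in> K"
  using assms(5-)
proof (induction "card {k. x k \<noteq> y k}" arbitrary: x y \<phi> t rule: less_induct)
  case less
  obtain a b where ab: "x a" "\<not> y a" "\<not> x b" "y b" using hamming_diff less.prems by blast
  define w where "w = swp a b x"
  show ?case
  proof (cases "w = y")
    case True
    then show ?thesis using adjacent[OF ab(1,3) less.prems(4)] by (simp add: w_def)
  next
    case False
    have good: "u \<noteq> v \<Longrightarrow> \<sigma> u \<noteq> v \<Longrightarrow> good_pair \<sigma> u v" for u v :: "'n bits"
      using \<sigma> good_pair_id good_pair_flip by blast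
    have wk: "w k \<noteq> y k \<longleftrightarrow> x k \<noteq> y k \<and> k \<noteq> a \<and> k \<noteq> b" for k
      using ab by (auto simp: w_def swp_def)
    then have "{k. w k \<noteq> y k} \<subset> {k. x k \<noteq> y k}" using ab by auto
    then have less': "card {k. w k \<noteq> y k} < card {k. x k \<noteq> y k}" by (intro psubset_card_mono) auto
    \<comment> \<open>The swap has made w agree with y at a, so w is not the mirror image of y and
      the induction hypothesis applies to w, y.\<close>
    have "flip w a \<noteq> y a" using wk[of a] by (auto simp: flip_def)
    then have wy: "\<sigma> w \<noteq> y" using \<sigma> False by auto
    have "su \<sigma> w y (of_real (cos (pi / 2))) (1 * of_real (sin (pi / 2))) \<in> K"
      using less.prems(1) False wy by (intro less.hyps[OF less']) (auto simp: w_def)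
    then have D: "su \<sigma> w y 0 1 \<in> K" by simp
    have A: "su \<sigma> x w (of_real (cos t)) (\<phi> * of_real (sin t)) \<in> K"
      unfolding w_def by (rule adjacent) (use ab less.prems in auto)
    have xw: "x \<noteq> w" "\<sigma> x \<noteq> w"
    proof -
      show "x \<noteq> w" using ab by (auto simp: w_def swp_def fun_eq_iff)
      moreover have "flip x \<noteq> w" using good_pair.ne'[OF good_pair_swp[OF card ab(1,3)]] by (simp add: w_def)
      ultimately show "\<sigma> x \<noteq> w" using \<sigma> by auto
    qed
    show ?thesis
      by (rule matrix_group.conj_mem[OF K D A su_conj[OF good[OF xw] good[OF False wy] good[OF less.prems(2,3)]]])
  qed
qed

section \<open>Separating a pair of strings from its mirror image by phases\<close>

definition sph :: "'n \<Rightarrow> 'n bits \<Rightarrow> complex" where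
  "sph a u = (if u a then \<i> else 1)"

lemma monomial_id: "monomial (\<lambda>x. x) d = diagm d"
  by (auto simp: monomial_def diagm_def vec_eq_iff)

text \<open>Exactly one of x, y has bit a set, and in the mirror images it is the other one.
  Conjugation by S at a therefore turns the amplitude \<i> into real amplitudes of opposite signs on
  the two planes. Multiplied with the rotation that has equal signs, this cancels on the mirror
  plane and doubles on the plane of x, y.\<close>

lemma (in xy_group) su_id_adjacent_mem:
  fixes x :: "'n bits"
  assumes card: "CARD('n) \<ge> 3" and ab: "x a" "\<not> x b" and \<phi>: "\<phi> \<in> {1, \<i>}"
    and phase: "\<And>A B. A \<in> K \<Longrightarrow> diagm (sph a) ** A = B ** diagm (sph a) \<Longrightarrow> B \<in> K"
  shows "su id x (swp a b x) (of_real (cos t)) (\<phi> * of_real (sin t)) \<in> K"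
proof -
  define y where "y = swp a b x"
  interpret good_pair flip x y unfolding y_def by (rule good_pair_swp[OF card ab])
  interpret I: good_pair id x y using ne by (rule good_pair_id)
  have bits: "x a" "\<not> y a" "\<not> flip x a" "flip y a"
    using ab by (auto simp: y_def swp_def flip_def)
  define h where "h = (\<lambda>s u. if u \<in> {x, y, flip x, flip y} then if u = x \<or> u = y then s else - s else (0::real))"
  define g where "g = (\<lambda>s u. if u \<in> {x, y, flip x, flip y} then s else (0::real))"
  have g_mem: "hop (pair_swap flip x y) (pair_dirn \<phi>) (g s) \<in> K" if "\<phi> \<in> {1, \<i>}" for \<phi> s
    using su_flip_adjacent_mem[OF card ab that, of s] su_eq_hop[of s \<phi>] by (simp add: y_def g_def)
  have "hop (pair_swap flip x y) (pair_dirn 1) (h s) \<in> K" for s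
  proof (rule phase[OF g_mem[of \<i> s]])
    show "diagm (sph a) ** hop (pair_swap flip x y) (pair_dirn \<i>) (g s) =
      hop (pair_swap flip x y) (pair_dirn 1) (h s) ** diagm (sph a)"
      unfolding monomial_id[symmetric]
    proof (rule monomial_hop_intertwine)
      fix u
      show "cos (h s u) = cos (g s u)" by (simp add: h_def g_def)
      show "pair_dirn 1 u * complex_of_real (sin (h s u)) * sph a u =
        pair_dirn \<i> u * complex_of_real (sin (g s u)) * sph a (pair_swap flip x y u)"
        by (cases u rule: row_cases)
          (use bits nes in \<open>simp_all add: h_def g_def pair_dirn_def sph_def i_sandwich\<close>)
      show "sph a u \<noteq> 0" by (simp add: sph_def)
    qed auto
  qed simp
  then have "hop (pair_swap flip x y) (pair_dirn 1) (g (t / 2)) **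
      hop (pair_swap flip x y) (pair_dirn 1) (h (t / 2)) \<in> K" for t
    by (intro mult g_mem) auto
  also have "hop (pair_swap flip x y) (pair_dirn 1) (g (t / 2)) **
      hop (pair_swap flip x y) (pair_dirn 1) (h (t / 2)) =
      hop (pair_swap flip x y) (pair_dirn 1) (\<lambda>u. g (t / 2) u + h (t / 2) u)" for t
    unfolding g_def h_def
    by (intro hop_mult hopping_pair strength_pair) (use nes in auto)
  also have "hop (pair_swap flip x y) (pair_dirn 1) (\<lambda>u. g (t / 2) u + h (t / 2) u) =
      hop (pair_swap id x y) (I.pair_dirn 1) (\<lambda>u. if u \<in> {x, y, id x, id y} then t else 0)" for t
  proof (rule hop_cong)
    fix u
    show "cos (g (t / 2) u + h (t / 2) u) = cos (if u \<in> {x, y, id x, id y} then t else 0)"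
      "pair_dirn 1 u * complex_of_real (sin (g (t / 2) u + h (t / 2) u)) =
       I.pair_dirn 1 u * complex_of_real (sin (if u \<in> {x, y, id x, id y} then t else 0))"
      "sin (g (t / 2) u + h (t / 2) u) \<noteq> 0 \<Longrightarrow> pair_swap flip x y u = pair_swap id x y u"
      using nes by (cases u rule: row_cases;
        simp add: g_def h_def pair_dirn_def I.pair_dirn_def pair_swap_def)+
  qed
  finally have mem1: "hop (pair_swap id x y) (I.pair_dirn 1) (\<lambda>u. if u \<in> {x, y, id x, id y} then t else 0) \<in> K" for t .
  \<comment> \<open>The mirror plane is no longer involved, so one more conjugation by S at a
    restores the imaginary amplitude; the sign of the angle changes on the way.\<close>
  have memi: "hop (pair_swap id x y) (I.pair_dirn \<i>) (\<lambda>u. if u \<in> {x, y, id x, id y} then t else 0) \<in> K" for t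
  proof (rule phase[OF mem1[of "- t"]])
    show "diagm (sph a) ** hop (pair_swap id x y) (I.pair_dirn 1) (\<lambda>u. if u \<in> {x, y, id x, id y} then - t else 0) =
      hop (pair_swap id x y) (I.pair_dirn \<i>) (\<lambda>u. if u \<in> {x, y, id x, id y} then t else 0) ** diagm (sph a)"
      unfolding monomial_id[symmetric]
    proof (rule monomial_hop_intertwine)
      fix u
      show "I.pair_dirn \<i> u * complex_of_real (sin (if u \<in> {x, y, id x, id y} then t else 0)) * sph a u =
        I.pair_dirn 1 u * complex_of_real (sin (if u \<in> {x, y, id x, id y} then - t else 0)) * sph a (pair_swap id x y u)"
        using bits nes by (cases "u = x"; cases "u = y") (simp_all add: I.pair_dirn_def sph_def i_sandwich)
      show "sph a u \<noteq> 0" by (simp add: sph_def)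
    qed auto
  qed
  show ?thesis
    using \<phi> mem1 memi I.su_eq_hop[of t \<phi>] unfolding y_def by auto
qed


section \<open>The gates\<close>

lemma sums_vec:
  fixes f :: "nat \<Rightarrow> 'a::finite cmat"
  assumes "\<And>i j. (\<lambda>k. f k $ i $ j) sums (g $ i $ j)"
  shows "f sums g"
  using assms unfolding sums_def by (auto intro!: vec_tendstoI simp: sum_component)

lemma mat_exp_swap:
  fixes M :: "(bool \<times> bool) cmat"
  assumes M: "\<And>p q. M $ p $ q = (if fst p \<noteq> snd p \<and> q = (snd p, fst p) then \<i> * of_real \<theta> else 0)"
  shows "mat_exp M $ p $ q = (if p = q then if fst p = snd p then 1 else of_real (cos \<theta>)
    else if q = (snd p, fst p) then \<i> * of_real (sin \<theta>) else 0)"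
proof -
  define z where "z = \<i> * complex_of_real \<theta>"
  \<comment> \<open>On the span of 01 and 10, M is z times the swap, with eigenvalues z and - z. On
    00 and 11 it is zero, and \<open>0 ^ k\<close> yields the identity for k = 0.\<close>
  define E where "E = (\<lambda>k (p :: bool \<times> bool) q. if p = q then if fst p = snd p then 0 ^ k else (z ^ k + (- z) ^ k) / 2
    else if q = (snd p, fst p) then (z ^ k - (- z) ^ k) / 2 else (0 :: complex))"
  have MA: "(M ** A) $ p $ q = (if fst p \<noteq> snd p then z * A $ (snd p, fst p) $ q else 0)" for A p q
  proof -
    have "(M ** A) $ p $ q = (\<Sum>r\<in>UNIV. if r = (snd p, fst p) then (if fst p \<noteq> snd p then z * A $ r $ q else 0) else 0)"
      unfolding matrix_mult_entry by (intro sum.cong) (auto simp: M z_def)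
    then show ?thesis by simp
  qed
  have pow: "((**) M ^^ k) (mat 1) $ p $ q = E k p q" for k p q
  proof (induction k arbitrary: p q)
    case 0
    then show ?case by (auto simp: E_def mat_1_entry)
  next
    case (Suc k)
    have "((**) M ^^ Suc k) (mat 1) $ p $ q = (if fst p \<noteq> snd p then z * E k (snd p, fst p) q else 0)"
      by (simp add: MA Suc)
    also have "\<dots> = E (Suc k) p q"
      by (cases p; cases q) (auto simp: E_def algebra_simps add_divide_distrib diff_divide_distrib)
    finally show ?case .
  qed
  define U :: "(bool \<times> bool) cmat" where "U = (\<chi> p q. if p = q then if fst p = snd p then 1 else of_real (cos \<theta>)
    else if q = (snd p, fst p) then \<i> * of_real (sin \<theta>) else 0)"
  have sums_exp: "(\<lambda>k. (1 / fact k) *\<^sub>R w ^ k) sums exp w" for w :: complex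
    using exp_converges[of w] by (simp add: divide_inverse)
  have exp_z: "exp z = of_real (cos \<theta>) + \<i> * of_real (sin \<theta>)" "exp (- z) = of_real (cos \<theta>) - \<i> * of_real (sin \<theta>)"
    using exp_Euler[of "of_real \<theta>"] exp_minus_Euler[of "of_real \<theta>"] by (simp_all add: z_def cos_of_real sin_of_real)
  have "(\<lambda>k. (1 / fact k) *\<^sub>R E k p q) sums (U $ p $ q)" for p q
  proof -
    have "(\<lambda>k. ((1 / fact k) *\<^sub>R z ^ k + (1 / fact k) *\<^sub>R (- z) ^ k) / 2) sums ((exp z + exp (- z)) / 2)"
      "(\<lambda>k. ((1 / fact k) *\<^sub>R z ^ k - (1 / fact k) *\<^sub>R (- z) ^ k) / 2) sums ((exp z - exp (- z)) / 2)"
      by (intro sums_divide sums_add sums_diff sums_exp)+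
    moreover have "((1 / fact k) *\<^sub>R z ^ k + (1 / fact k) *\<^sub>R (- z) ^ k) / 2 = (1 / fact k) *\<^sub>R ((z ^ k + (- z) ^ k) / 2)"
      "((1 / fact k) *\<^sub>R z ^ k - (1 / fact k) *\<^sub>R (- z) ^ k) / 2 = (1 / fact k) *\<^sub>R ((z ^ k - (- z) ^ k) / 2)" for k
      by (simp_all add: scaleR_conv_of_real field_simps)
    moreover have "(exp z + exp (- z)) / 2 = of_real (cos \<theta>)" "(exp z - exp (- z)) / 2 = \<i> * of_real (sin \<theta>)"
      by (simp_all add: exp_z)
    ultimately have 1: "(\<lambda>k. (1 / fact k) *\<^sub>R ((z ^ k + (- z) ^ k) / 2)) sums of_real (cos \<theta>)"
      and 2: "(\<lambda>k. (1 / fact k) *\<^sub>R ((z ^ k - (- z) ^ k) / 2)) sums (\<i> * of_real (sin \<theta>))"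
      by simp_all
    have 3: "(\<lambda>k. (1 / fact k) *\<^sub>R (0 :: complex) ^ k) sums 1"
      using sums_exp[of 0] by simp
    show ?thesis
      unfolding E_def U_def vec_lambda_beta
      by (cases "p = q"; cases "fst p = snd p"; cases "q = (snd p, fst p)")
        (simp_all only: if_True if_False simp_thms scaleR_zero_right sums_zero 1 2 3)
  qed
  then have "(\<lambda>k. (1 / fact k) *\<^sub>R ((**) M ^^ k) (mat 1)) sums U"
    by (intro sums_vec) (simp add: pow)
  then have "mat_exp M = U" unfolding mat_exp_def by (rule sums_unique[symmetric])
  then show ?thesis by (simp add: U_def)
qed

text \<open>The terms XX and YY both contribute 1 between 01 and 10, which turns pi / 8 into pi / 4;
  between 00 and 11 they cancel.\<close>

lemma sqrt_iSWAP_entry: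
  "sqrt_iSWAP $ p $ q = (if p = q then if fst p = snd p then 1 else of_real (cos (pi / 4))
    else if q = (snd p, fst p) then \<i> * of_real (sin (pi / 4)) else 0)"
  unfolding sqrt_iSWAP_def
proof (rule mat_exp_swap)
  fix p q :: "bool \<times> bool"
  show "cscale (\<i> * of_real (pi / 8)) (tensor pauli_X pauli_X + tensor pauli_Y pauli_Y) $ p $ q =
    (if fst p \<noteq> snd p \<and> q = (snd p, fst p) then \<i> * complex_of_real (pi / 4) else 0)"
    by (cases p; cases q) (auto simp: cscale_def tensor_def pauli_X_def pauli_Y_def)
qed

lemma on_pair_sqrt_iSWAP:
  fixes j k :: "'n::finite"
  assumes "j \<noteq> k"
  shows "on_pair j k sqrt_iSWAP = xy j k (pi / 4)"
proof -
  have "on_pair j k sqrt_iSWAP $ x $ y = xy j k (pi / 4) $ x $ y" for x y :: "'n bits"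
  proof -
    define ag where "ag \<longleftrightarrow> (\<forall>l. l \<noteq> j \<and> l \<noteq> k \<longrightarrow> x l = y l)"
    have 1: "y = x \<longleftrightarrow> ag \<and> x j = y j \<and> x k = y k" by (auto simp: fun_eq_iff ag_def)
    have 2: "x = swp j k y \<longleftrightarrow> ag \<and> x j = y k \<and> x k = y j"
      using assms by (auto simp: fun_eq_iff swp_def ag_def)
    show ?thesis
      unfolding on_pair_def xy_def hop_entry vec_lambda_beta 1 2 sqrt_iSWAP_entry ag_def[symmetric]
      by (cases ag; cases "x j"; cases "x k"; cases "y j"; cases "y k") simp_all
  qed
  then show ?thesis by (simp add: vec_eq_iff)
qed

lemma on_qubit_S_gate: "on_qubit j S_gate = diagm (sph j)"
proof -
  have "on_qubit j S_gate $ x $ y = diagm (sph j) $ x $ y" for x y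
  proof (cases "x = y")
    case False
    then have "\<not> ((\<forall>l. l \<noteq> j \<longrightarrow> x l = y l) \<and> x j = y j)" by (auto simp: fun_eq_iff)
    then show ?thesis using False by (auto simp: on_qubit_def diagm_def S_gate_def)
  qed (simp add: on_qubit_def diagm_def S_gate_def sph_def)
  then show ?thesis by (simp add: vec_eq_iff)
qed

lemma sum_on_qubit_Z:
  "(\<Sum>j\<in>UNIV. on_qubit j pauli_Z) = diagm (\<lambda>x :: 'n::finite bits. of_int (int CARD('n) - 2 * int (hamming_weight x)))"
proof -
  have entry: "on_qubit j pauli_Z $ x $ y = (if x = y then if x j then - 1 else 1 else 0)" for j and x y :: "'n bits"
  proof (cases "x = y")
    case False
    then have "\<not> ((\<forall>l. l \<noteq> j \<longrightarrow> x l = y l) \<and> x j = y j)" by (auto simp: fun_eq_iff)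
    then show ?thesis using False by (auto simp: on_qubit_def pauli_Z_def)
  qed (simp add: on_qubit_def pauli_Z_def)
  have "(\<Sum>j\<in>UNIV. if x j then - 1 else (1 :: complex)) = of_int (int CARD('n) - 2 * int (hamming_weight x))"
    for x :: "'n bits"
  proof -
    have c: "int (card {j. x j}) + int (card {j. \<not> x j}) = int CARD('n)"
      using card_Un_disjoint[of "{j. x j}" "{j. \<not> x j}"]
      by (simp add: disjoint_iff Un_def flip: of_nat_add)
    have "(\<Sum>j\<in>UNIV. if x j then - 1 else (1 :: complex)) = of_int (int (card {j. \<not> x j}) - int (card {j. x j}))"
      by (simp add: sum.If_cases Collect_neg_eq)
    also have "int (card {j. \<not> x j}) - int (card {j. x j}) = int CARD('n) - 2 * int (hamming_weight x)"
      using c by (simp add: hamming_weight_def)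
    finally show ?thesis .
  qed
  then show ?thesis by (simp add: vec_eq_iff entry diagm_def)
qed

lemma on_all_X_entry: "on_all pauli_X $ x $ y = (if y = flip x then 1 else 0)"
proof (cases "y = flip x")
  case True
  then show ?thesis by (simp add: on_all_def pauli_X_def flip_def)
next
  case False
  then obtain j where "x j = y j" by (auto simp: flip_def fun_eq_iff)
  then show ?thesis using False
    by (auto simp: on_all_def pauli_X_def intro!: prod_zero)
qed

section \<open>The symmetric groups\<close>

text \<open>The projection onto the \<open>s\<close>-eigenspace of $X^{\otimes n}$ in the sector of weight \<open>m\<close>,
  for \<open>s = 1\<close> or \<open>s = - 1\<close> and \<open>2 * m = n\<close>.\<close>

definition sproj :: "nat \<Rightarrow> complex \<Rightarrow> 'n::finite qop" where
  "sproj m s = (\<chi> x y. if hamming_weight x = m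
     then ((if y = x then 1 else 0) + s * (if y = flip x then 1 else 0)) / 2 else 0)"

abbreviation wproj :: "nat \<Rightarrow> 'n::finite qop" where
  "wproj m \<equiv> dproj {x. hamming_weight x = m}"

lemma hamming_weight_flip: "hamming_weight x + hamming_weight (flip x) = CARD('n)"
  for x :: "'n::finite bits"
  using card_Un_disjoint[of "{j. x j}" "{j. \<not> x j}"]
  by (simp add: hamming_weight_def flip_def disjoint_iff Un_def)

lemma hamming_weight_le: "hamming_weight x \<le> CARD('n)" for x :: "'n::finite bits"
  using hamming_weight_flip[of x] by linarith

lemma sproj_mult_entry: "(sproj m s ** A) $ x $ y =
  (if hamming_weight x = m then (A $ x $ y + s * A $ flip x $ y) / 2 else 0)"
proof -
  have "(sproj m s ** A) $ x $ y = (\<Sum>k\<in>UNIV. (if k = x then (if hamming_weight x = m then A $ k $ y / 2 else 0) else 0) +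
      (if k = flip x then (if hamming_weight x = m then s * A $ k $ y / 2 else 0) else 0))"
    unfolding matrix_mult_entry by (intro sum.cong) (auto simp: sproj_def)
  then show ?thesis by (simp add: sum.distrib add_divide_distrib)
qed

lemma mult_sproj_entry:
  fixes A :: "'n::finite qop"
  assumes "2 * m = CARD('n)"
  shows "(A ** sproj m s) $ x $ y =
    (if hamming_weight y = m then (A $ x $ y + s * A $ x $ flip y) / 2 else 0)"
proof -
  have *: "hamming_weight (flip y) = m \<longleftrightarrow> hamming_weight y = m"
    using hamming_weight_flip[of y] assms by linarith
  have "y = flip k \<longleftrightarrow> k = flip y" for k by (metis flip_flip)
  then have "(A ** sproj m s) $ x $ y = (\<Sum>k\<in>UNIV. (if k = y then (if hamming_weight y = m then A $ x $ k / 2 else 0) else 0) +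
      (if k = flip y then (if hamming_weight y = m then s * A $ x $ k / 2 else 0) else 0))"
    unfolding matrix_mult_entry by (intro sum.cong) (auto simp: sproj_def *)
  then show ?thesis by (simp add: sum.distrib add_divide_distrib)
qed

lemma sproj_idem:
  fixes m :: nat
  assumes "2 * m = CARD('n::finite)" "s * s = 1"
  shows "sproj m s ** sproj m s = (sproj m s :: 'n qop)"
proof -
  have *: "hamming_weight (flip x) = m \<longleftrightarrow> hamming_weight x = m" for x :: "'n bits"
    using hamming_weight_flip[of x] assms by linarith
  have "(sproj m s ** sproj m s) $ x $ y = (sproj m s :: 'n qop) $ x $ y" for x y
    unfolding sproj_mult_entry using assms(2)
    by (cases "y = x"; cases "y = flip x") (auto simp: sproj_def * field_simps)
  then show ?thesis by (simp add: vec_eq_iff)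
qed

text \<open>The total Z is diagonal with eigenvalue n - 2 m on weight m, and these values are
  distinct for distinct weights.\<close>

lemma U1_symmetric_iff:
  "U1_symmetric V \<longleftrightarrow> (\<forall>x y. hamming_weight x \<noteq> hamming_weight y \<longrightarrow> V $ x $ y = 0)"
proof -
  have "V $ x $ y * of_int (int n - 2 * int a) = of_int (int n - 2 * int b) * V $ x $ y \<longleftrightarrow> (a \<noteq> b \<longrightarrow> V $ x $ y = 0)"
    for x y and n a b :: nat
  proof -
    have "(of_int (int n - 2 * int a) = (of_int (int n - 2 * int b) :: complex)) \<longleftrightarrow> a = b"
      unfolding of_int_eq_iff by auto
    then show ?thesis by (simp only: mult.commute[of "V $ x $ y"] mult_cancel_right) blast
  qed
  then show ?thesis
    unfolding U1_symmetric_def sum_on_qubit_Z vec_eq_iff mult_diagm_entry diagm_mult_entry by metis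
qed

lemma U1_symmetric_iff_wproj: "U1_symmetric V \<longleftrightarrow> (\<forall>m. V ** wproj m = wproj m ** V)"
  unfolding U1_symmetric_iff commute_dproj_iff by auto

lemma on_all_X_mult: "(on_all pauli_X ** A) $ x $ y = A $ flip x $ y"
proof -
  have "(on_all pauli_X ** A) $ x $ y = (\<Sum>k\<in>UNIV. if k = flip x then A $ k $ y else 0)"
    unfolding matrix_mult_entry by (intro sum.cong) (auto simp: on_all_X_entry)
  then show ?thesis by simp
qed

lemma mult_on_all_X: "(A ** on_all pauli_X) $ x $ y = A $ x $ flip y"
proof -
  have "y = flip k \<longleftrightarrow> k = flip y" for k by (metis flip_flip)
  then have "(A ** on_all pauli_X) $ x $ y = (\<Sum>k\<in>UNIV. if k = flip y then A $ x $ k else 0)"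
    unfolding matrix_mult_entry by (intro sum.cong) (auto simp: on_all_X_entry)
  then show ?thesis by simp
qed

lemma X_symmetric_iff:
  "on_all pauli_X ** V ** on_all pauli_X = V \<longleftrightarrow> (\<forall>x y. V $ flip x $ flip y = V $ x $ y)"
  unfolding vec_eq_iff mult_on_all_X on_all_X_mult ..

lemma X_symmetric_iff_commute:
  "on_all pauli_X ** V ** on_all pauli_X = V \<longleftrightarrow> V ** on_all pauli_X = on_all pauli_X ** V"
  unfolding vec_eq_iff mult_on_all_X on_all_X_mult by (metis flip_flip)

lemma commute_sproj:
  fixes V :: "'n::finite qop"
  assumes "2 * m = CARD('n)" and V: "U1_symmetric V" "on_all pauli_X ** V ** on_all pauli_X = V"
  shows "V ** sproj m s = sproj m s ** V"
proof -
  have *: "hamming_weight (flip x) = m \<longleftrightarrow> hamming_weight x = m" for x :: "'n bits"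
    using hamming_weight_flip[of x] assms by linarith
  have f: "V $ flip x $ y = V $ x $ flip y" for x y
    using V(2) unfolding X_symmetric_iff by (metis flip_flip)
  have z: "V $ x $ y = 0" if "hamming_weight x \<noteq> hamming_weight y" for x y
    using V(1) that unfolding U1_symmetric_iff by blast
  have "(V ** sproj m s) $ x $ y = (sproj m s ** V) $ x $ y" for x y
    unfolding mult_sproj_entry[OF assms(1)] sproj_mult_entry f
    using z[of x y] z[of x "flip y"] *[of y] by auto
  then show ?thesis by (simp add: vec_eq_iff)
qed

lemma dproj_vec: "(dproj S *v v) $ x = (if x \<in> S then v $ x else 0)"
proof -
  have "(dproj S *v v) $ x = (\<Sum>k\<in>UNIV. if k = x then if x \<in> S then v $ x else 0 else 0)"
    unfolding matrix_vector_mult_def vec_lambda_beta by (intro sum.cong) (auto simp: dproj_def)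
  then show ?thesis by simp
qed

lemma sector_eq: "sector m = {v :: complex^('n::finite bits). wproj m *v v = v}"
proof
  have "vec.subspace {v :: complex^('n bits). wproj m *v v = v}"
    unfolding vec.subspace_def
    by (auto simp: matrix_vector_right_distrib vector_scalar_commute)
  moreover have "wproj m *v axis x 1 = (axis x 1 :: complex^_)" if "hamming_weight x = m" for x :: "'n bits"
    using that by (auto simp: vec_eq_iff dproj_vec axis_def)
  ultimately show "sector m \<subseteq> {v :: complex^('n bits). wproj m *v v = v}"
    unfolding sector_def by (intro vec.span_minimal) auto
next
  show "{v :: complex^('n bits). wproj m *v v = v} \<subseteq> sector m"
  proof
    fix v :: "complex^('n bits)" assume "v \<in> {v. wproj m *v v = v}"
    then have z: "v $ x = 0" if "hamming_weight x \<noteq> m" for x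
      using that dproj_vec[of "{x. hamming_weight x = m}" v x] by auto
    have "(\<Sum>x\<in>UNIV. v $ x *s axis x 1) \<in> sector m"
      unfolding sector_def
    proof (rule vec.span_sum)
      fix x :: "'n bits"
      show "v $ x *s axis x 1 \<in> vec.span {axis x 1 |x. hamming_weight x = m}"
        using z[of x] by (cases "hamming_weight x = m") (auto intro: vec.span_scale vec.span_base vec.span_zero)
    qed
    then show "v \<in> sector m" by (simp add: basis_expansion)
  qed
qed

lemma restrict_det_sector:
  "U1_symmetric V \<Longrightarrow> restrict_det V (sector m) = pdet (wproj m) V"
  by (intro restrict_det_eq_pdet dproj_idem sector_eq) (simp add: U1_symmetric_iff_wproj)

lemma restrict_det_eigenspace:
  fixes V :: "'n::finite qop"
  assumes m: "2 * m = CARD('n)" and s: "s * s = 1"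
    and V: "U1_symmetric V" "on_all pauli_X ** V ** on_all pauli_X = V"
  shows "restrict_det V (sector m \<inter> X_eigenspace s) = pdet (sproj m s) V"
proof (intro restrict_det_eq_pdet sproj_idem[OF m s] commute_sproj[OF m V])
  have X: "(on_all pauli_X *v v) $ x = v $ flip x" for v :: "complex^('n bits)" and x
  proof -
    have "(on_all pauli_X *v v) $ x = (\<Sum>k\<in>UNIV. if k = flip x then v $ k else 0)"
      unfolding matrix_vector_mult_def vec_lambda_beta by (intro sum.cong) (auto simp: on_all_X_entry)
    then show ?thesis by simp
  qed
  have P: "(sproj m s *v v) $ x = (if hamming_weight x = m then (v $ x + s * v $ flip x) / 2 else 0)"
    for v :: "complex^('n bits)" and x
  proof -
    have "(sproj m s *v v) $ x = (\<Sum>k\<in>UNIV. (if k = x then (if hamming_weight x = m then v $ k / 2 else 0) else 0) +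
      (if k = flip x then (if hamming_weight x = m then s * v $ k / 2 else 0) else 0))"
      unfolding matrix_vector_mult_def vec_lambda_beta by (intro sum.cong) (auto simp: sproj_def)
    then show ?thesis by (simp add: sum.distrib add_divide_distrib)
  qed
  have fw: "hamming_weight (flip x) = m \<longleftrightarrow> hamming_weight x = m" for x :: "'n bits"
    using hamming_weight_flip[of x] m by linarith
  have "(wproj m *v v = v \<and> on_all pauli_X *v v = s *s v) \<longleftrightarrow> sproj m s *v v = v" for v :: "complex^('n bits)"
  proof -
    have "((if hamming_weight x = m then v $ x else 0) = v $ x \<and> v $ flip x = s * v $ x) \<longleftrightarrow>
      (if hamming_weight x = m then (v $ x + s * v $ flip x) / 2 else 0) = v $ x"
      if z: "hamming_weight x \<noteq> m \<Longrightarrow> v $ flip x = 0" for x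
    proof (cases "hamming_weight x = m")
      case True
      have "v $ flip x = s * v $ x \<longleftrightarrow> (v $ x + s * v $ flip x) / 2 = v $ x"
      proof
        assume "v $ flip x = s * v $ x"
        then have "s * v $ flip x = v $ x" using s by (simp flip: mult.assoc)
        then show "(v $ x + s * v $ flip x) / 2 = v $ x" by simp
      next
        assume "(v $ x + s * v $ flip x) / 2 = v $ x"
        then have "s * v $ flip x = v $ x" by (simp add: field_simps)
        then have "s * (s * v $ flip x) = s * v $ x" by simp
        then show "v $ flip x = s * v $ x" using s by (simp flip: mult.assoc)
      qed
      then show ?thesis using True by simp
    qed (use z in auto)
    then have "(wproj m *v v = v \<and> on_all pauli_X *v v = s *s v) \<longleftrightarrow> sproj m s *v v = v"
      if "\<And>x. hamming_weight x \<noteq> m \<Longrightarrow> v $ flip x = 0"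
      unfolding vec_eq_iff dproj_vec X P vector_smult_component mem_Collect_eq using that by metis
    \<comment> \<open>Strings of weight other than m have mirror images of weight other than m, so
      either side of the equivalence yields the side condition used above.\<close>
    moreover have "v $ flip x = 0"
      if "wproj m *v v = v \<or> sproj m s *v v = v" "hamming_weight x \<noteq> m" for x
      using that fw[of x] dproj_vec[of "{x. hamming_weight x = m}" v "flip x"] P[of v "flip x"] by auto
    ultimately show ?thesis by metis
  qed
  then show "sector m \<inter> X_eigenspace s = {v :: complex^('n bits). sproj m s *v v = v}"
    by (auto simp: sector_eq X_eigenspace_def)
qed

text \<open>The common form of \<open>SV_U1\<close> and \<open>G_group\<close>: the commutant of
  \<C> with unit determinants on the projections in \<P>. That the projections commute with this
  commutant makes the determinants multiplicative.\<close>

lemma matrix_group_pdet: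
  assumes idem: "\<And>P. P \<in> \<P> \<Longrightarrow> P ** P = P"
    and comm: "\<And>V P. (\<And>C. C \<in> \<C> \<Longrightarrow> V ** C = C ** V) \<Longrightarrow> P \<in> \<P> \<Longrightarrow> V ** P = P ** V"
  shows "matrix_group {V. unitary V \<and> (\<forall>C\<in>\<C>. V ** C = C ** V) \<and> (\<forall>P\<in>\<P>. pdet P V = 1)}"
proof
  fix A B assume A: "A \<in> {V. unitary V \<and> (\<forall>C\<in>\<C>. V ** C = C ** V) \<and> (\<forall>P\<in>\<P>. pdet P V = 1)}"
  have adj: "adjoint_mat A ** C = C ** adjoint_mat A" if "C \<in> \<C>" for C
    using A that by (intro unitary_commute_adjoint) auto
  have "pdet P (adjoint_mat A) = 1" if "P \<in> \<P>" for P
  proof -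
    have "pdet P (A ** adjoint_mat A) = pdet P A * pdet P (adjoint_mat A)"
      by (rule pdet_mult[OF idem[OF that] comm[OF adj that]])
    then show ?thesis using A that by (simp add: unitary_def)
  qed
  then show "adjoint_mat A \<in> {V. unitary V \<and> (\<forall>C\<in>\<C>. V ** C = C ** V) \<and> (\<forall>P\<in>\<P>. pdet P V = 1)}"
    using A adj by (auto simp: unitary_adjoint)
  assume B: "B \<in> {V. unitary V \<and> (\<forall>C\<in>\<C>. V ** C = C ** V) \<and> (\<forall>P\<in>\<P>. pdet P V = 1)}"
  have "A ** B ** C = C ** (A ** B)" if "C \<in> \<C>" for C
    using A B that by (intro matrix_commute_mult) auto
  moreover have "pdet P (A ** B) = 1" if "P \<in> \<P>" for P
    using A B that pdet_mult[OF idem[OF that] comm[OF _ that], of B A] by auto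
  ultimately show "A ** B \<in> {V. unitary V \<and> (\<forall>C\<in>\<C>. V ** C = C ** V) \<and> (\<forall>P\<in>\<P>. pdet P V = 1)}"
    using A B by (auto simp: unitary_mult)
qed auto

lemma SV_U1_iff:
  "V \<in> SV_U1 \<longleftrightarrow> unitary V \<and> U1_symmetric V \<and> (\<forall>m\<le>CARD('n). pdet (wproj m) V = 1)"
  for V :: "'n::finite qop"
  by (auto simp: SV_U1_def restrict_det_sector)

lemma G_group_iff:
  "V \<in> G_group \<longleftrightarrow> unitary V \<and> U1_symmetric V \<and> on_all pauli_X ** V ** on_all pauli_X = V \<and>
     (\<forall>m\<le>CARD('n). pdet (wproj m) V = 1) \<and>
     (\<forall>m s. 2 * m = CARD('n) \<and> (s = 1 \<or> s = - 1) \<longrightarrow> pdet (sproj m s) V = 1)"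
  for V :: "'n::finite qop"
proof -
  have "(even CARD('n) \<longrightarrow> restrict_det V (sector (CARD('n) div 2) \<inter> X_eigenspace 1) = 1 \<and>
                    restrict_det V (sector (CARD('n) div 2) \<inter> X_eigenspace (- 1)) = 1) \<longleftrightarrow>
    (\<forall>m s. 2 * m = CARD('n) \<and> (s = 1 \<or> s = - 1) \<longrightarrow> pdet (sproj m s) V = 1)"
    if V: "U1_symmetric V" "on_all pauli_X ** V ** on_all pauli_X = V"
  proof (cases "even CARD('n)")
    case True
    then have m: "2 * (CARD('n) div 2) = CARD('n)" by simp
    then have "2 * m = CARD('n) \<longleftrightarrow> m = CARD('n) div 2" for m by linarith
    then show ?thesis
      using True restrict_det_eigenspace[OF m _ V, of 1] restrict_det_eigenspace[OF m _ V, of "- 1"] by auto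
  next
    case False
    then have "2 * m \<noteq> CARD('n)" for m by (metis dvd_triv_left)
    then show ?thesis using False by auto
  qed
  then show ?thesis by (auto simp: G_group_def restrict_det_sector)
qed

lemma G_group_subset_SV_U1: "G_group \<subseteq> SV_U1"
  by (auto simp: G_group_iff SV_U1_iff)

lemma matrix_group_SV_U1: "matrix_group (SV_U1 :: 'n::finite qop set)"
proof -
  have "SV_U1 = {V :: 'n qop. unitary V \<and> (\<forall>C\<in>range wproj. V ** C = C ** V) \<and>
      (\<forall>P\<in>wproj ` {..CARD('n)}. pdet P V = 1)}"
    by (auto simp: SV_U1_iff U1_symmetric_iff_wproj)
  also have "matrix_group \<dots>"
    by (rule matrix_group_pdet) (auto simp: dproj_idem)
  finally show ?thesis .
qed

lemma matrix_group_G_group: "matrix_group (G_group :: 'n::finite qop set)"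
proof -
  have "G_group = {V :: 'n qop. unitary V \<and> (\<forall>C\<in>insert (on_all pauli_X) (range wproj). V ** C = C ** V) \<and>
      (\<forall>P\<in>wproj ` {..CARD('n)} \<union> {sproj m s |m s. 2 * m = CARD('n) \<and> (s = 1 \<or> s = - 1)}. pdet P V = 1)}"
    unfolding set_eq_iff G_group_iff U1_symmetric_iff_wproj X_symmetric_iff_commute by auto
  also have "matrix_group \<dots>"
  proof (rule matrix_group_pdet)
    fix P :: "'n qop"
    assume P: "P \<in> wproj ` {..CARD('n)} \<union> {sproj m s |m s. 2 * m = CARD('n) \<and> (s = 1 \<or> s = - 1)}"
    then show "P ** P = P" by (auto simp: dproj_idem sproj_idem)
    fix V :: "'n qop" assume V: "\<And>C. C \<in> insert (on_all pauli_X) (range wproj) \<Longrightarrow> V ** C = C ** V"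
    then have "U1_symmetric V" "on_all pauli_X ** V ** on_all pauli_X = V"
      unfolding U1_symmetric_iff_wproj X_symmetric_iff_commute by auto
    then show "V ** P = P ** V" using P V by (auto simp: commute_sproj)
  qed
  finally show ?thesis .
qed

lemma xy_mem_G_group:
  fixes j k :: "'n::finite"
  assumes card: "CARD('n) \<ge> 3" and jk: "j \<noteq> k"
  shows "xy j k t \<in> G_group"
proof -
  obtain l where l: "l \<noteq> j" "l \<noteq> k" using third_index[OF card] by metis
  have U1: "U1_symmetric (xy j k t)" for t
    unfolding U1_symmetric_iff xy_def hop_entry by (auto simp: hamming_weight_swp)
  have X: "on_all pauli_X ** xy j k t ** on_all pauli_X = xy j k t" for t
    unfolding X_symmetric_iff xy_def hop_entry by (simp add: flip_apply flip: flip_swp)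
  define z where "z = (\<lambda>(x :: 'n bits) i. if x i then - 1 else (1 :: complex))"
  \<comment> \<open>Z_j alone would invert the hopping but anticommutes with the spin flip; the
    additional Z_l off the pair restores commutation, and so D commutes with the projections
    \<open>sproj\<close>.\<close>
  define D where "D = diagm (\<lambda>x. z x j * z x l)"
  have DD: "D ** D = mat 1" unfolding D_def by (rule diagm_involution) (simp add: z_def)
  have "D ** xy j k t = xy j k (- t) ** D" for t
    unfolding D_def monomial_id[symmetric] xy_def
  proof (rule monomial_hop_intertwine)
    fix x :: "'n bits"
    show "\<i> * complex_of_real (sin (if x j \<noteq> x k then - t else 0)) * (z x j * z x l) =
      \<i> * complex_of_real (sin (if x j \<noteq> x k then t else 0)) * (z (swp j k x) j * z (swp j k x) l)"
      using l by (simp add: z_def swp_simps)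
    show "z x j * z x l \<noteq> 0" by (simp add: z_def)
  qed auto
  then have conj: "D ** xy j k t ** D = xy j k (- t)" for t
    using DD by (metis matrix_mul_assoc matrix_mul_rid)
  have D1: "U1_symmetric D" unfolding U1_symmetric_iff by (auto simp: D_def diagm_def)
  have D2: "on_all pauli_X ** D ** on_all pauli_X = D"
    unfolding X_symmetric_iff by (simp add: D_def diagm_def z_def flip_apply)
  have inv: "xy j k t ** xy j k (- t) = mat 1" for t by (simp add: xy_mult xy_0)
  have det: "pdet P (xy j k t) = 1" if P: "P ** P = P" "\<And>t. xy j k t ** P = P ** xy j k t" "D ** P = P ** D" for P
  proof -
    have "pdet P (xy j k (t / 2) ** xy j k (t / 2)) = 1"
      by (rule pdet_eq_1_of_sqrt[OF P(1) P(2) P(2) P(3) P(3) inv DD conj])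
    then show ?thesis by (simp add: xy_mult)
  qed
  show ?thesis
    unfolding G_group_iff
  proof (intro conjI allI impI)
    show "unitary (xy j k t)" by (rule unitary_xy)
    show "U1_symmetric (xy j k t)" by (rule U1)
    show "on_all pauli_X ** xy j k t ** on_all pauli_X = xy j k t" by (rule X)
    show "pdet (wproj m) (xy j k t) = 1" for m
      using U1 D1 by (intro det dproj_idem) (simp_all add: U1_symmetric_iff_wproj)
    show "pdet (sproj m s) (xy j k t) = 1" if "2 * m = CARD('n) \<and> (s = 1 \<or> s = - 1)" for m s
      using that U1 X D1 D2 by (intro det sproj_idem commute_sproj) auto
  qed
qed

section \<open>The eigenbasis of the spin flip\<close>

text \<open>On the span of \<open>x\<close> and \<open>flip x\<close> with weight $n/2$ this is a Hadamard matrix, mapping the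
  index with bit \<open>c\<close> set to the symmetric combination and the other one to the antisymmetric
  combination. On all other weights it is the identity.\<close>

definition half_weight :: "'n::finite bits \<Rightarrow> bool" where
  "half_weight x \<longleftrightarrow> 2 * hamming_weight x = CARD('n)"

definition had_diag :: "'n \<Rightarrow> 'n::finite bits \<Rightarrow> complex" where
  "had_diag c x = (if half_weight x then if x c then of_real (1 / sqrt 2) else - of_real (1 / sqrt 2) else 1)"

definition had_off :: "'n::finite bits \<Rightarrow> complex" where
  "had_off x = (if half_weight x then of_real (1 / sqrt 2) else 0)"

definition had :: "'n \<Rightarrow> 'n::finite qop" where
  "had c = (\<chi> x y. (if y = x then had_diag c x else 0) + (if y = flip x then had_off x else 0))"

lemma half_weight_flip [simp]: "half_weight (flip x) = half_weight x"
  using hamming_weight_flip[of x] unfolding half_weight_def by linarith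

lemma had_off_flip [simp]: "had_off (flip x) = had_off x"
  by (simp add: had_off_def)

lemma had_left: "(had c ** A) $ x $ y = had_diag c x * A $ x $ y + had_off x * A $ flip x $ y"
  unfolding matrix_mult_entry had_def
  by (simp only: vec_lambda_beta distrib_right sum.distrib if_distrib[of "\<lambda>x. x * _"]
      mult_zero_left sum.delta' sum.delta finite UNIV_I if_True cong: if_cong)

lemma had_right: "(A ** had c) $ x $ y = A $ x $ y * had_diag c y + A $ x $ flip y * had_off y"
proof -
  have *: "y = flip k \<longleftrightarrow> k = flip y" for k by (metis flip_flip)
  show ?thesis
    unfolding matrix_mult_entry had_def
    by (simp only: vec_lambda_beta distrib_left sum.distrib if_distrib[of "\<lambda>x. _ * x"]
      mult_zero_right sum.delta' sum.delta finite UNIV_I if_True * had_off_flip cong: if_cong)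
qed

lemma had_entry: "had c $ x $ y = (if y = x then had_diag c x else 0) + (if y = flip x then had_off x else 0)"
  by (simp add: had_def)

lemma half_squared: "complex_of_real (1 / sqrt 2) * complex_of_real (1 / sqrt 2) = 1 / 2"
  by (simp flip: of_real_mult)

lemma had_had: "had c ** had c = mat 1"
proof -
  have "(had c ** had c) $ x $ y = mat 1 $ x $ y" for x y
    unfolding had_left had_entry mat_1_entry
    by (cases "half_weight x"; cases "y = x"; cases "y = flip x")
       (auto simp: had_diag_def had_off_def flip_apply half_squared simp del: of_real_divide)
  then show ?thesis by (simp add: vec_eq_iff)
qed

lemma adjoint_had: "adjoint_mat (had c) = had c"
proof -
  have *: "x = flip y \<longleftrightarrow> y = flip x" for x y by (metis flip_flip)
  have "cnj (had c $ y $ x) = had c $ x $ y" for x y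
    unfolding had_entry *[of x y] by (auto simp: had_diag_def had_off_def)
  then show ?thesis by (simp add: adjoint_mat_def vec_eq_iff)
qed

lemma matrix_group_conj:
  assumes K: "matrix_group K" and C: "C ** C = mat 1" "adjoint_mat C = C"
  shows "matrix_group {A. C ** A ** C \<in> K}"
proof
  have C_mult: "C ** (A ** B) ** C = (C ** A ** C) ** (C ** B ** C)" for A B
  proof -
    have "(C ** A ** C) ** (C ** B ** C) = C ** A ** (C ** C) ** B ** C" by (simp add: matrix_mul_assoc)
    then show ?thesis by (simp add: C matrix_mul_assoc)
  qed
  show "mat 1 \<in> {A. C ** A ** C \<in> K}" using C matrix_group.one[OF K] by simp
  fix A assume A: "A \<in> {A. C ** A ** C \<in> K}"
  show "A ** B \<in> {A. C ** A ** C \<in> K}" if "B \<in> {A. C ** A ** C \<in> K}" for B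
    using A that matrix_group.mult[OF K] by (simp add: C_mult)
  show "adjoint_mat A \<in> {A. C ** A ** C \<in> K}"
    using A matrix_group.adj[OF K, of "C ** A ** C"] by (simp add: adjoint_mat_mult C matrix_mul_assoc)
  have uC: "unitary C" by (simp add: unitary_def C)
  have "unitary (C ** A ** C)" using A matrix_group.unit[OF K] by blast
  then have "unitary (C ** (C ** A ** C) ** C)"
    by (rule unitary_mult[OF unitary_mult[OF uC] uC])
  moreover have "C ** (C ** A ** C) ** C = A"
  proof -
    have "C ** (C ** A ** C) ** C = C ** C ** A ** (C ** C)" by (simp add: matrix_mul_assoc)
    then show ?thesis by (simp add: C)
  qed
  ultimately show "unitary A" by simp
qed

lemma pdet_similar:
  assumes C: "C ** C = mat 1" and PC: "P ** C = C ** Q"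
  shows "pdet Q (C ** V ** C) = pdet P V"
proof -
  have "C ** P ** C = C ** C ** Q" by (simp add: PC flip: matrix_mul_assoc)
  then have Q: "C ** P ** C = Q" by (simp add: C)
  have "C ** V ** C ** Q = C ** (V ** P) ** C"
    by (simp add: PC flip: matrix_mul_assoc)
  then have "C ** V ** C ** Q + (mat 1 - Q) = C ** (V ** P + (mat 1 - P)) ** C"
    by (simp add: matrix_add_ldistrib matrix_mult_add_rdistrib matrix_diff_ldistrib matrix_diff_rdistrib C Q)
  then have "pdet Q (C ** V ** C) = det C * det C * pdet P V"
    by (simp add: pdet_def det_mul mult_ac)
  moreover have "det C * det C = 1" by (metis C det_I det_mul)
  ultimately show ?thesis by simp
qed

lemma wproj_had: "wproj m ** had c = had c ** wproj m"
proof -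
  have "had c $ x $ y = 0" if "(hamming_weight x = m) \<noteq> (hamming_weight y = m)" for x y
  proof -
    have "y \<noteq> x" "half_weight x \<Longrightarrow> y \<noteq> flip x"
      using that hamming_weight_flip[of x] by (auto simp: half_weight_def)
    then show ?thesis by (auto simp: had_entry had_off_def)
  qed
  then have "had c ** wproj m = wproj m ** had c"
    unfolding commute_dproj_iff mem_Collect_eq by blast
  then show ?thesis by simp
qed

text \<open>The reason for the change of basis: the eigenprojections of the spin flip become
  diagonal, with bit c recording the eigenvalue.\<close>

lemma sproj_had:
  fixes c :: "'n::finite"
  assumes m: "2 * m = CARD('n)"
  shows "sproj m (if b then 1 else - 1) ** had c = had c ** dproj {x. hamming_weight x = m \<and> x c = b}"
proof -
  have h: "half_weight x \<longleftrightarrow> hamming_weight x = m" for x :: "'n bits"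
    using m by (auto simp: half_weight_def)
  have "(sproj m (if b then 1 else - 1) ** had c) $ x $ y =
    (had c ** dproj {x. hamming_weight x = m \<and> x c = b}) $ x $ y" for x y
    unfolding sproj_mult_entry mult_dproj_entry had_entry mem_Collect_eq h[symmetric]
    using half_weight_flip[of x]
    by (cases "y = x"; cases "y = flip x"; cases b; cases "x c")
       (auto simp: had_diag_def had_off_def flip_apply)
  then show ?thesis by (simp add: vec_eq_iff)
qed

text \<open>The symmetry that remains in the eigenbasis. In the middle sector, commuting with the
  spin flip is now expressed by the block structure alone; elsewhere the basis is unchanged and the
  mirror image persists.\<close>

definition mirror :: "'n::finite bits \<Rightarrow> 'n bits" where
  "mirror x = (if half_weight x then x else flip x)"

text \<open>In the middle sector the second component is the eigenvalue of the flip; in the other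
  sectors it is constantly \<open>True\<close>.\<close>

definition label :: "'n \<Rightarrow> 'n::finite bits \<Rightarrow> nat \<times> bool" where
  "label c x = (hamming_weight x, half_weight x \<longrightarrow> x c)"

lemma half_weight_cong: "hamming_weight x = hamming_weight y \<Longrightarrow> half_weight x = half_weight y"
  for x y :: "'n::finite bits"
  by (simp add: half_weight_def)

lemma label_block_symmetry: "block_symmetry mirror (label (c :: 'n::finite))"
proof
  show "mirror (mirror x) = x" for x :: "'n bits" by (simp add: mirror_def)
  show "label c (mirror x) = label c (mirror y)" if "label c x = label c y" for x y :: "'n bits"
    using that half_weight_cong[of x y] hamming_weight_flip[of x] hamming_weight_flip[of y]
    by (auto simp: label_def mirror_def)
  show "mirror x = x" if "label c (mirror x) = label c x" for x :: "'n bits"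
    using that hamming_weight_flip[of x] by (auto simp: label_def mirror_def half_weight_def split: if_splits)
qed

text \<open>In the middle sector, commutation with the flip removes the entries between symmetric
  and antisymmetric combinations. The blocks of \<open>label c\<close> thus correspond to the
  eigenspaces there and to the whole sectors elsewhere, matching the two kinds of determinant
  conditions.\<close>

lemma conj_had_special:
  fixes V :: "'n::finite qop"
  assumes V: "V \<in> G_group"
  shows "block_symmetry.special mirror (label c) (had c ** V ** had c)"
proof -
  interpret block_symmetry mirror "label c" by (rule label_block_symmetry)
  have unit: "unitary V" and U1: "U1_symmetric V" and X: "on_all pauli_X ** V ** on_all pauli_X = V"
    using V by (auto simp: G_group_iff)
  have z: "V $ x $ y = 0" if "hamming_weight x \<noteq> hamming_weight y" for x y
    using U1 that by (auto simp: U1_symmetric_iff)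
  have f: "V $ flip x $ flip y = V $ x $ y" for x y using X by (auto simp: X_symmetric_iff)
  have f': "V $ flip x $ y = V $ x $ flip y" for x y using f by (metis flip_flip)
  have entry: "(had c ** V ** had c) $ x $ y =
    (had_diag c x * V $ x $ y + had_off x * V $ x $ flip y) * had_diag c y +
    (had_diag c x * V $ x $ flip y + had_off x * V $ x $ y) * had_off y" for x y
    unfolding had_right had_left f f' by simp
  have simple: "(had c ** V ** had c) $ x $ y = V $ x $ y" if "\<not> half_weight x" "\<not> half_weight y" for x y
    using that unfolding entry by (simp add: had_diag_def had_off_def)
  have zero: "(had c ** V ** had c) $ x $ y = 0" if "half_weight x \<noteq> half_weight y" for x y
  proof -
    have "V $ x $ y = 0" "V $ x $ flip y = 0"
      using that half_weight_cong[of x y] half_weight_cong[of x "flip y"] by (auto intro!: z)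
    then show ?thesis unfolding entry by simp
  qed
  show ?thesis
    unfolding special_def
  proof (intro conjI allI impI)
    have "unitary (had c)" by (simp add: unitary_def adjoint_had had_had)
    then show "unitary (had c ** V ** had c)" using unit by (intro unitary_mult)
    fix x y
    show "(had c ** V ** had c) $ mirror x $ mirror y = (had c ** V ** had c) $ x $ y"
      using zero[of x y] zero[of "flip x" "y"] zero[of "x" "flip y"] simple[of x y] simple[of "flip x" "flip y"] f[of x y]
      by (cases "half_weight x"; cases "half_weight y") (simp_all add: mirror_def)
    show "(had c ** V ** had c) $ x $ y = 0" if l: "label c x \<noteq> label c y"
    proof (cases "half_weight x \<and> half_weight y")
      case True
      then have "x c \<noteq> y c" using l by (auto simp: label_def half_weight_def)
      then show ?thesis
        using True unfolding entry by (auto simp: had_diag_def had_off_def algebra_simps)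
    next
      case False
      then show ?thesis
        using l zero[of x y] simple[of x y] z[of x y]
        by (cases "half_weight x"; cases "half_weight y") (auto simp: label_def)
    qed
  next
    fix z
    show "pdet (dproj {x. label c x = label c z}) (had c ** V ** had c) = 1"
    proof (cases "half_weight z")
      case True
      define m where "m = hamming_weight z"
      have m: "2 * m = CARD('n)" using True by (simp add: m_def half_weight_def)
      have "{x. label c x = label c z} = {x. hamming_weight x = m \<and> x c = z c}"
      proof (rule Collect_cong)
        fix x show "label c x = label c z \<longleftrightarrow> hamming_weight x = m \<and> x c = z c"
          using True half_weight_cong[of x z] by (cases "hamming_weight x = m") (simp_all add: label_def m_def)
      qed
      moreover have "pdet (sproj m (if z c then 1 else - 1)) V = 1"
        using V m by (auto simp: G_group_iff)
      ultimately show ?thesis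
        using pdet_similar[OF had_had sproj_had[OF m, where b="z c" and c=c], of V] by (simp only:)
    next
      case False
      have "{x. label c x = label c z} = {x. hamming_weight x = hamming_weight z}"
      proof (rule Collect_cong)
        fix x show "label c x = label c z \<longleftrightarrow> hamming_weight x = hamming_weight z"
          using False half_weight_cong[of x z] by (cases "hamming_weight x = hamming_weight z") (simp_all add: label_def)
      qed
      moreover have "pdet (wproj (hamming_weight z)) V = 1"
        using V hamming_weight_le[of z] by (auto simp: G_group_iff)
      ultimately show ?thesis
        using pdet_similar[OF had_had wproj_had[of "hamming_weight z" c], of V] by (simp only:)
    qed
  qed
qed

text \<open>In the middle sector the mirrored rotation of x with y turns symmetric and antisymmetric
  combinations by the same angle, and that of x with \<open>flip y\<close> turns them by opposite
  angles. Their product at half angles acts on one eigenspace only. In the other sectors the change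
  of basis has no effect.\<close>

lemma conj_had_rot:
  fixes K :: "'n::finite qop set"
  assumes K: "matrix_group K"
    and rots: "\<And>x y t. hamming_weight x = hamming_weight y \<Longrightarrow> x \<noteq> y \<Longrightarrow> flip x \<noteq> y \<Longrightarrow>
      su flip x y (of_real (cos t)) (\<phi> * of_real (sin t)) \<in> K"
    and \<phi>: "norm \<phi> = 1" and xy: "x \<noteq> y" "label c x = label c y"
  shows "had c ** su mirror x y (of_real (cos t)) (\<phi> * of_real (sin t)) ** had c \<in> K"
proof -
  have hw: "hamming_weight x = hamming_weight y" using xy by (simp add: label_def)
  then have half: "half_weight x = half_weight y" by (rule half_weight_cong)
  have fxy: "flip x \<noteq> y"
    using xy hw half hamming_weight_flip[of x] by (auto simp: label_def half_weight_def flip_apply)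
  interpret good_pair flip x y using xy(1) fxy by (rule good_pair_flip)
  have h4: "half_weight u = half_weight x" if "u \<in> {x, y, flip x, flip y}" for u
    using that half by auto
  have swap: "had c ** A ** had c = B" if "had c ** A = B ** had c" for A B
    using that by (metis had_had matrix_mul_assoc matrix_mul_rid)
  show ?thesis
  proof (cases "half_weight x")
    case False
    have m: "mirror x = flip x" "mirror y = flip y" using False half by (simp_all add: mirror_def)
    have "su mirror x y a b = su flip x y a b" for a b
      unfolding su_def pair_swap_def m ..
    moreover have "had c ** su flip x y a b = su flip x y a b ** had c" for a b
    proof -
      have "(had c ** su flip x y a b) $ u $ z = (su flip x y a b ** had c) $ u $ z" for u z
      proof -
        have out: "w \<notin> {x, y, flip x, flip y}" if "half_weight w" for w
          using that h4[of w] False by blast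
        have row: "su flip x y a b $ w $ z = (if z = w then 1 else 0)" if "half_weight w" for w z
          using su_entries(5)[OF out[OF that]] .
        have col: "su flip x y a b $ w $ z = (if z = w then 1 else 0)" if "half_weight z" for w z
          using out[OF that] by (cases w rule: row_cases) (auto simp: su_entries)
        show ?thesis
          unfolding had_left had_right
          by (cases "half_weight u"; cases "half_weight z")
            (auto simp: row col had_diag_def had_off_def)
      qed
      then show ?thesis by (simp add: vec_eq_iff)
    qed
    ultimately show ?thesis using rots[OF hw xy(1) fxy] swap by metis
  next
    case True
    have xyc: "x c = y c" using True half xy by (auto simp: label_def)
    have fxy': "flip x \<noteq> flip y" "x \<noteq> flip y" using fxy xy(1) by auto
    interpret F: good_pair flip x "flip y" using fxy' by (intro good_pair_flip) auto
    interpret M: good_pair mirror x y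
      using True half xy by unfold_locales (auto simp: mirror_def)
    have fw: "hamming_weight x = hamming_weight (flip y)"
      using hw True hamming_weight_flip[of y] by (auto simp: half_weight_def)
    define g where "g = (\<lambda>s u. if u \<in> {x, y, flip x, flip y} then s else (0::real))"
    define h where "h = (\<lambda>s u. if u \<in> {x, y, flip x, flip y} then if u c then s else - s else (0::real))"
    define r where "r = complex_of_real (1 / sqrt 2)"
    define p where "p = (if x c then r else - r)"
    have had: "had_diag c x = p" "had_diag c y = p" "had_diag c (flip x) = - p" "had_diag c (flip y) = - p"
      "had_off x = r" "had_off y = r" "had_off (flip x) = r" "had_off (flip y) = r"
      using True half xyc by (auto simp: had_diag_def had_off_def p_def r_def flip_apply)
    have flip_iff: "flip u = x \<longleftrightarrow> u = flip x" "flip u = y \<longleftrightarrow> u = flip y" for u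
      by (metis flip_flip)+
    have 1: "had c ** hop (pair_swap flip x y) (pair_dirn \<phi>) (g s) ** had c \<in> K" for s
    proof -
      have "(had c ** su flip x y a b) $ u $ z = (su flip x y a b ** had c) $ u $ z" for a b u z
        using nes unfolding had_left by (cases u rule: row_cases; cases z rule: row_cases)
          (simp_all add: su_rows su_entries had_entry had flip_iff)
      then have "had c ** su flip x y a b = su flip x y a b ** had c" for a b
        by (simp add: vec_eq_iff)
      then show ?thesis
        using rots[OF hw xy(1) fxy] swap unfolding g_def su_eq_hop[symmetric] by metis
    qed
    have 2: "had c ** hop (pair_swap flip x y) (pair_dirn \<phi>) (h s) ** had c \<in> K" for s
    proof -
      have "(had c ** hop (pair_swap flip x y) (pair_dirn \<phi>) (h s)) $ u $ z =
        (su flip x (flip y) (of_real (cos s)) (\<phi> * of_real (sin s)) ** had c) $ u $ z" for u z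
        using nes xyc by (cases u rule: row_cases; cases z rule: row_cases; cases "x c")
          (auto simp: F.su_rows[unfolded flip_flip] mult_hop_entry had_entry had h_def pair_dirn_def flip_apply p_def flip_iff)
      then have "had c ** hop (pair_swap flip x y) (pair_dirn \<phi>) (h s) =
        su flip x (flip y) (of_real (cos s)) (\<phi> * of_real (sin s)) ** had c"
        by (simp add: vec_eq_iff)
      from swap[OF this] show ?thesis using rots[OF fw fxy'(2)] xy(1) by simp
    qed
    \<comment> \<open>Bit c of x tells which eigenspace is meant; the sign makes the two half angles
      add up there and cancel in the other eigenspace.\<close>
    define s where "s = (if x c then t / 2 else - t / 2)"
    have "had c ** (hop (pair_swap flip x y) (pair_dirn \<phi>) (g (t / 2)) **
      hop (pair_swap flip x y) (pair_dirn \<phi>) (h s)) ** had c \<in> K"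
      using matrix_group.mult[OF matrix_group_conj[OF K had_had adjoint_had, of c]] 1 2 by blast
    also have "hop (pair_swap flip x y) (pair_dirn \<phi>) (g (t / 2)) ** hop (pair_swap flip x y) (pair_dirn \<phi>) (h s) =
      hop (pair_swap flip x y) (pair_dirn \<phi>) (\<lambda>u. g (t / 2) u + h s u)"
      unfolding g_def h_def
      by (intro hop_mult hopping_pair[OF \<phi>] strength_pair) (use xyc in \<open>auto simp: flip_apply\<close>)
    also have "\<dots> = su mirror x y (of_real (cos t)) (\<phi> * of_real (sin t))"
      unfolding M.su_eq_hop
    proof (rule hop_cong)
      have m: "mirror x = x" "mirror y = y" using True half by (auto simp: mirror_def)
      fix u
      have G: "g (t / 2) u + h s u = (if u = x \<or> u = y then t else 0)"
        using nes xyc by (cases u rule: row_cases; cases "x c")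
          (simp_all add: g_def h_def s_def flip_apply)
      show "cos (g (t / 2) u + h s u) = cos (if u \<in> {x, y, mirror x, mirror y} then t else 0)"
        unfolding m G by simp
      show "pair_dirn \<phi> u * complex_of_real (sin (g (t / 2) u + h s u)) =
         M.pair_dirn \<phi> u * complex_of_real (sin (if u \<in> {x, y, mirror x, mirror y} then t else 0))"
        unfolding m G using nes by (cases "u = x"; cases "u = y") (simp_all add: pair_dirn_def M.pair_dirn_def m)
      show "pair_swap flip x y u = pair_swap mirror x y u" if "sin (g (t / 2) u + h s u) \<noteq> 0"
      proof -
        have "u = x \<or> u = y" using that unfolding G by (auto split: if_splits)
        then show ?thesis using nes by (auto simp: pair_swap_def)
      qed
    qed
    finally show ?thesis .
  qed
qed

section \<open>Density in the symmetric groups\<close>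

lemma xy_group_closure:
  fixes H :: "'n::finite qop set"
  assumes card: "CARD('n) \<ge> 3" and H: "matrix_group H" and gates: "sqrt_iSWAP_gates \<subseteq> H"
  shows "xy_group (closure H)"
proof -
  interpret K: matrix_group "closure H" using H by (rule matrix_group.closure)
  have gate: "xy j k (pi / 4) \<in> closure H" if "j \<noteq> k" for j k
  proof -
    have "xy j k (pi / 4) \<in> sqrt_iSWAP_gates"
      unfolding sqrt_iSWAP_gates_def on_pair_sqrt_iSWAP[OF that, symmetric] using that by blast
    then show ?thesis using gates closure_subset by blast
  qed
  show ?thesis
  proof
    fix j k :: 'n and t assume jk: "j \<noteq> k"
    obtain l where l: "l \<noteq> j" "l \<noteq> k" using third_index[OF card] by blast
    then have tq: "three_qubits j k l" using jk by (simp add: three_qubits_def)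
    show "xy j k t \<in> closure H"
      by (rule three_qubits.xy_all_angles[OF tq K.matrix_group_axioms closed_closure gate[OF jk] gate[OF l(2)[symmetric]]])
  qed
qed

lemma G_group_subset_closure:
  fixes H :: "'n::finite qop set"
  assumes card: "CARD('n) \<ge> 3" and H: "matrix_group H" and gates: "sqrt_iSWAP_gates \<subseteq> H"
  shows "G_group \<subseteq> closure H"
proof
  interpret xy_group "closure H" by (rule xy_group_closure[OF assms])
  fix V :: "'n qop" assume V: "V \<in> G_group"
  \<comment> \<open>Any qubit will do: its bit singles out one string of each pair x,
    \<open>flip x\<close>.\<close>
  fix c :: 'n
  let ?K = "{A. had c ** A ** had c \<in> closure H}"
  have mem: "su flip x y (of_real (cos t)) (\<phi> * of_real (sin t)) \<in> closure H"
    if "hamming_weight x = hamming_weight y" "x \<noteq> y" "flip x \<noteq> y" "\<phi> \<in> {1, \<i>}" for x y \<phi> t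
    by (rule su_all_mem[OF matrix_group_axioms card _ su_flip_adjacent_mem[OF card] that]) simp_all
  have "had c ** V ** had c \<in> ?K"
  proof (rule block_symmetry.special_mem[OF label_block_symmetry[of c]])
    show "matrix_group ?K" by (rule matrix_group_conj[OF matrix_group_axioms had_had adjoint_had])
    show "block_symmetry.special mirror (label c) (had c ** V ** had c)" by (rule conj_had_special[OF V])
    fix x y :: "'n bits" and \<phi> t assume xy: "x \<noteq> y" "label c x = label c y" and \<phi>: "\<phi> \<in> {1, \<i>}"
    show "su mirror x y (of_real (cos t)) (\<phi> * of_real (sin t)) \<in> ?K"
      using conj_had_rot[OF matrix_group_axioms mem[OF _ _ _ \<phi>] _ xy] \<phi> by auto
  qed
  moreover have "had c ** (had c ** V ** had c) ** had c = V"
  proof -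
    have "had c ** (had c ** V ** had c) ** had c = had c ** had c ** V ** (had c ** had c)"
      by (simp add: matrix_mul_assoc)
    then show ?thesis by (simp add: had_had)
  qed
  ultimately show "V \<in> closure H" by simp
qed

text \<open>H need not contain the S gates, only be stable under conjugation by them. This allows H
  to lie inside \<open>SV_U1\<close>.\<close>

lemma SV_U1_subset_closure:
  fixes H :: "'n::finite qop set"
  assumes card: "CARD('n) \<ge> 3" and H: "matrix_group H" and gates: "sqrt_iSWAP_gates \<subseteq> H"
    and phase: "\<And>a A. A \<in> H \<Longrightarrow> diagm (sph a) ** A ** adjoint_mat (diagm (sph a)) \<in> H"
  shows "SV_U1 \<subseteq> closure H"
proof
  interpret xy_group "closure H" by (rule xy_group_closure[OF card H gates])
  have phase': "B \<in> closure H"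
    \<comment> \<open>Stability under conjugation passes to the closure by continuity.\<close>
    if A: "A \<in> closure H" and AB: "diagm (sph a) ** A = B ** diagm (sph a)" for a A B
  proof -
    let ?D = "diagm (sph a)"
    have D: "?D ** adjoint_mat ?D = mat 1"
      by (auto simp: vec_eq_iff diagm_mult_entry mat_1_entry) (auto simp: adjoint_mat_def diagm_def sph_def)
    obtain f where f: "\<And>n. f n \<in> H" "f \<longlonglongrightarrow> A" using A by (auto simp: closure_sequential)
    have "(\<lambda>n. ?D ** f n ** adjoint_mat ?D) \<longlonglongrightarrow> ?D ** A ** adjoint_mat ?D"
      by (intro tendsto_matrix_mult f tendsto_const)
    moreover have "\<forall>n. ?D ** f n ** adjoint_mat ?D \<in> H" by (intro allI phase f(1))
    ultimately have "?D ** A ** adjoint_mat ?D \<in> closure H"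
      unfolding closure_sequential by (intro exI conjI)
    also have "?D ** A ** adjoint_mat ?D = B"
      by (simp add: AB D flip: matrix_mul_assoc)
    finally show ?thesis .
  qed
  have mem: "su id x y (of_real (cos t)) (\<phi> * of_real (sin t)) \<in> closure H"
    if "hamming_weight x = hamming_weight y" "x \<noteq> y" "\<phi> \<in> {1, \<i>}" for x y \<phi> t
    by (rule su_all_mem[OF matrix_group_axioms card _ su_id_adjacent_mem[OF card _ _ _ phase']])
      (use that in simp_all)
  interpret block_symmetry id "hamming_weight :: 'n bits \<Rightarrow> nat" by unfold_locales simp_all
  fix V :: "'n qop" assume V: "V \<in> SV_U1"
  then have "special V"
    using hamming_weight_le unfolding special_def SV_U1_iff U1_symmetric_iff by auto
  then show "V \<in> closure H" by (rule special_mem[OF matrix_group_axioms mem, rotated 3])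
qed

theorem corollary21:
  assumes "CARD('n::finite) \<ge> 3"
  shows "(\<exists>H. H \<subseteq> generate unitary_group (sqrt_iSWAP_gates \<union> S_gates :: 'n qop set) \<and>
              dense_subgroup H (SV_U1 :: 'n qop set)) \<and>
         dense_subgroup (generate unitary_group (sqrt_iSWAP_gates :: 'n qop set)) (G_group :: 'n qop set)"
proof -
  let ?G = "generate unitary_group (sqrt_iSWAP_gates :: 'n qop set)"
  let ?GS = "generate unitary_group (sqrt_iSWAP_gates \<union> S_gates :: 'n qop set)"
  note group = group_unitary_group[where 'a = "'n bits"]
  have iswap_G: "sqrt_iSWAP_gates \<subseteq> (G_group :: 'n qop set)"
    by (auto simp: sqrt_iSWAP_gates_def on_pair_sqrt_iSWAP intro: xy_mem_G_group[OF assms])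
  then have G_subset: "?G \<subseteq> G_group"
    by (intro group.generate_subgroup_incl[OF group] matrix_group_subgroup matrix_group_G_group)
  have iswap_carrier: "sqrt_iSWAP_gates \<subseteq> carrier (unitary_group :: 'n qop monoid)"
    using iswap_G by (auto simp: unitary_group_def G_group_iff)
  have S_unitary: "unitary (diagm (sph a))" for a :: 'n
    unfolding unitary_def
    by (auto simp: vec_eq_iff diagm_mult_entry mult_diagm_entry mat_1_entry)
      (auto simp: adjoint_mat_def diagm_def sph_def)
  have S_carrier: "S_gates \<subseteq> carrier (unitary_group :: 'n qop monoid)"
    using S_unitary by (auto simp: S_gates_def on_qubit_S_gate unitary_group_def)
  have sub: "subgroup ?G unitary_group" "subgroup ?GS unitary_group"
    using iswap_carrier S_carrier by (auto intro!: group.generate_is_subgroup[OF group])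
  have "G_group \<subseteq> closure ?G"
    by (rule G_group_subset_closure[OF assms subgroup_matrix_group[OF sub(1)]]) (auto intro: generate.incl)
  then have ii: "dense_subgroup ?G G_group"
    using sub(1) G_subset by (simp add: dense_subgroup_def)
  \<comment> \<open>The S gates have sector determinants other than 1, so the witness is the part of
    the generated group inside \<open>SV_U1\<close>. It is stable under conjugation by S because
    determinants are invariant under conjugation.\<close>
  let ?H = "?GS \<inter> SV_U1"
  interpret GS: matrix_group ?GS by (rule subgroup_matrix_group[OF sub(2)])
  interpret SV: matrix_group "SV_U1 :: 'n qop set" by (rule matrix_group_SV_U1)
  have H: "matrix_group ?H"
    by unfold_locales (auto intro: GS.one SV.one GS.mult SV.mult GS.adj SV.adj GS.unit)
  have "SV_U1 \<subseteq> closure ?H"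
  proof (rule SV_U1_subset_closure[OF assms H])
    show "sqrt_iSWAP_gates \<subseteq> ?H"
      using iswap_G G_group_subset_SV_U1 by (auto intro: generate.incl)
    fix a :: 'n and A :: "'n qop" assume A: "A \<in> ?H"
    let ?D = "diagm (sph a)"
    have D: "?D \<in> ?GS"
      by (rule generate.incl) (auto simp: S_gates_def simp flip: on_qubit_S_gate)
    have comm: "?D ** wproj m = wproj m ** ?D" for m
      unfolding commute_dproj_iff by (auto simp: diagm_def)
    have comm': "adjoint_mat ?D ** wproj m = wproj m ** adjoint_mat ?D" for m
      by (rule unitary_commute_adjoint[OF S_unitary comm])
    have A': "unitary A" "\<And>m. A ** wproj m = wproj m ** A" "\<And>m. m \<le> CARD('n) \<Longrightarrow> pdet (wproj m) A = 1"
      using A by (auto simp: SV_U1_iff U1_symmetric_iff_wproj)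
    have "?D ** A ** adjoint_mat ?D ** wproj m = wproj m ** (?D ** A ** adjoint_mat ?D)" for m
      by (rule matrix_commute_mult[OF matrix_commute_mult[OF comm A'(2)] comm'])
    moreover have "pdet (wproj m) (?D ** A ** adjoint_mat ?D) = 1" if "m \<le> CARD('n)" for m
      using pdet_conj[OF dproj_idem A'(2) comm comm'] S_unitary A'(3)[OF that] by (simp add: unitary_def)
    moreover have "unitary (?D ** A ** adjoint_mat ?D)"
      by (rule unitary_mult[OF unitary_mult[OF S_unitary A'(1)] unitary_adjoint[OF S_unitary]])
    ultimately have "?D ** A ** adjoint_mat ?D \<in> SV_U1"
      by (simp add: SV_U1_iff U1_symmetric_iff_wproj)
    moreover have "?D ** A ** adjoint_mat ?D \<in> ?GS"
      using A D by (intro GS.mult GS.adj) auto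
    ultimately show "?D ** A ** adjoint_mat ?D \<in> ?H" by blast
  qed
  then have "dense_subgroup ?H SV_U1"
    using matrix_group_subgroup[OF H] by (simp add: dense_subgroup_def)
  then show ?thesis using ii by blast
qed

end
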